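(* Let $X$ be a connected finite $2$-complex with a single vertex $v$, with edges $e_1,\ldots,e_n$ and $2$-cells $f_1,\ldots,f_m$ ($n,m\geq 0$), and let $k\geq 1$. Then the maps $$\Bigl\{\tau_{i_1}^{S_1}\cup\cdots\cup\tau_{i_p}^{S_p}\cup\sigma^{J}\ \Big|\ i_1<\cdots<i_p \text{ and } |J|+\textstyle\sum_q|S_q|\leq k-1\Bigr\}$$ are the characteristic maps of a cell structure for $\exp_k(X,v)$, and these maps together with $$\Bigl\{\tilde\tau_{i_1}^{S_1}\cup\cdots\cup\tilde\tau_{i_p}^{S_p}\cup\tilde\sigma^{J}\ \Big|\ i_1<\cdots<i_p \text{ and } |J|+\textstyle\sum_q|S_q|\leq k\Bigr\}$$ are the characteristic maps of a cell structure for $\exp_k X$. Here $p\geq 0$, each $S_q$ is a non-empty finite vector of positive integers, $J$ is an $n$-tuple of non-negative integers, and in the second family $p$ and $|J|$ are not both $0$.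
   Context: Finite subset spaces. $\exp_k X$ is the set of non-empty finite subsets of $X$ of size at most $k$, topologised as a quotient of $X^k$ via $(x_1,\ldots,x_k)\mapsto\{x_1,\ldots,x_k\}$; $\exp_k(X,v)\subseteq\exp_k X$ is the subspace of subsets containing $v$. A map $h\colon X\to Y$ induces $\exp_k h\colon\exp_kX\to\exp_kY$, $\Lambda\mapsto h(\Lambda)$. For maps $a\colon Y\to\exp_k X$, $b\colon Z\to\exp_l X$, the map $a\cup b\colon Y\times Z\to\exp_{k+l}X$ is $(y,z)\mapsto a(y)\cup b(z)$. The map $\cup\{v\}\colon\exp_{k}X\to\exp_{k+1}(X,v)$ is $\Lambda\mapsto\Lambda\cup\{v\}$. Complex. The $1$-skeleton of $X$ is the graph $\Gamma_n$ with vertex $v$ and edges $e_1,\ldots,e_n$, each with a characteristic map $e_i\colon[0,1]\to\Gamma_n$. Each $2$-cell $f_i$ has a characteristic map $\phi_i\colon D^2\to X$, where $D^2\subseteq\mathbf{C}$ is the closed unit disc, with $\phi_i(-1)=v$. Notation. For a vector $S=(s_1,\ldots,s_\ell)$ write $\ell(S)=\ell$ and $|S|=s_1+\cdots+s_\ell$. Let $\tilde\Delta_j=\{(x_1,\ldots,x_j):0\leq x_1\leq\cdots\leq x_j\leq 1\}$ and, for a vector $S$ of non-negative integers, let $\tilde\Delta_S=\tilde\Delta_{s_1}\times\cdots\times\tilde\Delta_{s_\ell}$, omitting factors $\tilde\Delta_0$ (so $\tilde\Delta_S$ is a ball). Graph cells. For $J=(j_1,\ldots,j_n)$ with $|J|\geq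 1$, $\tilde\sigma^J\colon\tilde\Delta_J\to\exp_{|J|}\Gamma_n$ sends a tuple of points $(x^{(i)}_1,\ldots,x^{(i)}_{j_i})\in\tilde\Delta_{j_i}$ to $\{e_i(x^{(i)}_b): 1\leq i\leq n,\ 1\leq b\leq j_i\}$. The map $\sigma^J\colon\tilde\Delta_J\to\exp_{|J|+1}(\Gamma_n,v)$ is $\tilde\sigma^J$ followed by $\cup\{v\}$; for $J=0$, $\sigma^0$ is the single point $\{v\}$. When $J=0$ in a product $\tilde\tau_{i_1}^{S_1}\cup\cdots\cup\tilde\tau_{i_p}^{S_p}\cup\tilde\sigma^J$, the factor $\tilde\sigma^J$ is omitted. Two-cell cells. Let $\kappa\colon I^2\to D^2$ be $\kappa(x,y)=x(1-e^{2\pi i y})-1$; it sends the sides $x=0$, $y=0$, $y=1$ to $-1$ and maps the rest of the square homeomorphically onto the rest of the disc. For a vector $S=(s_1,\ldots,s_\ell)$ of positive integers, $\ell\geq 1$, there is a map $\tilde\Delta_S\times\tilde\Delta_\ell\to\exp_{|S|}I^2$ sending $(y^{(1)},\ldots,y^{(\ell)};x)$, with $y^{(a)}\in\tilde\Delta_{s_a}$ and $x\in\tilde\Delta_\ell$, to $\{(x_a,y^{(a)}_b):1\leq a\leq\ell,\ 1\leq b\leq s_a\}$. Composing with $\exp_{|S|}\kappa$ and $\exp_{|S|}\phi_i$ gives $$\tilde\tau_i^S\colon\tilde\Delta_S\times\tilde\Delta_{\ell(S)}\to\exp_{|S|}X,$$ and $\tau_i^S=(\cup\{v\})\circ\tilde\tau_i^S\colon\tilde\Delta_S\times\tilde\Delta_{\ell(S)}\to\exp_{|S|+1}(X,v)$.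 The domain has dimension $|S|+\ell(S)$. *)

theory Defs
  imports "HOL-Analysis.Analysis"
begin

section \<open>Cell structures\<close>

definition disk :: "nat \<Rightarrow> (nat \<Rightarrow> real) topology" where
  "disk d = subtopology (Euclidean_space d) {x. (\<Sum>i<d. (x i)\<^sup>2) \<le> 1}"

text \<open>For \<open>d = 0\<close> the open disk is the whole one-point space \<open>disk 0\<close> and the boundary is empty.\<close>

definition open_disk :: "nat \<Rightarrow> (nat \<Rightarrow> real) set" where
  "open_disk d = {x \<in> topspace (Euclidean_space d). (\<Sum>i<d. (x i)\<^sup>2) < 1}"

definition boundary_sphere :: "nat \<Rightarrow> (nat \<Rightarrow> real) set" where
  "boundary_sphere d = {x \<in> topspace (Euclidean_space d). (\<Sum>i<d. (x i)\<^sup>2) = 1}"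

text \<open>
  A CW structure on \<open>Y\<close> presented by its characteristic maps, as in Hatcher, \<open>Algebraic Topology\<close>,
  Proposition A.2.
\<close>

definition cw_structure ::
  "'a topology \<Rightarrow> 'i set \<Rightarrow> ('i \<Rightarrow> nat) \<Rightarrow> ('i \<Rightarrow> (nat \<Rightarrow> real) \<Rightarrow> 'a) \<Rightarrow> bool" where
  "cw_structure Y I d \<Phi> \<longleftrightarrow>
     Hausdorff_space Y \<and>
     (\<forall>i\<in>I. continuous_map (disk (d i)) Y (\<Phi> i)) \<and>
     (\<forall>i\<in>I. homeomorphic_map (subtopology (disk (d i)) (open_disk (d i)))
                              (subtopology Y (\<Phi> i ` open_disk (d i))) (\<Phi> i)) \<and>
     disjoint_family_on (\<lambda>i. \<Phi> i ` open_disk (d i)) I \<and>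
     (\<Union>i\<in>I. \<Phi> i ` open_disk (d i)) = topspace Y \<and>
     (\<forall>i\<in>I. \<exists>F. finite F \<and> F \<subseteq> {j\<in>I. d j < d i} \<and>
        \<Phi> i ` boundary_sphere (d i) \<subseteq> (\<Union>j\<in>F. \<Phi> j ` open_disk (d j))) \<and>
     (\<forall>A. A \<subseteq> topspace Y \<longrightarrow>
        (\<forall>i\<in>I. closedin (disk (d i)) {x \<in> topspace (disk (d i)). \<Phi> i x \<in> A}) \<longrightarrow>
        closedin Y A)"

text \<open>
  Characteristic maps may be defined on any balls \<open>B i\<close>, identified with standard disks by
  homeomorphisms \<open>h i\<close>. The choice of \<open>h i\<close> is immaterial, because homeomorphisms of disks preserve
  the boundary sphere. The family is indexed, so distinct indices give distinct (disjoint) open cells.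
\<close>

definition cell_structure ::
  "'a topology \<Rightarrow> 'i set \<Rightarrow> ('i \<Rightarrow> nat) \<Rightarrow> ('i \<Rightarrow> 'b topology) \<Rightarrow> ('i \<Rightarrow> 'b \<Rightarrow> 'a) \<Rightarrow> bool" where
  "cell_structure Y I d B f \<longleftrightarrow>
     (\<exists>h. (\<forall>i\<in>I. homeomorphic_map (disk (d i)) (B i) (h i)) \<and>
          cw_structure Y I d (\<lambda>i. f i \<circ> h i))"


section \<open>Finite 2-complexes with a single vertex\<close>

datatype cell2 = Vertex | Edge nat | Face nat

definition cells2 :: "nat \<Rightarrow> nat \<Rightarrow> cell2 set" where
  "cells2 n m = {Vertex} \<union> Edge ` {..<n} \<union> Face ` {..<m}"

fun dim2 :: "cell2 \<Rightarrow> nat" where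
  "dim2 Vertex = 0"
| "dim2 (Edge i) = 1"
| "dim2 (Face i) = 2"

text \<open>
  The point, the unit interval and the unit disc are all placed in the complex plane, so that the
  characteristic maps of the complex have a common domain type.
\<close>

fun dom2 :: "cell2 \<Rightarrow> complex topology" where
  "dom2 Vertex = top_of_set {0}"
| "dom2 (Edge i) = top_of_set (complex_of_real ` {0..1})"
| "dom2 (Face i) = top_of_set (cball 0 1)"

fun char2 :: "'a \<Rightarrow> (nat \<Rightarrow> real \<Rightarrow> 'a) \<Rightarrow> (nat \<Rightarrow> complex \<Rightarrow> 'a) \<Rightarrow> cell2 \<Rightarrow> complex \<Rightarrow> 'a" where
  "char2 v e \<phi> Vertex = (\<lambda>_. v)"
| "char2 v e \<phi> (Edge i) = e i \<circ> Re"
| "char2 v e \<phi> (Face i) = \<phi> i"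

definition one_vertex_2_complex ::
  "'a topology \<Rightarrow> 'a \<Rightarrow> nat \<Rightarrow> (nat \<Rightarrow> real \<Rightarrow> 'a) \<Rightarrow> nat \<Rightarrow> (nat \<Rightarrow> complex \<Rightarrow> 'a) \<Rightarrow> bool" where
  "one_vertex_2_complex X v n e m \<phi> \<longleftrightarrow>
     cell_structure X (cells2 n m) dim2 dom2 (char2 v e \<phi>) \<and> (\<forall>i<m. \<phi> i (-1) = v)"


section \<open>Finite subset spaces\<close>

definition exp_set :: "nat \<Rightarrow> 'a topology \<Rightarrow> 'a set set" where
  "exp_set k X = {\<Lambda>. \<Lambda> \<subseteq> topspace X \<and> finite \<Lambda> \<and> \<Lambda> \<noteq> {} \<and> card \<Lambda> \<le> k}"

definition exp_space :: "nat \<Rightarrow> 'a topology \<Rightarrow> 'a set topology" where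
  "exp_space k X = topology (\<lambda>U. U \<subseteq> exp_set k X \<and>
     openin (product_topology (\<lambda>_. X) {..<k})
       {x \<in> topspace (product_topology (\<lambda>_. X) {..<k}). x ` {..<k} \<in> U})"

definition exp_space_at :: "nat \<Rightarrow> 'a topology \<Rightarrow> 'a \<Rightarrow> 'a set topology" where
  "exp_space_at k X v = subtopology (exp_space k X) {\<Lambda>. v \<in> \<Lambda>}"

lemma openin_exp_space:
  "openin (exp_space k X) U \<longleftrightarrow> U \<subseteq> exp_set k X \<and>
     openin (product_topology (\<lambda>_. X) {..<k})
       {x \<in> topspace (product_topology (\<lambda>_. X) {..<k}). x ` {..<k} \<in> U}"
proof -
  let ?P = "product_topology (\<lambda>_. X) {..<k}"
  let ?pre = "\<lambda>U. {x \<in> topspace ?P. x ` {..<k} \<in> U}"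
  have "istopology (\<lambda>U. U \<subseteq> exp_set k X \<and> openin ?P (?pre U))"
    unfolding istopology_def
  proof (intro conjI allI impI)
    fix S T
    assume S: "S \<subseteq> exp_set k X \<and> openin ?P (?pre S)" and T: "T \<subseteq> exp_set k X \<and> openin ?P (?pre T)"
    show "S \<inter> T \<subseteq> exp_set k X" using S by blast
    have "?pre (S \<inter> T) = ?pre S \<inter> ?pre T" by blast
    then show "openin ?P (?pre (S \<inter> T))" using S T by auto
  next
    fix K
    assume K: "\<forall>U\<in>K. U \<subseteq> exp_set k X \<and> openin ?P (?pre U)"
    show "\<Union>K \<subseteq> exp_set k X" using K by blast
    have "?pre (\<Union>K) = (\<Union>U\<in>K. ?pre U)" by blast
    then show "openin ?P (?pre (\<Union>K))" using K by (auto intro: openin_Union)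
  qed
  then show ?thesis
    by (simp add: exp_space_def)
qed

lemma image_exp_set:
  assumes "k \<ge> 1"
  shows "(\<lambda>x. x ` {..<k}) ` topspace (product_topology (\<lambda>_. X) {..<k}) = exp_set k X"
proof (intro equalityI subsetI)
  fix \<Lambda> assume "\<Lambda> \<in> (\<lambda>x. x ` {..<k}) ` topspace (product_topology (\<lambda>_. X) {..<k})"
  then obtain x where x: "x \<in> {..<k} \<rightarrow>\<^sub>E topspace X" "\<Lambda> = x ` {..<k}" by auto
  have "card \<Lambda> \<le> k" using x(2) card_image_le[of "{..<k}" x] by simp
  moreover have "\<Lambda> \<noteq> {}" using x(2) assms by (auto simp: lessThan_empty_iff)
  ultimately show "\<Lambda> \<in> exp_set k X" using x by (auto simp: exp_set_def)
next
  fix \<Lambda> assume L: "\<Lambda> \<in> exp_set k X"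
  then have fin: "finite \<Lambda>" and ne: "\<Lambda> \<noteq> {}" and sub: "\<Lambda> \<subseteq> topspace X" and c: "card \<Lambda> \<le> k"
    by (auto simp: exp_set_def)
  obtain g where g: "bij_betw g {..<card \<Lambda>} \<Lambda>"
    using ex_bij_betw_nat_finite[OF fin] by (auto simp: atLeast0LessThan)
  obtain a where a: "a \<in> \<Lambda>" using ne by blast
  let ?x = "restrict (\<lambda>i. if i < card \<Lambda> then g i else a) {..<k}"
  have gl: "g i \<in> \<Lambda>" if "i < card \<Lambda>" for i using g that by (auto simp: bij_betw_def)
  have "?x ` {..<k} = \<Lambda>"
  proof (intro equalityI subsetI)
    fix y assume "y \<in> ?x ` {..<k}" then show "y \<in> \<Lambda>" using a gl by auto
  next
    fix y assume "y \<in> \<Lambda>"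
    then obtain i where i: "i < card \<Lambda>" "y = g i" using g by (auto simp: bij_betw_def)
    then have "y = ?x i" "i < k" using c by auto
    then show "y \<in> ?x ` {..<k}" by blast
  qed
  moreover have "?x \<in> topspace (product_topology (\<lambda>_. X) {..<k})"
    using a gl sub by (auto simp: PiE_iff)
  ultimately show "\<Lambda> \<in> (\<lambda>x. x ` {..<k}) ` topspace (product_topology (\<lambda>_. X) {..<k})"
    by (metis (no_types, lifting) image_eqI)
qed

lemma topspace_exp_space:
  assumes "k \<ge> 1"
  shows "topspace (exp_space k X) = exp_set k X"
proof -
  let ?P = "product_topology (\<lambda>_. X) {..<k}"
  have "{x \<in> topspace ?P. x ` {..<k} \<in> exp_set k X} = topspace ?P"
    using image_exp_set[OF assms, of X] by blast
  then have "openin (exp_space k X) (exp_set k X)"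
    unfolding openin_exp_space by (metis openin_topspace order_refl)
  moreover have "topspace (exp_space k X) \<subseteq> exp_set k X"
    using openin_topspace[of "exp_space k X"] unfolding openin_exp_space by blast
  ultimately show ?thesis using openin_subset by blast
qed

lemma quotient_map_exp_space:
  assumes "k \<ge> 1"
  shows "quotient_map (product_topology (\<lambda>_. X) {..<k}) (exp_space k X) (\<lambda>x. x ` {..<k})"
  unfolding quotient_map_def topspace_exp_space[OF assms]
  using image_exp_set[OF assms, of X] by (auto simp: openin_exp_space)


section \<open>The cells\<close>

text \<open>All coordinates are indexed from \<open>0\<close>.\<close>

definition simplex_space :: "nat \<Rightarrow> (nat \<Rightarrow> real) topology" where
  "simplex_space j = subtopology (Euclidean_space j)
     {x. (\<forall>b<j. 0 \<le> x b \<and> x b \<le> 1) \<and> (\<forall>b c. b \<le> c \<longrightarrow> c < j \<longrightarrow> x b \<le> x c)}"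

text \<open>
  A factor of dimension \<open>0\<close> contributes a single point to the product, so it need not be removed.
\<close>

definition simplex_product :: "nat list \<Rightarrow> (nat \<Rightarrow> nat \<Rightarrow> real) topology" where
  "simplex_product S = product_topology (\<lambda>a. simplex_space (S ! a)) {..<length S}"

definition sigma_free :: "(nat \<Rightarrow> real \<Rightarrow> 'a) \<Rightarrow> nat list \<Rightarrow> (nat \<Rightarrow> nat \<Rightarrow> real) \<Rightarrow> 'a set" where
  "sigma_free e J z = {e i (z i b) | i b. i < length J \<and> b < J ! i}"

definition sigma_based :: "'a \<Rightarrow> (nat \<Rightarrow> real \<Rightarrow> 'a) \<Rightarrow> nat list \<Rightarrow> (nat \<Rightarrow> nat \<Rightarrow> real) \<Rightarrow> 'a set" where
  "sigma_based v e J z = sigma_free e J z \<union> {v}"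

definition kappa :: "real \<times> real \<Rightarrow> complex" where
  "kappa = (\<lambda>(x, y). complex_of_real x * (1 - exp (2 * complex_of_real pi * \<i> * complex_of_real y)) - 1)"

type_synonym face_point = "(nat \<Rightarrow> nat \<Rightarrow> real) \<times> (nat \<Rightarrow> real)"

definition tau_dom :: "nat list \<Rightarrow> face_point topology" where
  "tau_dom S = prod_topology (simplex_product S) (simplex_space (length S))"

definition tau_free :: "(complex \<Rightarrow> 'a) \<Rightarrow> nat list \<Rightarrow> face_point \<Rightarrow> 'a set" where
  "tau_free \<phi>i S = (\<lambda>(y, x). \<phi>i ` kappa ` {(x a, y a b) | a b. a < length S \<and> b < S ! a})"

definition tau_based :: "'a \<Rightarrow> (complex \<Rightarrow> 'a) \<Rightarrow> nat list \<Rightarrow> face_point \<Rightarrow> 'a set" where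
  "tau_based v \<phi>i S w = tau_free \<phi>i S w \<union> {v}"

text \<open>The index \<open>([(i\<^sub>1, S\<^sub>1), \<dots>, (i\<^sub>p, S\<^sub>p)], J)\<close>.\<close>

type_synonym cell_index = "(nat \<times> nat list) list \<times> nat list"

definition cell_indices :: "nat \<Rightarrow> nat \<Rightarrow> nat \<Rightarrow> cell_index set" where
  "cell_indices n m r = {(T, J).
     sorted_wrt (<) (map fst T) \<and>
     (\<forall>(i, S)\<in>set T. i < m \<and> S \<noteq> [] \<and> (\<forall>s\<in>set S. 0 < s)) \<and>
     length J = n \<and>
     sum_list J + (\<Sum>(i, S)\<leftarrow>T. sum_list S) \<le> r}"

definition free_cell_indices :: "nat \<Rightarrow> nat \<Rightarrow> nat \<Rightarrow> cell_index set" where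
  "free_cell_indices n m r = {(T, J) \<in> cell_indices n m r. \<not> (T = [] \<and> sum_list J = 0)}"

definition cell_dim :: "cell_index \<Rightarrow> nat" where
  "cell_dim = (\<lambda>(T, J). sum_list J + (\<Sum>(i, S)\<leftarrow>T. sum_list S + length S))"

type_synonym cell_point = "(nat \<Rightarrow> face_point) \<times> (nat \<Rightarrow> nat \<Rightarrow> real)"

definition cell_dom :: "cell_index \<Rightarrow> cell_point topology" where
  "cell_dom = (\<lambda>(T, J). prod_topology
     (product_topology (\<lambda>q. tau_dom (snd (T ! q))) {..<length T}) (simplex_product J))"

definition based_cell ::
  "'a \<Rightarrow> (nat \<Rightarrow> real \<Rightarrow> 'a) \<Rightarrow> (nat \<Rightarrow> complex \<Rightarrow> 'a) \<Rightarrow> cell_index \<Rightarrow> cell_point \<Rightarrow> 'a set" where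
  "based_cell v e \<phi> = (\<lambda>(T, J) (w, z).
     (\<Union>q<length T. tau_based v (\<phi> (fst (T ! q))) (snd (T ! q)) (w q)) \<union> sigma_based v e J z)"

text \<open>If \<open>J = 0\<close> then \<open>sigma_free e J z\<close> is empty, so the last factor is effectively omitted.\<close>

definition free_cell ::
  "(nat \<Rightarrow> real \<Rightarrow> 'a) \<Rightarrow> (nat \<Rightarrow> complex \<Rightarrow> 'a) \<Rightarrow> cell_index \<Rightarrow> cell_point \<Rightarrow> 'a set" where
  "free_cell e \<phi> = (\<lambda>(T, J) (w, z).
     (\<Union>q<length T. tau_free (\<phi> (fst (T ! q))) (snd (T ! q)) (w q)) \<union> sigma_free e J z)"

end

theory Submission
  imports Defs
begin

text \<open>
  All cells in question are finite in number and the space is Hausdorff, so only three things matter: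
  the domains are balls, the open cells partition the space, and boundaries land in open cells of lower
  dimension. A finite set \<open>\<Lambda>\<close> containing \<open>v\<close> is cut up by the open cells of the complex into finite
  subsets of open intervals and of open unit squares; sorting the former, and sorting the latter first
  by columns and then inside each column, gives a unique index and a unique interior point of its
  domain. The dimension of the cell so obtained is the number of points of \<open>\<Lambda>\<close> other than \<open>v\<close> plus
  the number of columns that \<open>\<Lambda>\<close> occupies in the squares. On a closed cell both numbers are at most
  the numbers of coordinates available, because the sides of the squares go to the 1-skeleton, and
  equality in both forces all coordinates to be distinct and interior. Hence the sum drops on the
  boundary. A cell not containing \<open>v\<close> is handled by adding \<open>v\<close> to it.
\<close>

subsection \<open>Balls with their interiors\<close>

text \<open>Counting points alone would not detect every boundary. The side \<open>x = 1\<close> of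
  a square may be glued along the interior of an edge, so a column that moves there can keep all its
  points distinct and away from \<open>v\<close>; and two columns can merge without any two points
  meeting. In both cases only the number of columns drops, which is why it enters the count. No face
  of a cell is ever computed. The count depends on the finite set alone and ignores
  \<open>v\<close>, and every set lies in an open cell whose dimension is its count; so the boundary
  condition for both families reduces to one strict inequality, and it does not matter whether a
  limit of sets without \<open>v\<close> acquires \<open>v\<close>. The complex is given through
  unspecified homeomorphisms from disks. Invariance of domain shows that these must carry the open
  disk onto the open interval or open unit disc, so the open cells are the expected ones. For the
  new cells homeomorphisms have to be constructed; they all come from unit balls of positively
  homogeneous functions, which need not be symmetric and so include the simplex.\<close>

definition ball_pair :: "nat \<Rightarrow> 'b topology \<Rightarrow> 'b set \<Rightarrow> bool" where
  "ball_pair d B U \<longleftrightarrow> (\<exists>h. homeomorphic_map (disk d) B h \<and> h ` open_disk d = U)"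

lemma ball_pair_homeomorphic:
  assumes "ball_pair d B U" "homeomorphic_map B C f" "f ` U = V"
  shows "ball_pair d C V"
proof -
  obtain h where h: "homeomorphic_map (disk d) B h" "h ` open_disk d = U"
    using assms(1) by (auto simp: ball_pair_def)
  have "(f \<circ> h) ` open_disk d = V"
    using h(2) assms(3) image_comp[of f h "open_disk d"] by metis
  with homeomorphic_map_compose[OF h(1) assms(2)] show ?thesis
    unfolding ball_pair_def by blast
qed

lemma Euclidean_space_eq_top_of_set: "Euclidean_space n = top_of_set {x. \<forall>i\<ge>n. x i = 0}"
  by (simp add: Euclidean_space_def euclidean_product_topology)

lemma subtopology_Euclidean_space:
  "subtopology (Euclidean_space n) S = top_of_set {x. (\<forall>i\<ge>n. x i = 0) \<and> x \<in> S}"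
  by (simp add: Euclidean_space_eq_top_of_set subtopology_subtopology Collect_conj_eq)

text \<open>
  A gauge is the radial function of a ball around the origin; two gauge balls are homeomorphic
  by rescaling along rays.
\<close>

definition gauge_on :: "nat \<Rightarrow> ((nat \<Rightarrow> real) \<Rightarrow> real) \<Rightarrow> bool" where
  "gauge_on n q \<longleftrightarrow> continuous_on UNIV q \<and> (\<forall>c x. 0 \<le> c \<longrightarrow> q (\<lambda>i. c * x i) = c * q x) \<and>
     (\<exists>M>0. \<forall>x i. (\<forall>j\<ge>n. x j = 0) \<longrightarrow> \<bar>x i\<bar> \<le> M * q x)"

lemma gauge_onD:
  assumes "gauge_on n q"
  shows "continuous_on A q" "0 \<le> c \<Longrightarrow> q (\<lambda>i. c * x i) = c * q x" "q (\<lambda>_. 0) = 0"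
    "\<forall>j\<ge>n. x j = 0 \<Longrightarrow> 0 \<le> q x" "\<forall>j\<ge>n. x j = 0 \<Longrightarrow> q x = 0 \<Longrightarrow> x = (\<lambda>_. 0)"
proof -
  show "continuous_on A q" using assms by (auto simp: gauge_on_def intro: continuous_on_subset)
  show hom: "q (\<lambda>i. c * x i) = c * q x" if "0 \<le> c" for c x using assms that by (auto simp: gauge_on_def)
  show "q (\<lambda>_. 0) = 0" using hom[of 0 "\<lambda>_. 0"] by simp
  obtain M where M: "M > 0" "\<And>x i. (\<forall>j\<ge>n. x j = 0) \<Longrightarrow> \<bar>x i\<bar> \<le> M * q x"
    using assms unfolding gauge_on_def by blast
  show "0 \<le> q x" if "\<forall>j\<ge>n. x j = 0"
    using M(2)[OF that, of 0] M(1) by (meson abs_ge_zero order_trans zero_le_mult_iff not_le)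
  show "x = (\<lambda>_. 0)" if "\<forall>j\<ge>n. x j = 0" "q x = 0"
    using M(2)[OF that(1)] that(2) by auto
qed

text \<open>The factor is chosen so that the image has \<open>q\<close>-value \<open>p x\<close>. At
  the origin the convention \<open>a / 0 = 0\<close> gives the right value.\<close>

definition rescale :: "((nat \<Rightarrow> real) \<Rightarrow> real) \<Rightarrow> ((nat \<Rightarrow> real) \<Rightarrow> real) \<Rightarrow> (nat \<Rightarrow> real) \<Rightarrow> nat \<Rightarrow> real" where
  "rescale p q x = (\<lambda>i. (p x / q x) * x i)"

lemma rescale_zero: "x i = 0 \<Longrightarrow> rescale p q x i = 0"
  by (simp add: rescale_def)

lemma gauge_rescale:
  assumes p: "gauge_on n p" and q: "gauge_on n q" and x: "\<forall>j\<ge>n. x j = 0"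
  shows "q (rescale p q x) = p x"
proof (cases "q x = 0")
  case True
  then have "x = (\<lambda>_. 0)" using gauge_onD(5)[OF q x] by simp
  then show ?thesis by (simp add: rescale_def gauge_onD(3)[OF p] gauge_onD(3)[OF q])
next
  case False
  have "0 \<le> p x / q x" using gauge_onD(4)[OF p x] gauge_onD(4)[OF q x] by simp
  from gauge_onD(2)[OF q this, of x] False show ?thesis by (simp add: rescale_def)
qed

lemma rescale_rescale:
  assumes p: "gauge_on n p" and q: "gauge_on n q" and x: "\<forall>j\<ge>n. x j = 0"
  shows "rescale q p (rescale p q x) = x"
proof (cases "x = (\<lambda>_. 0)")
  case True then show ?thesis by (simp add: rescale_def)
next
  case False
  then have nz: "p x \<noteq> 0" "q x \<noteq> 0"
    using gauge_onD(5)[OF p x] gauge_onD(5)[OF q x] by auto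
  have "0 \<le> p x / q x" using gauge_onD(4)[OF p x] gauge_onD(4)[OF q x] by simp
  from gauge_onD(2)[OF p this, of x] have "p (rescale p q x) = (p x / q x) * p x"
    by (simp add: rescale_def)
  then show ?thesis
    using nz gauge_rescale[OF p q x] by (subst rescale_def) (simp add: rescale_def fun_eq_iff)
qed

text \<open>Only the origin is delicate. There the bound in \<open>gauge_on\<close> cancels the
  denominator \<open>q x\<close> and leaves \<open>M * p x\<close>, which tends to 0.\<close>

lemma continuous_on_rescale:
  assumes p: "gauge_on n p" and q: "gauge_on n q"
  shows "continuous_on {x. \<forall>i\<ge>n. x i = 0} (rescale p q)"
proof (rule continuous_on_coordinatewise_then_product)
  fix i
  let ?E = "{x::nat \<Rightarrow> real. \<forall>i\<ge>n. x i = 0}"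
  obtain M where M: "M > 0" "\<And>x i. x \<in> ?E \<Longrightarrow> \<bar>x i\<bar> \<le> M * q x"
    using q unfolding gauge_on_def by blast
  show "continuous_on ?E (\<lambda>x. rescale p q x i)"
    unfolding continuous_on_def
  proof
    fix a assume a: "a \<in> ?E"
    have lim: "(f \<longlongrightarrow> f a) (at a within ?E)" if "continuous_on UNIV f" for f :: "(nat \<Rightarrow> real) \<Rightarrow> real"
      using that a continuous_on_subset[OF that, of ?E] by (auto simp: continuous_on_def)
    have lp: "(p \<longlongrightarrow> p a) (at a within ?E)" and lq: "(q \<longlongrightarrow> q a) (at a within ?E)"
      using lim gauge_onD(1)[OF p] gauge_onD(1)[OF q] by blast+
    have lx: "((\<lambda>x. x i) \<longlongrightarrow> a i) (at a within ?E)"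
      by (rule lim) (simp add: continuous_on_product_coordinates)
    show "((\<lambda>x. rescale p q x i) \<longlongrightarrow> rescale p q a i) (at a within ?E)"
    proof (cases "a = (\<lambda>_. 0)")
      case False
      then have "q a \<noteq> 0" using gauge_onD(5)[OF q] a by auto
      then show ?thesis unfolding rescale_def by (intro tendsto_intros lp lq lx)
    next
      case True
      have "norm (rescale p q x i) \<le> p x * M" if "x \<in> ?E" for x
      proof (cases "q x = 0")
        case True
        then show ?thesis using gauge_onD(4)[OF p, of x] that M(1) by (simp add: rescale_def)
      next
        case False
        then have "q x > 0" using gauge_onD(4)[OF q, of x] that by force
        then have "\<bar>x i\<bar> / q x \<le> M" using M(2)[OF that, of i] by (simp add: field_simps)
        then have "p x * (\<bar>x i\<bar> / q x) \<le> p x * M"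
          using gauge_onD(4)[OF p, of x] that by (intro mult_left_mono) auto
        then show ?thesis
          using gauge_onD(4)[OF p, of x] that \<open>q x > 0\<close> by (simp add: rescale_def abs_mult)
      qed
      then have "\<forall>\<^sub>F x in at a within ?E. norm (rescale p q x i) \<le> p x * M"
        by (simp add: eventually_at_filter)
      moreover have "((\<lambda>x. p x * M) \<longlongrightarrow> 0) (at a within ?E)"
        using tendsto_mult_right[OF lp, of M] gauge_onD(3)[OF p] True by simp
      ultimately have "((\<lambda>x. rescale p q x i) \<longlongrightarrow> 0) (at a within ?E)"
        by (rule Lim_null_comparison)
      then show ?thesis using True by (simp add: rescale_zero)
    qed
  qed
qed

lemma gauge_on_norm: "gauge_on n (\<lambda>x. sqrt (\<Sum>i<n. (x i)\<^sup>2))"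
  unfolding gauge_on_def
proof (intro conjI allI impI exI[of _ "1::real"])
  show "continuous_on UNIV (\<lambda>x::nat \<Rightarrow> real. sqrt (\<Sum>i<n. (x i)\<^sup>2))"
    by (intro continuous_intros) auto
  show "sqrt (\<Sum>i<n. (c * x i)\<^sup>2) = c * sqrt (\<Sum>i<n. (x i)\<^sup>2)" if "0 \<le> c" for c :: real and x
    using that by (simp add: power_mult_distrib sum_distrib_left[symmetric] real_sqrt_mult)
  show "\<bar>x i\<bar> \<le> 1 * sqrt (\<Sum>i<n. (x i)\<^sup>2)" if x: "\<forall>j\<ge>n. x j = 0" for x :: "nat \<Rightarrow> real" and i
  proof (cases "i < n")
    case True
    then have "(x i)\<^sup>2 \<le> (\<Sum>i<n. (x i)\<^sup>2)" by (intro member_le_sum) auto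
    then show ?thesis by (simp add: real_le_rsqrt)
  next
    case False then show ?thesis using x by (simp add: sum_nonneg)
  qed
qed simp

text \<open>Rescaling carries each sublevel set of the norm onto the sublevel set of
  \<open>q\<close> at the same level, so it matches the closed balls and the open balls at once;
  rescaling back is its inverse.\<close>

lemma ball_pair_gauge:
  assumes q: "gauge_on n q"
  shows "ball_pair n (top_of_set {x. (\<forall>i\<ge>n. x i = 0) \<and> q x \<le> 1})
           {x. (\<forall>i\<ge>n. x i = 0) \<and> q x < 1}"
proof -
  let ?p = "\<lambda>x::nat \<Rightarrow> real. sqrt (\<Sum>i<n. (x i)\<^sup>2)"
  let ?E = "{x::nat \<Rightarrow> real. \<forall>i\<ge>n. x i = 0}"
  note p = gauge_on_norm[of n]
  have d: "disk n = top_of_set {x \<in> ?E. ?p x \<le> 1}"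
    by (simp add: disk_def subtopology_Euclidean_space)
  have od: "open_disk n = {x \<in> ?E. ?p x < 1}"
    by (auto simp add: open_disk_def topspace_Euclidean_space)
  have c: "continuous_on A (rescale p q)" if "A \<subseteq> ?E" "gauge_on n p" "gauge_on n q" for A p q
    using continuous_on_subset[OF continuous_on_rescale that(1)] that by blast
  have E: "rescale p q x \<in> ?E" if "x \<in> ?E" for p q x using that by (simp add: rescale_zero)
  have g1: "q (rescale ?p q x) = ?p x" if "x \<in> ?E" for x
    using gauge_rescale[OF p q] that by blast
  have g2: "?p (rescale q ?p x) = q x" if "x \<in> ?E" for x
    using gauge_rescale[OF q p] that by blast
  have r1: "rescale q ?p (rescale ?p q x) = x" if "x \<in> ?E" for x
    using rescale_rescale[OF p q] that by blast
  have r2: "rescale ?p q (rescale q ?p x) = x" if "x \<in> ?E" for x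
    using rescale_rescale[OF q p] that by blast
  have "homeomorphic_maps (top_of_set {x \<in> ?E. ?p x \<le> 1}) (top_of_set {x \<in> ?E. q x \<le> 1}) (rescale ?p q) (rescale q ?p)"
    unfolding homeomorphic_maps_def
  proof (intro conjI ballI)
    show "continuous_map (top_of_set {x \<in> ?E. ?p x \<le> 1}) (top_of_set {x \<in> ?E. q x \<le> 1}) (rescale ?p q)"
      unfolding continuous_map_in_subtopology continuous_map_iff_continuous
      using E g1 by (auto intro!: c[OF _ p q])
    show "continuous_map (top_of_set {x \<in> ?E. q x \<le> 1}) (top_of_set {x \<in> ?E. ?p x \<le> 1}) (rescale q ?p)"
      unfolding continuous_map_in_subtopology continuous_map_iff_continuous
      proof (intro conjI c[OF _ q p] funcsetI)
      fix x assume "x \<in> topspace (top_of_set {x \<in> ?E. q x \<le> 1})"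
      then have x: "x \<in> ?E" "q x \<le> 1" by auto
      have "?p (rescale q ?p x) \<le> 1" unfolding g2[OF x(1)] by (rule x(2))
      with E[OF x(1)] show "rescale q ?p x \<in> {x \<in> ?E. ?p x \<le> 1}" by blast
    qed auto
    show "rescale q ?p (rescale ?p q x) = x" if "x \<in> topspace (top_of_set {x \<in> ?E. ?p x \<le> 1})" for x
      using r1[of x] that by simp
    show "rescale ?p q (rescale q ?p x) = x" if "x \<in> topspace (top_of_set {x \<in> ?E. q x \<le> 1})" for x
      using r2[of x] that by simp
  qed
  then have "homeomorphic_map (disk n) (top_of_set {x \<in> ?E. q x \<le> 1}) (rescale ?p q)"
    unfolding d using homeomorphic_map_maps by blast
  moreover have "rescale ?p q ` open_disk n = {x \<in> ?E. q x < 1}"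
  proof (intro equalityI subsetI)
    fix y assume "y \<in> rescale ?p q ` open_disk n"
    then obtain x where x: "x \<in> ?E" "?p x < 1" "y = rescale ?p q x" unfolding od by blast
    then show "y \<in> {x \<in> ?E. q x < 1}" using E[OF x(1)] g1[OF x(1)] by simp
  next
    fix y assume "y \<in> {x \<in> ?E. q x < 1}"
    then have y: "y \<in> ?E" "q y < 1" by auto
    have "rescale q ?p y \<in> open_disk n"
    proof -
      have "?p (rescale q ?p y) < 1" unfolding g2[OF y(1)] by (rule y(2))
      with E[OF y(1)] show ?thesis unfolding od by blast
    qed
    then show "y \<in> rescale ?p q ` open_disk n" using r2[OF y(1)] by force
  qed
  ultimately have "ball_pair n (top_of_set {x \<in> ?E. q x \<le> 1}) {x \<in> ?E. q x < 1}"
    unfolding ball_pair_def by blast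
  then show ?thesis by (simp only: mem_Collect_eq)
qed

section \<open>Products of balls\<close>

lemma continuous_on_eval: "continuous_on A (\<lambda>x. x i)"
  by (rule continuous_on_subset[OF continuous_on_product_coordinates]) simp

lemma homeomorphic_map_top_of_setI:
  assumes "continuous_on S f" "continuous_on T g"
    and "\<And>x. x \<in> S \<Longrightarrow> f x \<in> T" "\<And>y. y \<in> T \<Longrightarrow> g y \<in> S"
    and "\<And>x. x \<in> S \<Longrightarrow> g (f x) = x" "\<And>y. y \<in> T \<Longrightarrow> f (g y) = y"
  shows "homeomorphic_map (top_of_set S) (top_of_set T) f"
  unfolding homeomorphic_map_maps homeomorphic_maps_def continuous_map_in_subtopology
    continuous_map_iff_continuous
  using assms by (intro exI[of _ g]) auto

lemma ball_pair_singleton: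
  assumes "topspace B = {x}"
  shows "ball_pair 0 B {x}"
proof -
  have t: "topspace (disk 0) = {\<lambda>_. 0}" "open_disk 0 = {\<lambda>_. 0}"
    by (auto simp: disk_def open_disk_def topspace_Euclidean_space)
  have "homeomorphic_maps (disk 0) B (\<lambda>_. x) (\<lambda>_. \<lambda>_. 0)"
    using assms t by (auto simp: homeomorphic_maps_def)
  then show ?thesis unfolding ball_pair_def t homeomorphic_map_maps by (intro exI[of _ "\<lambda>_. x"]) auto
qed

text \<open>In concatenated coordinates the product of two round disks is the unit ball of the
  maximum of the two norms, which is again a gauge.\<close>

lemma ball_pair_prod:
  assumes "ball_pair a B U" "ball_pair b C V"
  shows "ball_pair (a + b) (prod_topology B C) (U \<times> V)"
proof -
  obtain f where f: "homeomorphic_map (disk a) B f" "f ` open_disk a = U"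
    using assms(1) by (auto simp: ball_pair_def)
  obtain g where g: "homeomorphic_map (disk b) C g" "g ` open_disk b = V"
    using assms(2) by (auto simp: ball_pair_def)
  define p where "p = (\<lambda>x::nat \<Rightarrow> real. sqrt (\<Sum>i<a. (x i)\<^sup>2))"
  define q where "q = (\<lambda>x::nat \<Rightarrow> real. sqrt (\<Sum>i<b. (x i)\<^sup>2))"
  define fst' where "fst' = (\<lambda>(x::nat \<Rightarrow> real) i. if i < a then x i else 0)"
  define snd' where "snd' = (\<lambda>(x::nat \<Rightarrow> real) i. x (a + i))"
  define join where "join = (\<lambda>(y::nat \<Rightarrow> real, z::nat \<Rightarrow> real) i. if i < a then y i else z (i - a))"
  define Q where "Q = (\<lambda>x. max (p (fst' x)) (q (snd' x)))"
  let ?E = "\<lambda>n. {x::nat \<Rightarrow> real. \<forall>i\<ge>n. x i = 0}"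
  have gp: "gauge_on a p" and gq: "gauge_on b q"
    unfolding p_def q_def by (rule gauge_on_norm)+
  have cf: "continuous_on A fst'" for A
  proof (rule continuous_on_coordinatewise_then_product)
    show "continuous_on A (\<lambda>x. fst' x i)" for i by (cases "i < a") (auto simp: fst'_def continuous_on_eval)
  qed
  have cs: "continuous_on A snd'" for A unfolding snd'_def
    by (intro continuous_on_coordinatewise_then_product continuous_on_eval)
  have cj: "continuous_on A join" for A
  proof (rule continuous_on_coordinatewise_then_product)
    have "continuous_on A (\<lambda>x. fst x i)" "continuous_on A (\<lambda>x. snd x i)"
      for i and A :: "((nat \<Rightarrow> real) \<times> (nat \<Rightarrow> real)) set"
      by (rule continuous_on_product_then_coordinatewise; intro continuous_intros)+
    then show "continuous_on A (\<lambda>x. join x i)" for i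
      by (cases "i < a") (auto simp: join_def case_prod_unfold)
  qed
  have E: "fst' x \<in> ?E a" "snd' x \<in> ?E b" if "x \<in> ?E (a + b)" for x
    using that by (auto simp: fst'_def snd'_def)
  have J: "join (y, z) \<in> ?E (a + b)" "fst' (join (y, z)) = y" "snd' (join (y, z)) = z"
    if "y \<in> ?E a" "z \<in> ?E b" for y z
    using that by (auto simp: fst'_def snd'_def join_def fun_eq_iff)
  have S: "join (fst' x, snd' x) = x" for x by (auto simp: fst'_def snd'_def join_def fun_eq_iff)
  have "gauge_on (a + b) Q"
    unfolding gauge_on_def
  proof (intro conjI allI impI)
    show "continuous_on UNIV Q" unfolding Q_def
      by (intro continuous_intros continuous_on_compose2[OF gauge_onD(1)[OF gp, of UNIV] cf]
          continuous_on_compose2[OF gauge_onD(1)[OF gq, of UNIV] cs]) auto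
    show "Q (\<lambda>i. c * x i) = c * Q x" if "0 \<le> c" for c x
    proof -
      have "fst' (\<lambda>i. c * x i) = (\<lambda>i. c * fst' x i)" "snd' (\<lambda>i. c * x i) = (\<lambda>i. c * snd' x i)"
        by (auto simp: fst'_def snd'_def)
      then show ?thesis
        using that by (simp add: Q_def gauge_onD(2)[OF gp] gauge_onD(2)[OF gq] max_mult_distrib_left)
    qed
    obtain M where M: "M > 0" "\<And>x i. x \<in> ?E a \<Longrightarrow> \<bar>x i\<bar> \<le> M * p x"
      using gp unfolding gauge_on_def by blast
    obtain N where N: "N > 0" "\<And>x i. x \<in> ?E b \<Longrightarrow> \<bar>x i\<bar> \<le> N * q x"
      using gq unfolding gauge_on_def by blast
    have "\<bar>x i\<bar> \<le> max M N * Q x" if x: "x \<in> ?E (a + b)" for x i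
    proof -
      note E = E[OF x]
      have "\<bar>fst' x i\<bar> \<le> max M N * Q x" for i
        using M(2)[OF E(1), of i] mult_mono[of M "max M N" "p (fst' x)" "Q x"] M(1)
          gauge_onD(4)[OF gp] E(1) by (force simp: Q_def)
      moreover have "\<bar>snd' x i\<bar> \<le> max M N * Q x" for i
        using N(2)[OF E(2), of i] mult_mono[of N "max M N" "q (snd' x)" "Q x"] N(1)
          gauge_onD(4)[OF gq] E(2) by (force simp: Q_def)
      ultimately show ?thesis
        by (metis fst'_def snd'_def le_add_diff_inverse not_less)
    qed
    then show "\<exists>M>0. \<forall>x i. (\<forall>j\<ge>a + b. x j = 0) \<longrightarrow> \<bar>x i\<bar> \<le> M * Q x"
      using M(1) by (intro exI[of _ "max M N"]) auto
  qed
  then have ball: "ball_pair (a + b) (top_of_set {x \<in> ?E (a + b). Q x \<le> 1}) {x \<in> ?E (a + b). Q x < 1}"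
    using ball_pair_gauge by (simp only: mem_Collect_eq)
  have da: "disk a = top_of_set {x \<in> ?E a. p x \<le> 1}" and db: "disk b = top_of_set {x \<in> ?E b. q x \<le> 1}"
    by (simp_all add: disk_def subtopology_Euclidean_space p_def q_def)
  have oa: "open_disk a = {x \<in> ?E a. p x < 1}" and ob: "open_disk b = {x \<in> ?E b. q x < 1}"
    by (auto simp add: open_disk_def topspace_Euclidean_space p_def q_def)
  have 1: "homeomorphic_map (top_of_set {x \<in> ?E (a + b). Q x \<le> 1}) (prod_topology (disk a) (disk b))
      (\<lambda>x. (fst' x, snd' x))"
    unfolding da db prod_topology_subtopology_eu
  proof (rule homeomorphic_map_top_of_setI[of _ _ _ join])
    show "continuous_on {x \<in> ?E (a + b). Q x \<le> 1} (\<lambda>x. (fst' x, snd' x))"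
      by (intro continuous_intros cf cs)
    show "(fst' x, snd' x) \<in> {x \<in> ?E a. p x \<le> 1} \<times> {x \<in> ?E b. q x \<le> 1}"
      if "x \<in> {x \<in> ?E (a + b). Q x \<le> 1}" for x
      using that E[of x] by (auto simp only: Q_def mem_Collect_eq mem_Times_iff fst_conv snd_conv max.bounded_iff)
    fix w assume "w \<in> {x \<in> ?E a. p x \<le> 1} \<times> {x \<in> ?E b. q x \<le> 1}"
    then obtain y z where w: "w = (y, z)" "y \<in> ?E a" "z \<in> ?E b" "p y \<le> 1" "q z \<le> 1"
      by blast
    show "join w \<in> {x \<in> ?E (a + b). Q x \<le> 1}" "(fst' (join w), snd' (join w)) = w"
      using J[OF w(2,3)] w by (simp_all only: Q_def mem_Collect_eq max.bounded_iff simp_thms)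
  qed (rule cj, rule S)
  have 2: "homeomorphic_map (prod_topology (disk a) (disk b)) (prod_topology B C) (\<lambda>(x, y). (f x, g y))"
    using f(1) g(1) homeomorphic_maps_prod unfolding homeomorphic_map_maps by blast
  have 3: "(\<lambda>x. (fst' x, snd' x)) ` {x \<in> ?E (a + b). Q x < 1} = open_disk a \<times> open_disk b"
  proof (intro equalityI subsetI)
    fix w assume "w \<in> open_disk a \<times> open_disk b"
    then obtain y z where w: "w = (y, z)" "y \<in> ?E a" "z \<in> ?E b" "p y < 1" "q z < 1"
      unfolding oa ob by auto
    then show "w \<in> (\<lambda>x. (fst' x, snd' x)) ` {x \<in> ?E (a + b). Q x < 1}"
      using J[OF w(2,3)] by (intro image_eqI[of _ _ "join w"]) (auto simp: Q_def)
  qed (use E in \<open>auto simp: oa ob Q_def\<close>)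
  have 4: "(\<lambda>(x, y). (f x, g y)) ` (open_disk a \<times> open_disk b) = U \<times> V"
    using f(2) g(2) by auto
  show ?thesis
    by (rule ball_pair_homeomorphic[OF ball_pair_homeomorphic[OF ball 1 3] 2 4])
qed

lemma ball_pair_product:
  fixes n :: nat
  assumes "\<And>i. i < n \<Longrightarrow> ball_pair (d i) (B i) (U i)" "\<And>i. i < n \<Longrightarrow> U i \<subseteq> topspace (B i)"
  shows "ball_pair (\<Sum>i<n. d i) (product_topology B {..<n}) (Pi\<^sub>E {..<n} U)"
  using assms
proof (induction n)
  case 0
  show ?case using ball_pair_singleton[of "product_topology B {}" "\<lambda>_. undefined"] by simp
next
  case (Suc n)
  \<comment> \<open>Points of a product are extensional functions, so splitting off the last
    coordinate must also reset it to \<open>undefined\<close> in the remaining function; hence the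
    restriction.\<close>
  let ?f = "\<lambda>(f, x). f(n := x)" and ?g = "\<lambda>g. (restrict g {..<n}, g n)"
  have fg: "?f (?g w) = w" if "w \<in> extensional {..<Suc n}" for w
  proof
    show "?f (?g w) i = w i" for i
      using that by (cases "i < n"; cases "i = n") (auto simp: extensional_def)
  qed
  have "homeomorphic_maps (prod_topology (product_topology B {..<n}) (B n)) (product_topology B {..<Suc n}) ?f ?g"
    unfolding homeomorphic_maps_def
  proof (intro conjI ballI)
    have "continuous_map (prod_topology (product_topology B {..<n}) (B n)) (B i) (\<lambda>w. ?f w i)"
      if "i < Suc n" for i
    proof (cases "i = n")
      case True then show ?thesis by (simp add: case_prod_unfold continuous_map_snd)
    next
      case False
      then have "i < n" using that by simp
      then show ?thesis using False
        continuous_map_compose[OF continuous_map_fst continuous_map_product_projection[of i "{..<n}" B]]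
        by (auto simp: case_prod_unfold o_def)
    qed
    then show "continuous_map (prod_topology (product_topology B {..<n}) (B n)) (product_topology B {..<Suc n}) ?f"
      unfolding continuous_map_componentwise by (auto simp: extensional_def PiE_iff)
    show "continuous_map (product_topology B {..<Suc n}) (prod_topology (product_topology B {..<n}) (B n)) ?g"
      by (auto simp: continuous_map_pairwise o_def continuous_map_componentwise intro!: continuous_map_product_projection)
    show "?g (?f w) = w" if w0: "w \<in> topspace (prod_topology (product_topology B {..<n}) (B n))" for w
    proof -
      obtain f x where w: "w = (f, x)" "f \<in> extensional {..<n}"
        using w0 by (cases w) (auto simp: PiE_iff)
      have "restrict (f(n := x)) {..<n} = f"
        using w(2) by (intro extensionalityI[of _ "{..<n}"]) auto
      then show ?thesis using w(1) by simp
    qed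
    show "?f (?g w) = w" if "w \<in> topspace (product_topology B {..<Suc n})" for w
      using that by (intro fg) (auto simp: PiE_iff)
  qed
  then have h: "homeomorphic_map (prod_topology (product_topology B {..<n}) (B n)) (product_topology B {..<Suc n}) ?f"
    using homeomorphic_map_maps by blast
  have "?f ` (Pi\<^sub>E {..<n} U \<times> U n) = Pi\<^sub>E {..<Suc n} U"
  proof (intro equalityI subsetI)
    fix w assume w: "w \<in> Pi\<^sub>E {..<Suc n} U"
    then have gw: "?g w \<in> Pi\<^sub>E {..<n} U \<times> U n" by (simp add: PiE_iff)
    have wx: "w \<in> extensional {..<Suc n}" using w by (simp add: PiE_iff)
    from imageI[OF gw, of ?f] show "w \<in> ?f ` (Pi\<^sub>E {..<n} U \<times> U n)"
      unfolding fg[OF wx] .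
  next
    fix w assume "w \<in> ?f ` (Pi\<^sub>E {..<n} U \<times> U n)"
    then obtain c where c: "c \<in> Pi\<^sub>E {..<n} U \<times> U n" "w = ?f c" by (rule imageE)
    obtain f x where fx: "c = (f, x)" by (cases c)
    have w: "w = f(n := x)" and f: "f \<in> Pi\<^sub>E {..<n} U" and x: "x \<in> U n"
      using c unfolding fx by (simp_all only: prod.case mem_Times_iff fst_conv snd_conv)
    show "w \<in> Pi\<^sub>E {..<Suc n} U"
      unfolding w lessThan_Suc by (rule PiE_fun_upd[where f = f, OF x f])
  qed
  from ball_pair_homeomorphic[OF ball_pair_prod h this] show ?case
    using Suc by simp
qed

section \<open>Ordered simplices\<close>

definition open_simplex :: "nat \<Rightarrow> (nat \<Rightarrow> real) set" where
  "open_simplex j = {x. (\<forall>i\<ge>j. x i = 0) \<and> (\<forall>b<j. 0 < x b \<and> x b < 1) \<and> (\<forall>b c. b < c \<longrightarrow> c < j \<longrightarrow> x b < x c)}"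

lemma topspace_simplex_space:
  "topspace (simplex_space j) = {x. (\<forall>i\<ge>j. x i = 0) \<and> (\<forall>b<j. 0 \<le> x b \<and> x b \<le> 1) \<and>
     (\<forall>b c. b \<le> c \<longrightarrow> c < j \<longrightarrow> x b \<le> x c)}"
  by (auto simp: simplex_space_def topspace_Euclidean_space)

lemma simplex_space_eq: "simplex_space j = top_of_set (topspace (simplex_space j))"
  by (simp add: topspace_simplex_space) (simp add: simplex_space_def subtopology_Euclidean_space)

lemma open_simplex_subset: "open_simplex j \<subseteq> topspace (simplex_space j)"
  unfolding open_simplex_def topspace_simplex_space by (force simp: le_less)

lemma continuous_on_Max:
  fixes f :: "'i \<Rightarrow> 'b::topological_space \<Rightarrow> real"
  assumes "finite I" "I \<noteq> {}" "\<And>i. i \<in> I \<Longrightarrow> continuous_on A (f i)"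
  shows "continuous_on A (\<lambda>x. Max ((\<lambda>i. f i x) ` I))"
  using assms
proof (induction I rule: finite_ne_induct)
  case (insert i I)
  have "continuous_on A (\<lambda>x. max (f i x) (Max ((\<lambda>i. f i x) ` I)))"
    using insert by (intro continuous_on_max) auto
  then show ?case using insert by simp
qed simp

text \<open>
  The gauge is taken around the barycentre \<open>x\<^sub>b = (b + 1) / (j + 1)\<close>. Padding a point \<open>x\<close> of the
  simplex with \<open>0\<close> on the left and \<open>1\<close> on the right turns all its defining inequalities into
  inequalities between neighbours.
\<close>

lemma ball_pair_simplex: "ball_pair j (simplex_space j) (open_simplex j)"
proof -
  \<comment> \<open>Here \<open>u\<close> is the displacement from the barycentre, and
    \<open>D u b\<close> is the amount by which it shrinks the \<open>b\<close>-th of the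
    \<open>j + 1\<close> gaps between neighbours. Since \<open>u j = 0\<close> on the ambient space,
    the same formula covers the last gap.\<close>
  define D where "D = (\<lambda>(u::nat \<Rightarrow> real) b. (if b = 0 then 0 else u (b - 1)) - u b)"
  \<comment> \<open>All gaps at the barycentre equal \<open>1 / (j + 1)\<close>. With this
    normalisation \<open>q u \<le> 1\<close> says that no gap becomes negative and
    \<open>q u < 1\<close> that all stay positive.\<close>
  define q where "q = (\<lambda>u. real (Suc j) * Max ((\<lambda>b. D u b) ` {..j}))"
  let ?E = "{x::nat \<Rightarrow> real. \<forall>i\<ge>j. x i = 0}"
  define K where "K = 1 / real (Suc j)"
  have K: "1 = real j * K + K" by (simp add: K_def field_simps)
  define c where "c = (\<lambda>b. if b < j then real (Suc b) * K else 0)"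
  have q_le: "q u \<le> 1 \<longleftrightarrow> (\<forall>b\<le>j. D u b \<le> K)" for u
  proof -
    have "q u \<le> 1 \<longleftrightarrow> Max ((\<lambda>b. D u b) ` {..j}) \<le> K"
      by (simp add: q_def K_def field_simps)
    then show ?thesis by (subst (asm) Max_le_iff) auto
  qed
  have q_less: "q u < 1 \<longleftrightarrow> (\<forall>b\<le>j. D u b < K)" for u
  proof -
    have "q u < 1 \<longleftrightarrow> Max ((\<lambda>b. D u b) ` {..j}) < K"
      by (simp add: q_def K_def field_simps)
    then show ?thesis by (subst (asm) Max_less_iff) auto
  qed
  have "gauge_on j q"
    unfolding gauge_on_def
  proof (intro conjI allI impI exI[of _ "1::real"])
    have cD: "continuous_on UNIV (\<lambda>u. D u b)" for b
      by (cases "b = 0") (auto simp: D_def intro!: continuous_intros)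
    show "continuous_on UNIV q" unfolding q_def
      by (intro continuous_intros continuous_on_Max cD) auto
    show "q (\<lambda>i. c * u i) = c * q u" if "0 \<le> c" for c u
    proof -
      have "Max ((\<lambda>b. D (\<lambda>i. c * u i) b) ` {..j}) = Max ((*) c ` (\<lambda>b. D u b) ` {..j})"
        by (intro arg_cong[of _ _ Max]) (auto simp: D_def image_image algebra_simps)
      also have "\<dots> = c * Max ((\<lambda>b. D u b) ` {..j})"
        using that by (intro mono_Max_commute[symmetric]) (auto simp: mono_def mult_left_mono)
      finally show ?thesis by (simp add: q_def)
    qed
    fix u :: "nat \<Rightarrow> real" and i assume u: "\<forall>i\<ge>j. u i = 0"
    let ?m = "Max ((\<lambda>b. D u b) ` {..j})"
    have m: "D u b \<le> ?m" if "b \<le> j" for b using that by (intro Max_ge) auto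
    have sumD: "(\<Sum>b\<le>i. D u b) = - u i" for i
      by (induction i) (auto simp: D_def)
    \<comment> \<open>The differences sum to \<open>- u j = 0\<close>, so their maximum cannot be
      negative.\<close>
    have "(\<Sum>b\<le>j. D u b) \<le> real (card {..j}) * ?m" using m by (intro sum_bounded_above) auto
    then have m0: "0 \<le> ?m" using u by (simp add: sumD zero_le_mult_iff)
    show "\<bar>u i\<bar> \<le> 1 * q u"
    proof (cases "i < j")
      case True
      \<comment> \<open>The differences are bounded only from above. The first \<open>i + 1\<close>
        of them sum to \<open>- u i\<close> and the remaining ones to \<open>u i\<close>, so this
        one-sided bound controls both signs.\<close>
      have "- u i \<le> real (card {..i}) * ?m"
        unfolding sumD[symmetric] using m True by (intro sum_bounded_above) auto
      also have "\<dots> \<le> q u" using m0 True unfolding q_def by (intro mult_right_mono) auto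
      finally have 1: "- u i \<le> q u" .
      have "{..j} = {..i} \<union> {Suc i..j}" "{..i} \<inter> {Suc i..j} = {}" using True by auto
      then have "(\<Sum>b\<le>j. D u b) = (\<Sum>b\<le>i. D u b) + (\<Sum>b=Suc i..j. D u b)"
        by (metis finite_atLeastAtMost finite_atMost sum.union_disjoint)
      then have "u i = (\<Sum>b=Suc i..j. D u b)" using u by (simp add: sumD)
      also have "\<dots> \<le> real (card {Suc i..j}) * ?m" using m by (intro sum_bounded_above) auto
      also have "\<dots> \<le> q u" using m0 True unfolding q_def by (intro mult_right_mono) auto
      finally show ?thesis using 1 by simp
    next
      case False then show ?thesis using u m0 by (simp add: q_def)
    qed
  qed simp
  then have ball: "ball_pair j (top_of_set {x \<in> ?E. q x \<le> 1}) {x \<in> ?E. q x < 1}"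
    using ball_pair_gauge by (simp only: mem_Collect_eq)
  define f where "f = (\<lambda>(u::nat \<Rightarrow> real) b. u b + c b)"
  \<comment> \<open>Past the value 1 at position \<open>j + 1\<close> the padding keeps growing, so
    that monotonicity along all natural numbers amounts to the \<open>j + 1\<close> relevant
    inequalities.\<close>
  define pad where "pad = (\<lambda>(x::nat \<Rightarrow> real) b. if b = 0 then 0 else if b \<le> j then x (b - 1) else real (b - j))"
  have pad_D: "pad (f u) (Suc b) - pad (f u) b = K - D u b" if "u \<in> ?E" "b \<le> j" for u b

  proof -
    have "b = j \<or> Suc b \<le> j" using that(2) by auto
    then show ?thesis
    proof
      assume "b = j"
      then show ?thesis using that K by (cases b) (auto simp: pad_def f_def D_def c_def ring_distribs)
    next
      assume "Suc b \<le> j"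
      then show ?thesis using that by (cases b) (auto simp: pad_def f_def D_def c_def ring_distribs)
    qed
  qed
  have pad_out: "pad x b < pad x (Suc b)" if "b > j" for x b
    using that by (auto simp: pad_def)
  have adj: "q u \<le> 1 \<longleftrightarrow> (\<forall>b. pad (f u) b \<le> pad (f u) (Suc b))"
       "q u < 1 \<longleftrightarrow> (\<forall>b. pad (f u) b < pad (f u) (Suc b))" if "u \<in> ?E" for u
  proof -
    have "D u b \<le> K \<longleftrightarrow> pad (f u) b \<le> pad (f u) (Suc b)" "D u b < K \<longleftrightarrow> pad (f u) b < pad (f u) (Suc b)"
      if "b \<le> j" for b using pad_D[OF \<open>u \<in> ?E\<close> that] by linarith+
    with pad_out[where x = "f u"] show "q u \<le> 1 \<longleftrightarrow> (\<forall>b. pad (f u) b \<le> pad (f u) (Suc b))"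
      "q u < 1 \<longleftrightarrow> (\<forall>b. pad (f u) b < pad (f u) (Suc b))"
      unfolding q_le q_less by (metis less_imp_le not_le)+
  qed
  have simp_le: "x \<in> topspace (simplex_space j) \<longleftrightarrow> (\<forall>b. pad x b \<le> pad x (Suc b))" if x: "x \<in> ?E" for x
  proof
    assume *: "\<forall>b. pad x b \<le> pad x (Suc b)"
    have mono: "pad x b \<le> pad x c" if "b \<le> c" for b c
      using lift_Suc_mono_le[of "pad x", OF _ that] * by auto
    have "0 \<le> x b" "x b \<le> 1" if "b < j" for b
      using mono[of 0 "Suc b"] mono[of "Suc b" "Suc j"] that by (auto simp: pad_def)
    moreover have "x b \<le> x c" if "b \<le> c" "c < j" for b c
      using mono[of "Suc b" "Suc c"] that by (auto simp: pad_def)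
    ultimately show "x \<in> topspace (simplex_space j)" using x by (auto simp: topspace_simplex_space)
  next
    assume "x \<in> topspace (simplex_space j)"
    then show "\<forall>b. pad x b \<le> pad x (Suc b)"
      by (auto simp: topspace_simplex_space pad_def Suc_le_eq)
  qed
  have simp_less: "x \<in> open_simplex j \<longleftrightarrow> (\<forall>b. pad x b < pad x (Suc b))" if x: "x \<in> ?E" for x
  proof
    assume *: "\<forall>b. pad x b < pad x (Suc b)"
    have mono: "pad x b < pad x c" if "b < c" for b c
      using lift_Suc_mono_less[of "pad x", OF _ that] * by auto
    have "0 < x b" "x b < 1" if "b < j" for b
      using mono[of 0 "Suc b"] mono[of "Suc b" "Suc j"] that by (auto simp: pad_def)
    moreover have "x b < x c" if "b < c" "c < j" for b c
      using mono[of "Suc b" "Suc c"] that by (auto simp: pad_def)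
    ultimately show "x \<in> open_simplex j" using x by (auto simp: open_simplex_def)
  next
    assume "x \<in> open_simplex j"
    then show "\<forall>b. pad x b < pad x (Suc b)"
      by (auto simp: open_simplex_def pad_def Suc_le_eq)
  qed
  let ?g = "\<lambda>x b. x b - c b"
  have fg: "f (?g x) = x" "?g (f u) = u" for x u by (auto simp: f_def)
  have fE: "f u \<in> ?E \<longleftrightarrow> u \<in> ?E" "?g x \<in> ?E \<longleftrightarrow> x \<in> ?E" for u x by (auto simp: f_def c_def)
  have sE: "topspace (simplex_space j) \<subseteq> ?E" "open_simplex j \<subseteq> ?E"
    by (auto simp: topspace_simplex_space open_simplex_def)
  have cont: "continuous_on A f" "continuous_on A ?g" for A
  proof -
    show "continuous_on A f" unfolding f_def
      by (intro continuous_on_coordinatewise_then_product continuous_intros continuous_on_eval)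
    show "continuous_on A ?g"
      by (intro continuous_on_coordinatewise_then_product continuous_intros continuous_on_eval)
  qed
  have im: "f u \<in> topspace (simplex_space j)" if "u \<in> ?E" "q u \<le> 1" for u
    using that(2) unfolding simp_le[OF iffD2[OF fE(1) that(1)]] adj(1)[OF that(1)] .
  have im': "?g x \<in> {x \<in> ?E. q x \<le> 1}" if "x \<in> topspace (simplex_space j)" for x
  proof -
    have x: "x \<in> ?E" using that sE(1) by (rule subsetD[rotated])
    note gx = iffD2[OF fE(2) x]
    show ?thesis using that gx unfolding simp_le[OF x] adj(1)[OF gx] fg(1) mem_Collect_eq by (rule conjI[rotated])
  qed
  have "homeomorphic_map (top_of_set {x \<in> ?E. q x \<le> 1}) (top_of_set (topspace (simplex_space j))) f"
  proof (rule homeomorphic_map_top_of_setI[OF cont])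
    show "f u \<in> topspace (simplex_space j)" if "u \<in> {x \<in> ?E. q x \<le> 1}" for u
      using that by (elim CollectE conjE) (intro im CollectI)
  qed (assumption | rule im' fg(1) fg(2))+
  then have 1: "homeomorphic_map (top_of_set {x \<in> ?E. q x \<le> 1}) (simplex_space j) f"
    by (subst simplex_space_eq)
  have 2: "f ` {x \<in> ?E. q x < 1} = open_simplex j"
  proof (intro equalityI subsetI)
    fix x assume x: "x \<in> open_simplex j"
    then have xE: "x \<in> ?E" using sE(2) by (rule subsetD[rotated])
    note gx = iffD2[OF fE(2) xE]
    have "q (?g x) < 1" using x unfolding simp_less[OF xE] adj(2)[OF gx] fg(1) .
    with gx have "?g x \<in> {x \<in> ?E. q x < 1}" unfolding mem_Collect_eq by (rule conjI)
    from imageI[OF this, of f] show "x \<in> f ` {x \<in> ?E. q x < 1}" unfolding fg(1) .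
  next
    fix x assume "x \<in> f ` {x \<in> ?E. q x < 1}"
    then obtain u where uE: "u \<in> {x \<in> ?E. q x < 1}" and xu: "x = f u" by (rule imageE)
    have u: "u \<in> ?E" "q u < 1"
      using uE unfolding mem_Collect_eq by (rule conjunct1, rule conjunct2)
    show "x \<in> open_simplex j"
      using u(2) unfolding xu simp_less[OF iffD2[OF fE(1) u(1)]] adj(2)[OF u(1)] .
  qed
  show ?thesis by (rule ball_pair_homeomorphic[OF ball 1 2])
qed

subsection \<open>A criterion for finite cell structures\<close>

text \<open>The disk sits in an infinite product of lines. It is closed there and contained in a
  product of intervals \<open>{-1..1}\<close>, which is compact by Tychonoff.\<close>

lemma compact_space_disk: "compact_space (disk d)"
proof -
  let ?S = "{x::nat \<Rightarrow> real. (\<forall>i\<ge>d. x i = 0) \<and> (\<Sum>i<d. (x i)\<^sup>2) \<le> 1}"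
  have "compactin (powertop_real UNIV) (Pi\<^sub>E UNIV (\<lambda>_. {-1..1}))"
    by (simp add: compactin_PiE)
  then have cpt: "compact (Pi\<^sub>E (UNIV::nat set) (\<lambda>_. {-1..1::real}))"
    by (simp add: euclidean_product_topology)
  have "?S = {x. \<forall>i. i \<ge> d \<longrightarrow> x i = 0} \<inter> {x. (\<Sum>i<d. (x i)\<^sup>2) \<le> 1}" by auto
  moreover have "closed {x::nat \<Rightarrow> real. \<forall>i. i \<ge> d \<longrightarrow> x i = 0}"
    by (intro closed_Collect_all closed_Collect_imp closed_Collect_eq continuous_on_eval continuous_intros)
      auto
  moreover have "closed {x::nat \<Rightarrow> real. (\<Sum>i<d. (x i)\<^sup>2) \<le> 1}"
    by (intro closed_Collect_le continuous_intros continuous_on_eval)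
  ultimately have "closed ?S" by auto
  note cpt_Int = compact_Int_closed[OF cpt this]
  have "?S \<subseteq> Pi\<^sub>E UNIV (\<lambda>_. {-1..1})"
  proof
    fix x :: "nat \<Rightarrow> real" assume x: "x \<in> ?S"
    have abs: "\<bar>x i\<bar> \<le> 1" for i
    proof (cases "i < d")
      case True
      then have "(x i)\<^sup>2 \<le> (\<Sum>i<d. (x i)\<^sup>2)" by (intro member_le_sum) auto
      also have "\<dots> \<le> 1" using x by simp
      finally show ?thesis by (simp add: abs_square_le_1)
    qed (use x in simp)
    have "x i \<in> {-1..1}" for i using abs[of i] unfolding atLeastAtMost_iff by linarith
    then show "x \<in> Pi\<^sub>E UNIV (\<lambda>_. {-1..1})" by (simp add: PiE_iff)
  qed
  then have "compact ?S" using cpt_Int by (simp only: Int_absorb1)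
  then show ?thesis
    by (simp add: disk_def subtopology_Euclidean_space compact_space_subtopology)
qed

lemma open_disk_subset: "open_disk d \<subseteq> topspace (disk d)"
  by (auto simp: open_disk_def disk_def)

lemma ball_pair_subset: "ball_pair d B U \<Longrightarrow> U \<subseteq> topspace B"
  unfolding ball_pair_def using open_disk_subset homeomorphic_imp_surjective_map by blast

lemma homeomorphic_map_open_cell:
  assumes f: "continuous_map B Y f" and B: "compact_space B" and Y: "Hausdorff_space Y"
    and U: "U \<subseteq> topspace B" "inj_on f U" "f ` (topspace B - U) \<inter> f ` U = {}"
  shows "homeomorphic_map (subtopology B U) (subtopology Y (f ` U)) f"
proof (rule bijective_closed_imp_homeomorphic_map)
  have "{x \<in> topspace B. f x \<in> f ` U} = U" using U by blast
  then show "closed_map (subtopology B U) (subtopology Y (f ` U)) f"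
    using closed_map_restriction continuous_imp_closed_map[OF f B Y] by blast
  show "continuous_map (subtopology B U) (subtopology Y (f ` U)) f"
    using f by (simp add: continuous_map_in_subtopology continuous_map_from_subtopology)
  have "f ` U \<subseteq> topspace Y" using f U(1) continuous_map_image_subset_topspace by blast
  then show "f ` topspace (subtopology B U) = topspace (subtopology Y (f ` U))"
    using U(1) by (simp add: inf.absorb2)
  show "inj_on f (topspace (subtopology B U))"
    using U(1,2) by (simp add: inf.absorb2)
qed

text \<open>With finitely many compact cells the weak topology is automatic: \<open>A\<close> is a
  finite union of compact images. The boundary hypothesis asks only for some open cell of lower
  dimension containing the point. That cell differs from the given one, so disjointness keeps
  boundary values out of the cell's own interior, and \<open>homeomorphic_map_open_cell\<close>
  applies.\<close>

lemma cell_structure_finiteI: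
  assumes Y: "Hausdorff_space Y" and fin: "finite I"
    and ball: "\<And>i. i \<in> I \<Longrightarrow> ball_pair (d i) (B i) (U i)"
    and cont: "\<And>i. i \<in> I \<Longrightarrow> continuous_map (B i) Y (f i)"
    and inj: "\<And>i. i \<in> I \<Longrightarrow> inj_on (f i) (U i)"
    and disj: "disjoint_family_on (\<lambda>i. f i ` U i) I"
    and cover: "topspace Y \<subseteq> (\<Union>i\<in>I. f i ` U i)"
    and bdry: "\<And>i z. i \<in> I \<Longrightarrow> z \<in> topspace (B i) - U i \<Longrightarrow> \<exists>j\<in>I. d j < d i \<and> f i z \<in> f j ` U j"
  shows "cell_structure Y I d B f"
proof -
  obtain h where h: "\<And>i. i \<in> I \<Longrightarrow> homeomorphic_map (disk (d i)) (B i) (h i)"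
      "\<And>i. i \<in> I \<Longrightarrow> h i ` open_disk (d i) = U i"
    using ball unfolding ball_pair_def by metis
  have hD: "continuous_map (disk (d i)) (B i) (h i)" "inj_on (h i) (topspace (disk (d i)))"
    "h i ` topspace (disk (d i)) = topspace (B i)" if "i \<in> I" for i
    using h(1)[OF that] homeomorphic_imp_continuous_map homeomorphic_imp_injective_map
      homeomorphic_imp_surjective_map by blast+
  have cell: "(f i \<circ> h i) ` open_disk (d i) = f i ` U i" if "i \<in> I" for i
    by (simp only: image_comp[symmetric] h(2)[OF that])
  have cont': "continuous_map (disk (d i)) Y (f i \<circ> h i)" if "i \<in> I" for i
    using continuous_map_compose[OF hD(1)[OF that] cont[OF that]] .
  have out: "h i x \<in> topspace (B i) - U i" if "i \<in> I" "x \<in> topspace (disk (d i)) - open_disk (d i)" for i x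
    using that hD(2,3)[OF that(1)] h(2)[OF that(1)] open_disk_subset[of "d i"]
    by (auto simp: inj_on_def) blast
  have bd: "\<exists>j\<in>I. d j < d i \<and> (f i \<circ> h i) x \<in> f j ` U j"
    if "i \<in> I" "x \<in> topspace (disk (d i)) - open_disk (d i)" for i x
    using bdry[OF that(1) out[OF that]] by simp
  show ?thesis
    unfolding cell_structure_def cw_structure_def
  proof (intro exI[of _ h] conjI ballI allI impI)
    fix i assume i: "i \<in> I"
    show "homeomorphic_map (subtopology (disk (d i)) (open_disk (d i)))
        (subtopology Y ((f i \<circ> h i) ` open_disk (d i))) (f i \<circ> h i)"
    proof (rule homeomorphic_map_open_cell[OF cont'[OF i] compact_space_disk Y open_disk_subset])
      show "inj_on (f i \<circ> h i) (open_disk (d i))"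
        using inj[OF i] h(2)[OF i] hD(2)[OF i] open_disk_subset
        by (intro comp_inj_on) (auto intro: inj_on_subset)
      show "(f i \<circ> h i) ` (topspace (disk (d i)) - open_disk (d i)) \<inter> (f i \<circ> h i) ` open_disk (d i) = {}"
        unfolding cell[OF i]
      proof (safe)
        fix x u assume x: "x \<in> topspace (disk (d i))" "x \<notin> open_disk (d i)"
          and u: "u \<in> U i" "(f i \<circ> h i) x = f i u"
        obtain j where j: "j \<in> I" "d j < d i" "(f i \<circ> h i) x \<in> f j ` U j"
          using bd[OF i, of x] x by blast
        then have "i \<noteq> j" by auto
        then have "f i ` U i \<inter> f j ` U j = {}"
          using disj i j(1) by (auto simp: disjoint_family_on_def)
        then show "(f i \<circ> h i) x \<in> {}" using u j(3) by auto
      qed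
    qed
    have "boundary_sphere (d i) \<subseteq> topspace (disk (d i)) - open_disk (d i)"
      by (auto simp: boundary_sphere_def disk_def open_disk_def)
    then have "(f i \<circ> h i) ` boundary_sphere (d i) \<subseteq> (\<Union>j\<in>{j\<in>I. d j < d i}. f j ` U j)"
      using bd[OF i] by blast
    also have "\<dots> = (\<Union>j\<in>{j\<in>I. d j < d i}. (f j \<circ> h j) ` open_disk (d j))"
      using cell by auto
    finally show "\<exists>F. finite F \<and> F \<subseteq> {j \<in> I. d j < d i} \<and>
        (f i \<circ> h i) ` boundary_sphere (d i) \<subseteq> (\<Union>j\<in>F. (f j \<circ> h j) ` open_disk (d j))"
      using fin by (intro exI[of _ "{j \<in> I. d j < d i}"]) auto
  next
    show "disjoint_family_on (\<lambda>i. (f i \<circ> h i) ` open_disk (d i)) I"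
      using disj cell by (simp add: disjoint_family_on_def)
    have "f i ` U i \<subseteq> topspace Y" if "i \<in> I" for i
      using continuous_map_image_subset_topspace[OF cont[OF that]] ball_pair_subset[OF ball[OF that]] by blast
    then show "(\<Union>i\<in>I. (f i \<circ> h i) ` open_disk (d i)) = topspace Y"
      using cover cell by auto
  next
    fix A assume A: "A \<subseteq> topspace Y"
      "\<forall>i\<in>I. closedin (disk (d i)) {x \<in> topspace (disk (d i)). (f i \<circ> h i) x \<in> A}"
    let ?P = "\<lambda>i. {x \<in> topspace (disk (d i)). (f i \<circ> h i) x \<in> A}"
    have "closedin Y ((f i \<circ> h i) ` ?P i)" if "i \<in> I" for i
      using that A(2) Y cont' compact_space_disk
      by (meson closedin_compact_space compactin_imp_closedin image_compactin)
    then have "closedin Y (\<Union>i\<in>I. (f i \<circ> h i) ` ?P i)"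
      using fin by (intro closedin_Union) auto
    moreover have "(\<Union>i\<in>I. (f i \<circ> h i) ` ?P i) = A"
    proof (intro equalityI subsetI)
      fix y assume y: "y \<in> A"
      then obtain i where i: "i \<in> I" "y \<in> (f i \<circ> h i) ` open_disk (d i)"
        using A(1) cover cell by blast
      then show "y \<in> (\<Union>i\<in>I. (f i \<circ> h i) ` ?P i)" using y open_disk_subset[of "d i"] by blast
    qed auto
    ultimately show "closedin Y A" by simp
  qed (use h cont' Y in auto)
qed

subsection \<open>Topology of finite subset spaces\<close>

text \<open>These sets and those of \<open>openin_exp_space_inside\<close> are the subbasic sets of
  the Vietoris topology. That they are open in the quotient topology is all that separation
  requires.\<close>

lemma openin_exp_space_hit:
  assumes k: "k \<ge> 1" and W: "openin X W"
  shows "openin (exp_space k X) {\<Lambda> \<in> exp_set k X. \<Lambda> \<inter> W \<noteq> {}}"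
  unfolding openin_exp_space
proof
  let ?P = "product_topology (\<lambda>_. X) {..<k}"
  have "{x \<in> topspace ?P. x ` {..<k} \<in> {\<Lambda> \<in> exp_set k X. \<Lambda> \<inter> W \<noteq> {}}} =
      (\<Union>i\<in>{..<k}. {x \<in> topspace ?P. x i \<in> W})"
    using image_exp_set[OF k, of X] by blast
  moreover have "openin ?P {x \<in> topspace ?P. x i \<in> W}" if "i < k" for i
    using that W by (intro openin_continuous_map_preimage[OF continuous_map_product_projection]) auto
  ultimately show "openin ?P {x \<in> topspace ?P. x ` {..<k} \<in> {\<Lambda> \<in> exp_set k X. \<Lambda> \<inter> W \<noteq> {}}}"
    by auto
qed auto

lemma openin_exp_space_inside:
  assumes k: "k \<ge> 1" and W: "openin X W"
  shows "openin (exp_space k X) {\<Lambda> \<in> exp_set k X. \<Lambda> \<subseteq> W}"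
  unfolding openin_exp_space
proof
  let ?P = "product_topology (\<lambda>_. X) {..<k}"
  have "{x \<in> topspace ?P. x ` {..<k} \<in> {\<Lambda> \<in> exp_set k X. \<Lambda> \<subseteq> W}} = Pi\<^sub>E {..<k} (\<lambda>_. W)"
    using image_exp_set[OF k, of X] openin_subset[OF W]
    by (auto simp: PiE_iff) (meson extensional_arb lessThan_iff)
  then show "openin ?P {x \<in> topspace ?P. x ` {..<k} \<in> {\<Lambda> \<in> exp_set k X. \<Lambda> \<subseteq> W}}"
    using W by (simp add: openin_PiE)
qed auto

lemma Hausdorff_separate_point_finite:
  assumes X: "Hausdorff_space X" and p: "p \<in> topspace X" "p \<notin> F" and F: "finite F" "F \<subseteq> topspace X"
  obtains V W where "openin X V" "openin X W" "p \<in> V" "F \<subseteq> W" "V \<inter> W = {}"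
proof -
  have "compactin X {p}" "compactin X F" "disjnt {p} F"
    using p F by (auto intro: finite_imp_compactin)
  with X have "\<exists>V W. openin X V \<and> openin X W \<and> {p} \<subseteq> V \<and> F \<subseteq> W \<and> disjnt V W"
    unfolding Hausdorff_space_compact_sets by blast
  then show ?thesis using that by (auto simp: disjnt_def)
qed

text \<open>A point of one set that is missing from the other can be separated from the finite other
  set by disjoint open \<open>V\<close> and \<open>W\<close>. No set both meets \<open>V\<close> and
  lies inside \<open>W\<close>.\<close>

lemma Hausdorff_exp_space:
  assumes X: "Hausdorff_space X" and k: "k \<ge> 1"
  shows "Hausdorff_space (exp_space k X)"
  unfolding Hausdorff_space_def
proof (intro allI impI, elim conjE)
  have sep: "\<exists>V W. openin (exp_space k X) V \<and> openin (exp_space k X) W \<and> A \<in> V \<and> B \<in> W \<and> disjnt V W"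
    if AB: "A \<in> exp_set k X" "B \<in> exp_set k X" and p: "p \<in> A" "p \<notin> B" for A B p
  proof -
    have "p \<in> topspace X" "finite B" "B \<subseteq> topspace X" using AB p(1) by (auto simp: exp_set_def)
    then obtain V W where "openin X V" "openin X W" "p \<in> V" "B \<subseteq> W" "V \<inter> W = {}"
      using Hausdorff_separate_point_finite[OF X _ p(2)] by metis
    then show ?thesis
      using openin_exp_space_hit[OF k, of X V] openin_exp_space_inside[OF k, of X W] AB p
      by (intro exI[of _ "{\<Lambda> \<in> exp_set k X. \<Lambda> \<inter> V \<noteq> {}}"] exI[of _ "{\<Lambda> \<in> exp_set k X. \<Lambda> \<subseteq> W}"])
        (auto simp: disjnt_def)
  qed
  fix A B assume AB: "A \<in> topspace (exp_space k X)" "B \<in> topspace (exp_space k X)" "A \<noteq> B"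
  note AB' = AB(1,2)[unfolded topspace_exp_space[OF k]]
  from AB(3) obtain p where "p \<in> A \<and> p \<notin> B \<or> p \<in> B \<and> p \<notin> A" by blast
  then show "\<exists>V W. openin (exp_space k X) V \<and> openin (exp_space k X) W \<and> A \<in> V \<and> B \<in> W \<and> disjnt V W"
    using sep[OF AB'] sep[OF AB'(2,1)] disjnt_sym by metis
qed

text \<open>A surjection from the \<open>k\<close> slots onto \<open>G\<close>, with repetitions if
  \<open>G\<close> is smaller, lifts the map to the \<open>k\<close>-fold product, where continuity
  is coordinatewise.\<close>

lemma continuous_map_exp_space:
  assumes G: "finite G" "G \<noteq> {}" "card G \<le> k"
    and F: "\<And>g. g \<in> G \<Longrightarrow> continuous_map Z X (F g)"
  shows "continuous_map Z (exp_space k X) (\<lambda>z. (\<lambda>g. F g z) ` G)"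
proof -
  have k: "k \<ge> 1" using G by (metis One_nat_def Suc_leI card_gt_0_iff order_less_le_trans)
  \<comment> \<open>The surjection is obtained by viewing \<open>G\<close> as a point of the finite
    subset space of the discrete space \<open>G\<close>.\<close>
  have "G \<in> exp_set k (discrete_topology G)" using G by (auto simp: exp_set_def)
  then obtain s where s: "s \<in> topspace (product_topology (\<lambda>_. discrete_topology G) {..<k})" "s ` {..<k} = G"
    unfolding image_exp_set[OF k, symmetric] by blast
  have "continuous_map Z (product_topology (\<lambda>_. X) {..<k}) (\<lambda>z. \<lambda>t\<in>{..<k}. F (s t) z)"
    using F s(2) by (auto simp: continuous_map_componentwise)
  from continuous_map_compose[OF this quotient_imp_continuous_map[OF quotient_map_exp_space[OF k]]]
  have "continuous_map Z (exp_space k X) (\<lambda>z. (\<lambda>t\<in>{..<k}. F (s t) z) ` {..<k})"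
    by (simp add: o_def)
  moreover have "(\<lambda>t\<in>{..<k}. F (s t) z) ` {..<k} = (\<lambda>g. F g z) ` G" for z
    unfolding s(2)[symmetric] by auto
  ultimately show ?thesis by simp
qed

subsection \<open>The square parametrising a disc\<close>

lemma Re_kappa: "Re (kappa (x, y)) = x * (1 - cos (2 * pi * y)) - 1"
  by (simp add: kappa_def Re_exp)

lemma Im_kappa: "Im (kappa (x, y)) = - x * sin (2 * pi * y)"
  by (simp add: kappa_def Im_exp)

text \<open>For fixed \<open>x\<close> the curve is the circle of radius \<open>x\<close> about
  \<open>x - 1\<close>, tangent to the unit circle at \<open>-1\<close>. The formula writes the
  defect of the squared norm from 1 as a product that is non-negative on the square and positive in
  its interior.\<close>

lemma norm_kappa: "(norm (kappa (x, y)))\<^sup>2 = 1 - 2 * (1 - x) * x * (1 - cos (2 * pi * y))"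
proof -
  have "sin (2 * pi * y) * sin (2 * pi * y) = 1 - cos (2 * pi * y) * cos (2 * pi * y)"
    using sin_squared_eq[of "2 * pi * y"] by (simp add: power2_eq_square)
  then show ?thesis
    unfolding cmod_power2 Re_kappa Im_kappa unfolding power2_eq_square by algebra
qed

lemma kappa_in_cball:
  assumes "0 \<le> x" "x \<le> 1"
  shows "kappa (x, y) \<in> cball 0 1"
proof -
  have "0 \<le> 2 * (1 - x) * x * (1 - cos (2 * pi * y))" using assms by simp
  then have "(norm (kappa (x, y)))\<^sup>2 \<le> 1\<^sup>2" using norm_kappa[of x y] by simp
  then have "norm (kappa (x, y)) \<le> 1" by (rule power2_le_imp_le) simp
  then show ?thesis by simp
qed

lemma kappa_1_in_sphere: "kappa (1, y) \<in> sphere 0 1"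
proof -
  have "(norm (kappa (1, y)))\<^sup>2 = 1\<^sup>2" using norm_kappa[of 1 y] by simp
  then have "norm (kappa (1, y)) = 1" by (rule power2_eq_imp_eq) simp_all
  then show ?thesis by simp
qed

lemma kappa_sides: "kappa (0, y) = -1" "kappa (x, 0) = -1" "kappa (x, 1) = -1"
  by (simp_all add: complex_eq_iff Re_kappa Im_kappa)

lemma cos_2pi_less_1:
  assumes "0 < y" "y < 1"
  shows "cos (2 * pi * y) < 1"
proof -
  have "cos (2 * pi * y) \<noteq> 1"
  proof
    assume "cos (2 * pi * y) = 1"
    then obtain i :: int where "2 * pi * y = of_int i * 2 * pi"
      using cos_one_2pi_int by blast
    then have "y = of_int i" by simp
    then show False using assms by simp
  qed
  then show ?thesis using cos_le_one[of "2 * pi * y"] by linarith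
qed

lemma kappa_in_ball:
  assumes "0 < x" "x < 1" "0 < y" "y < 1"
  shows "kappa (x, y) \<in> ball 0 1"
proof -
  have "0 < 2 * (1 - x) * x * (1 - cos (2 * pi * y))"
    using cos_2pi_less_1[of y] assms by simp
  then have "(norm (kappa (x, y)))\<^sup>2 < 1\<^sup>2" using norm_kappa[of x y] by simp
  then have "norm (kappa (x, y)) < 1" by (rule power_less_imp_less_base) simp
  then show ?thesis by simp
qed

text \<open>Two circles of the family with different radii meet only at \<open>-1\<close>.
  Algebraically, \<open>w = kappa (x, y) + 1\<close> satisfies \<open>|w|^2 = 2 x Re w\<close>,
  which recovers \<open>x\<close> as soon as \<open>Re w > 0\<close>; the angle then
  follows.\<close>

lemma kappa_inject:
  assumes "0 < x" "0 < x'" "0 < y" "y < 1" "0 < y'" "y' < 1"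
    and eq: "kappa (x, y) = kappa (x', y')"
  shows "x = x' \<and> y = y'"
proof -
  let ?t = "2 * pi * y" and ?t' = "2 * pi * y'"
  let ?a = "x * (1 - cos ?t)" and ?b = "x * sin ?t"
  have a: "?a = x' * (1 - cos ?t')" and b: "?b = x' * sin ?t'"
    using eq by (simp_all add: complex_eq_iff Re_kappa Im_kappa)
  have sq: "(x * (1 - cos t))\<^sup>2 + (x * sin t)\<^sup>2 = 2 * x * (x * (1 - cos t))" for x t :: real
  proof -
    have "sin t * sin t = 1 - cos t * cos t" using sin_squared_eq[of t] by (simp add: power2_eq_square)
    then show ?thesis unfolding power2_eq_square by algebra
  qed
  have "?a\<^sup>2 + ?b\<^sup>2 = 2 * x * ?a" by (rule sq)
  moreover have "?a\<^sup>2 + ?b\<^sup>2 = 2 * x' * ?a" unfolding a b by (rule sq)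
  ultimately have "2 * x * ?a = 2 * x' * ?a" by (rule trans[OF sym])
  moreover have "?a > 0" using cos_2pi_less_1[of y] assms by simp
  ultimately have x: "x = x'" by auto
  then have "cos ?t = cos ?t'" "sin ?t = sin ?t'" using a b assms(1) by simp_all
  \<comment> \<open>Equal exponentials have arguments differing by a multiple of
    \<open>2 * pi\<close>, so \<open>y - y'\<close> is an integer, and it lies strictly between -1
    and 1.\<close>
  then have "exp (\<i> * of_real ?t) = exp (\<i> * of_real ?t')"
    by (simp add: complex_eq_iff Re_exp Im_exp)
  then obtain k :: int where k: "\<i> * of_real ?t = \<i> * of_real ?t' + of_int (2 * k) * pi * \<i>"
    unfolding exp_eq by blast
  then have "Im (\<i> * of_real ?t) = Im (\<i> * of_real ?t' + of_int (2 * k) * pi * \<i>)" by (rule arg_cong)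
  then have "2 * pi * y = 2 * pi * (y' + of_int k)" by (simp add: algebra_simps)
  then have "y = y' + of_int k" by simp
  then have "- 1 < real_of_int k" "real_of_int k < 1" using assms by linarith+
  then have "k = 0" by simp
  then show ?thesis using x \<open>y = y' + of_int k\<close> by simp
qed

lemma kappa_surj:
  assumes "z \<in> ball 0 1"
  obtains x y where "0 < x" "x < 1" "0 < y" "y < 1" "z = kappa (x, y)"
proof -
  define w where "w = z + 1"
  have z: "(Re z)\<^sup>2 + (Im z)\<^sup>2 < 1"
    using assms by (simp add: cmod_def)
  then have "(Re z)\<^sup>2 < 1" using zero_le_power2[of "Im z"] by linarith
  then have "\<bar>Re z\<bar> < 1" by (simp add: abs_square_less_1)
  then have rw: "Re w > 0" by (simp add: w_def abs_less_iff)
  \<comment> \<open>This solves \<open>|w|^2 = 2 x Re w\<close>, the equation of the circle of the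
    family that passes through the given point.\<close>
  define x where "x = (norm w)\<^sup>2 / (2 * Re w)"
  have x2: "(norm w)\<^sup>2 = 2 * x * Re w" using rw by (simp add: x_def)
  have nw: "norm w > 0" using rw by auto
  have x0: "x > 0" using rw nw by (simp add: x_def)
  have "(norm w)\<^sup>2 < 2 * Re w"
    using z unfolding cmod_power2 by (simp add: w_def power2_eq_square algebra_simps)
  then have x1: "x < 1" using rw by (simp add: x_def)
  \<comment> \<open>The value that \<open>exp (2 pi i y)\<close> must have for
    \<open>kappa (x, y)\<close> to be the given point. The choice of \<open>x\<close> puts it on the
    unit circle, and \<open>w \<noteq> 0\<close> keeps it away from 1, so the angle is not
    0.\<close>
  define u where "u = 1 - w / of_real x"
  have "(norm (of_real x - w))\<^sup>2 = x\<^sup>2"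
    using x2 unfolding cmod_power2 by (simp add: power2_eq_square algebra_simps)
  then have "norm (of_real x - w) = x" using x0 by (simp add: power2_eq_iff_nonneg)
  moreover have "u = (of_real x - w) / of_real x" using x0 by (simp add: u_def field_simps)
  ultimately have u: "norm u = 1" using x0 by (simp add: norm_divide)
  define y where "y = Arg2pi u / (2 * pi)"
  have eu: "u = exp (\<i> * of_real (Arg2pi u))" using Arg2pi_eq[of u] u by simp
  have "u \<noteq> 1" using nw x0 by (auto simp: u_def)
  then have "Arg2pi u \<noteq> 0" using eu by auto
  then have "Arg2pi u > 0" "Arg2pi u < 2 * pi" using Arg2pi[of u] by auto
  then have y: "0 < y" "y < 1" by (simp_all add: y_def)
  have "exp (2 * complex_of_real pi * \<i> * complex_of_real y) = u"
    by (subst eu) (simp add: y_def mult_ac)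
  then have "kappa (x, y) = of_real x * (1 - u) - 1" by (simp add: kappa_def)
  also have "\<dots> = z" using x0 by (simp add: u_def w_def)
  finally show ?thesis using that x0 x1 y by metis
qed

lemma continuous_on_kappa: "continuous_on A kappa"
  unfolding kappa_def case_prod_unfold by (intro continuous_intros)

subsection \<open>Unfolding the complex\<close>

text \<open>Invariance of domain, applied to \<open>h \<circ> p\<close> and to its inverse, shows
  that each carries the interior of its domain to an open set, so the interiors correspond. The
  auxiliary \<open>p\<close> is there because \<open>disk d\<close> lies in an infinite product,
  whereas the theorem speaks of open sets of a Euclidean space.\<close>

lemma homeomorphic_map_disk_interior:
  fixes p :: "'b::euclidean_space \<Rightarrow> nat \<Rightarrow> real" and K :: "'b set"
  assumes p: "homeomorphic_map (top_of_set (cball 0 1)) (disk d) p" "p ` ball 0 1 = open_disk d"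
    and h: "homeomorphic_map (disk d) (top_of_set K) h"
  shows "h ` open_disk d = interior K"
proof -
  obtain g where g: "homeomorphic_maps (top_of_set (cball 0 1)) (top_of_set K) (h \<circ> p) g"
    using homeomorphic_map_compose[OF p(1) h] unfolding homeomorphic_map_maps by blast
  let ?f = "h \<circ> p"
  have c: "continuous_on (cball 0 1) ?f" "?f ` cball 0 1 \<subseteq> K" "continuous_on K g" "g ` K \<subseteq> cball 0 1"
    and gf: "\<And>x. x \<in> cball 0 1 \<Longrightarrow> g (?f x) = x" and fg: "\<And>y. y \<in> K \<Longrightarrow> ?f (g y) = y"
    using g unfolding homeomorphic_maps_def continuous_map_in_subtopology continuous_map_iff_continuous
    by auto
  have "open (?f ` ball 0 1)"
  proof (rule invariance_of_domain_gen)
    show "continuous_on (ball 0 1) ?f" using c(1) by (rule continuous_on_subset) auto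
    show "inj_on ?f (ball 0 1)" by (rule inj_on_inverseI[of _ g]) (use gf in auto)
  qed auto
  moreover have "?f ` ball 0 1 \<subseteq> K" using c(2) by auto
  ultimately have 1: "?f ` ball 0 1 \<subseteq> interior K" by (simp add: interior_maximal)
  have "open (g ` interior K)"
  proof (rule invariance_of_domain_gen)
    show "continuous_on (interior K) g" using c(3) interior_subset by (rule continuous_on_subset)
    show "inj_on g (interior K)"
      by (rule inj_on_inverseI[of _ ?f]) (use fg interior_subset in blast)
  qed auto
  moreover have "g ` interior K \<subseteq> cball 0 1" using c(4) interior_subset by blast
  ultimately have 2: "g ` interior K \<subseteq> ball 0 1" using interior_maximal interior_cball by metis
  have "interior K \<subseteq> ?f ` ball 0 1"
  proof
    fix y assume y: "y \<in> interior K"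
    then have "?f (g y) = y" using fg interior_subset by blast
    then show "y \<in> ?f ` ball 0 1" using 2 y by (metis image_subset_iff imageI)
  qed
  with 1 have "?f ` ball 0 1 = interior K" by (rule equalityI)
  then show ?thesis using p(2) by (metis image_comp)
qed

lemma disk_1_interval:
  "homeomorphic_map (top_of_set (cball 0 1)) (disk 1) (\<lambda>t i. if i = 0 then t else (0::real))"
  "(\<lambda>t i. if i = 0 then t else (0::real)) ` ball 0 1 = open_disk 1"
proof -
  let ?p = "\<lambda>t i. if i = (0::nat) then t else (0::real)"
  have d: "disk 1 = top_of_set {x. (\<forall>i\<ge>1. x i = 0) \<and> (\<Sum>i<1. (x i)\<^sup>2) \<le> 1}"
    by (simp add: disk_def subtopology_Euclidean_space)
  have inv: "?p (x 0) = x" if "\<forall>i\<ge>1. x i = 0" for x :: "nat \<Rightarrow> real"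
    using that by (auto simp: fun_eq_iff)
  show "homeomorphic_map (top_of_set (cball 0 1)) (disk 1) ?p"
    unfolding d
  proof (rule homeomorphic_map_top_of_setI[of _ _ _ "\<lambda>x. x 0"])
    show "continuous_on (cball 0 1) ?p"
    proof (rule continuous_on_coordinatewise_then_product)
      show "continuous_on (cball 0 1) (\<lambda>x. ?p x i)" for i by (cases "i = 0") auto
    qed
  qed (use inv in \<open>auto simp: continuous_on_eval abs_square_le_1\<close>)
  show "?p ` ball 0 1 = open_disk 1"
  proof (intro equalityI subsetI)
    fix x assume x: "x \<in> open_disk 1"
    then have E: "\<forall>i\<ge>1. x i = 0" by (simp add: open_disk_def topspace_Euclidean_space)
    have "x 0 \<in> ball 0 1" using x by (simp add: open_disk_def abs_square_less_1)
    from imageI[OF this, of ?p] show "x \<in> ?p ` ball 0 1" unfolding inv[OF E] .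
  qed (auto simp: open_disk_def topspace_Euclidean_space abs_square_less_1)
qed

lemma disk_2_complex:
  "homeomorphic_map (top_of_set (cball 0 1)) (disk 2) (\<lambda>z i. if i = 0 then Re z else if i = 1 then Im z else 0)"
  "(\<lambda>z i. if i = 0 then Re z else if i = 1 then Im z else 0) ` ball 0 1 = open_disk 2"
proof -
  let ?p = "\<lambda>z i. if i = (0::nat) then Re z else if i = 1 then Im z else 0"
  have s: "(\<Sum>i<2. f i) = f 0 + f 1" for f :: "nat \<Rightarrow> real" by (simp add: numeral_2_eq_2)
  have d: "disk 2 = top_of_set {x. (\<forall>i\<ge>2. x i = 0) \<and> (x 0)\<^sup>2 + (x 1)\<^sup>2 \<le> 1}"
    by (simp add: disk_def subtopology_Euclidean_space s)
  have inv: "?p (Complex (x 0) (x 1)) = x" if "\<forall>i\<ge>2. x i = 0" for x :: "nat \<Rightarrow> real"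
  proof
    show "?p (Complex (x 0) (x 1)) i = x i" for i
      using that by (cases "i \<ge> 2") (auto simp: not_le less_2_cases_iff)
  qed
  have od: "x \<in> open_disk 2 \<longleftrightarrow> (\<forall>i\<ge>2. x i = 0) \<and> (x 0)\<^sup>2 + (x 1)\<^sup>2 < 1" for x
    by (simp add: open_disk_def topspace_Euclidean_space s)
  show "homeomorphic_map (top_of_set (cball 0 1)) (disk 2) ?p"
    unfolding d
  proof (rule homeomorphic_map_top_of_setI[of _ _ _ "\<lambda>x. Complex (x 0) (x 1)"])
    show "continuous_on (cball 0 1) ?p"
    proof (rule continuous_on_coordinatewise_then_product)
      show "continuous_on (cball 0 1) (\<lambda>x. ?p x i)" for i
        by (cases "i = 0"; cases "i = 1") (auto intro!: continuous_intros)
    qed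
    show "continuous_on A (\<lambda>x. Complex (x 0) (x 1))" for A :: "(nat \<Rightarrow> real) set"
      unfolding Complex_eq by (intro continuous_intros continuous_on_eval)
    show "?p (Complex (x 0) (x 1)) = x" if "x \<in> {x. (\<forall>i\<ge>2. x i = 0) \<and> (x 0)\<^sup>2 + (x 1)\<^sup>2 \<le> 1}" for x
      using inv[of x] that by blast
  qed (auto simp: cmod_def)
  show "?p ` ball 0 1 = open_disk 2"
  proof (intro equalityI subsetI)
    fix x assume x: "x \<in> open_disk 2"
    then have E: "\<forall>i\<ge>2. x i = 0" by (simp add: od)
    have "Complex (x 0) (x 1) \<in> ball 0 1" using x by (simp add: od cmod_def)
    from imageI[OF this, of ?p] show "x \<in> ?p ` ball 0 1" unfolding inv[OF E] .
  qed (auto simp: od cmod_def)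
qed

text \<open>A converse of \<open>cell_structure_finiteI\<close> that removes the unknown
  parametrisations. By \<open>int\<close> every homeomorphism from the disk to \<open>B i\<close>
  has the same image of the open disk, so the open cells can be expressed through \<open>U i\<close>
  alone.\<close>

lemma cell_structure_unfold:
  assumes "cell_structure Y I d B f"
    and int: "\<forall>i\<in>I. \<forall>h. homeomorphic_map (disk (d i)) (B i) h \<longrightarrow> h ` open_disk (d i) = U i"
  shows "Hausdorff_space Y"
    and "\<And>i. i \<in> I \<Longrightarrow> continuous_map (B i) Y (f i)"
    and "\<And>i. i \<in> I \<Longrightarrow> inj_on (f i) (U i)"
    and "disjoint_family_on (\<lambda>i. f i ` U i) I"
    and "(\<Union>i\<in>I. f i ` U i) = topspace Y"
    and "\<And>i z. i \<in> I \<Longrightarrow> z \<in> topspace (B i) - U i \<Longrightarrow> \<exists>j\<in>I. d j < d i \<and> f i z \<in> f j ` U j"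
proof -
  obtain h where h: "\<And>i. i \<in> I \<Longrightarrow> homeomorphic_map (disk (d i)) (B i) (h i)"
    and cw: "cw_structure Y I d (\<lambda>i. f i \<circ> h i)"
    using assms(1) unfolding cell_structure_def by blast
  note cw = cw[unfolded cw_structure_def]
  have U: "h i ` open_disk (d i) = U i" if "i \<in> I" for i using int h[OF that] that by blast
  have cell: "(f i \<circ> h i) ` open_disk (d i) = f i ` U i" if "i \<in> I" for i
    by (simp only: image_comp[symmetric] U[OF that])
  show "Hausdorff_space Y" using cw by blast
  show "continuous_map (B i) Y (f i)" if i: "i \<in> I" for i
  proof -
    obtain g where g: "homeomorphic_maps (disk (d i)) (B i) (h i) g"
      using h[OF i] unfolding homeomorphic_map_maps by blast
    have "continuous_map (disk (d i)) Y (f i \<circ> h i)" using cw i by blast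
    then have "continuous_map (B i) Y ((f i \<circ> h i) \<circ> g)"
      using g unfolding homeomorphic_maps_def by (blast intro: continuous_map_compose)
    then show ?thesis
      by (rule continuous_map_eq) (use g in \<open>simp add: homeomorphic_maps_def\<close>)
  qed
  show "inj_on (f i) (U i)" if i: "i \<in> I" for i
  proof -
    have "homeomorphic_map (subtopology (disk (d i)) (open_disk (d i)))
        (subtopology Y ((f i \<circ> h i) ` open_disk (d i))) (f i \<circ> h i)" using cw i by blast
    from homeomorphic_imp_injective_map[OF this] have "inj_on (f i \<circ> h i) (open_disk (d i))"
      using open_disk_subset by (simp add: inf.absorb2)
    then show ?thesis using inj_on_imageI U[OF i] by metis
  qed
  show "disjoint_family_on (\<lambda>i. f i ` U i) I"
    using cw cell unfolding disjoint_family_on_def by simp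
  show "(\<Union>i\<in>I. f i ` U i) = topspace Y" using cw cell by simp
  show "\<exists>j\<in>I. d j < d i \<and> f i z \<in> f j ` U j" if i: "i \<in> I" and z: "z \<in> topspace (B i) - U i" for i z
  proof -
    obtain x where x: "x \<in> topspace (disk (d i))" "z = h i x"
      using z homeomorphic_imp_surjective_map[OF h[OF i]] by blast
    then have "x \<notin> open_disk (d i)" using z U[OF i] by blast
    then have "x \<in> boundary_sphere (d i)"
      using x(1) by (auto simp: disk_def open_disk_def boundary_sphere_def)
    moreover obtain F where "F \<subseteq> {j \<in> I. d j < d i}"
      "(f i \<circ> h i) ` boundary_sphere (d i) \<subseteq> (\<Union>j\<in>F. (f j \<circ> h j) ` open_disk (d j))"
      using cw i by meson
    ultimately obtain j where "j \<in> I" "d j < d i" "(f i \<circ> h i) x \<in> (f j \<circ> h j) ` open_disk (d j)"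
      by blast
    then show ?thesis using cell[of j] x(2) by auto
  qed
qed

fun int2 :: "cell2 \<Rightarrow> complex set" where
  "int2 Vertex = {0}"
| "int2 (Edge i) = complex_of_real ` {0<..<1}"
| "int2 (Face i) = ball 0 1"

lemma homeomorphic_map_dom2_interior:
  assumes h: "homeomorphic_map (disk (dim2 c)) (dom2 c) h"
  shows "h ` open_disk (dim2 c) = int2 c"
proof (cases c)
  case Vertex
  have "open_disk 0 = topspace (disk 0)"
    by (auto simp: disk_def open_disk_def)
  then show ?thesis using homeomorphic_imp_surjective_map[OF h] Vertex by simp
next
  case (Edge i)
  \<comment> \<open>The domain of an edge is a segment in the plane and has empty interior there.
    Projecting it to the real line makes the dimensions agree, as invariance of domain
    requires.\<close>
  have r: "homeomorphic_map (top_of_set (complex_of_real ` {0..1})) (top_of_set {0..1}) Re"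
    by (rule homeomorphic_map_top_of_setI[of _ _ _ complex_of_real]) (auto intro!: continuous_intros)
  have "(Re \<circ> h) ` open_disk 1 = interior {0..1}"
    by (rule homeomorphic_map_disk_interior[OF disk_1_interval])
      (use h Edge r homeomorphic_map_compose[of _ _ h _ Re] in \<open>simp add: o_def\<close>)
  then have R: "Re ` h ` open_disk 1 = {0<..<1}" by (simp add: image_comp)
  have "h ` open_disk 1 \<subseteq> complex_of_real ` {0..1}"
    using homeomorphic_imp_surjective_map[OF h] open_disk_subset[of 1] Edge
    by (metis One_nat_def dim2.simps(2) dom2.simps(2) image_mono topspace_euclidean_subtopology)
  then have "complex_of_real (Re w) = w" if "w \<in> h ` open_disk 1" for w using that by auto
  then have "complex_of_real ` Re ` h ` open_disk 1 = h ` open_disk 1"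
    unfolding image_image by (rule trans[OF image_cong[OF refl]]) auto
  then show ?thesis using R Edge by simp
next
  case (Face i)
  have "h ` open_disk 2 = interior (cball 0 1)"
    by (rule homeomorphic_map_disk_interior[OF disk_2_complex]) (use h Face in simp)
  then show ?thesis using Face by simp
qed

text \<open>The complex as seen pointwise: a partition into the vertex, open intervals and open unit
  discs, together with the places where interval ends and boundary circles go. No parametrisation by
  standard disks remains.\<close>

locale one_vertex_complex =
  fixes X :: "'a topology" and v :: 'a and n m :: nat
    and e :: "nat \<Rightarrow> real \<Rightarrow> 'a" and \<phi> :: "nat \<Rightarrow> complex \<Rightarrow> 'a"
  assumes Hausdorff: "Hausdorff_space X"
    and vertex: "v \<in> topspace X"
    and edge_cont: "\<And>i. i < n \<Longrightarrow> continuous_map (top_of_set {0..1}) X (e i)"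
    and face_cont: "\<And>i. i < m \<Longrightarrow> continuous_map (top_of_set (cball 0 1)) X (\<phi> i)"
    and edge_inject: "\<And>i j s t. \<lbrakk>i < n; j < n; s \<in> {0<..<1}; t \<in> {0<..<1}; e i s = e j t\<rbrakk> \<Longrightarrow> i = j \<and> s = t"
    and disc_inject: "\<And>i j z w. \<lbrakk>i < m; j < m; z \<in> ball 0 1; w \<in> ball 0 1; \<phi> i z = \<phi> j w\<rbrakk> \<Longrightarrow> i = j \<and> z = w"
    and edge_disc: "\<And>i j s z. \<lbrakk>i < n; j < m; s \<in> {0<..<1}; z \<in> ball 0 1\<rbrakk> \<Longrightarrow> e i s \<noteq> \<phi> j z"
    and edge_vertex: "\<And>i s. \<lbrakk>i < n; s \<in> {0<..<1}\<rbrakk> \<Longrightarrow> e i s \<noteq> v"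
    and disc_vertex: "\<And>i z. \<lbrakk>i < m; z \<in> ball 0 1\<rbrakk> \<Longrightarrow> \<phi> i z \<noteq> v"
    and disc_cover: "\<And>p. p \<in> topspace X \<Longrightarrow> p = v \<or> (\<exists>i<n. \<exists>s\<in>{0<..<1}. p = e i s) \<or> (\<exists>i<m. \<exists>z\<in>ball 0 1. p = \<phi> i z)"
    and edge_ends: "\<And>i. i < n \<Longrightarrow> e i 0 = v" "\<And>i. i < n \<Longrightarrow> e i 1 = v"
    and disc_boundary: "\<And>i z. \<lbrakk>i < m; z \<in> sphere 0 1\<rbrakk> \<Longrightarrow> \<phi> i z = v \<or> (\<exists>j<n. \<exists>s\<in>{0<..<1}. \<phi> i z = e j s)"
    and disc_base: "\<And>i. i < m \<Longrightarrow> \<phi> i (-1) = v"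

lemma one_vertex_complexI:
  assumes "one_vertex_2_complex X v n e m \<phi>"
  shows "one_vertex_complex X v n m e \<phi>"
proof -
  let ?I = "cells2 n m" and ?f = "char2 v e \<phi>"
  have cs: "cell_structure X ?I dim2 dom2 ?f" and base: "\<And>i. i < m \<Longrightarrow> \<phi> i (-1) = v"
    using assms by (auto simp: one_vertex_2_complex_def)
  have "\<forall>c\<in>?I. \<forall>h. homeomorphic_map (disk (dim2 c)) (dom2 c) h \<longrightarrow> h ` open_disk (dim2 c) = int2 c"
    using homeomorphic_map_dom2_interior by blast
  note cw = cell_structure_unfold[OF cs this]
  have I: "Vertex \<in> ?I" "\<And>i. i < n \<Longrightarrow> Edge i \<in> ?I" "\<And>i. i < m \<Longrightarrow> Face i \<in> ?I"
    by (auto simp: cells2_def)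
  have disj: "c = d" if "c \<in> ?I" "d \<in> ?I" "z \<in> int2 c" "w \<in> int2 d" "?f c z = ?f d w" for c d z w
    using cw(4) that by (auto simp: disjoint_family_on_def)
  have E: "?f (Edge i) (complex_of_real s) = e i s" for i s by simp
  have Eint: "complex_of_real s \<in> int2 (Edge i)" if "s \<in> {0<..<1}" for s i using that by simp
  have Fint: "z \<in> int2 (Face i)" if "z \<in> ball 0 1" for z i using that by simp
  show ?thesis
  proof
    show "Hausdorff_space X" by (rule cw(1))
    show "v \<in> topspace X"
    proof -
      have "v \<in> (\<Union>c\<in>?I. ?f c ` int2 c)" using I(1) by (intro UN_I[of Vertex]) auto
      then show ?thesis using cw(5) by blast
    qed
    show "continuous_map (top_of_set {0..1}) X (e i)" if "i < n" for i
    proof -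
      have "continuous_map (top_of_set {0..1}) (top_of_set (complex_of_real ` {0..1})) complex_of_real"
        by (auto simp: continuous_map_in_subtopology intro!: continuous_intros)
      from continuous_map_compose[OF this, of X "?f (Edge i)"] show ?thesis
        using cw(2)[OF I(2)[OF that]] by (simp add: o_def)
    qed
    show "continuous_map (top_of_set (cball 0 1)) X (\<phi> i)" if "i < m" for i
      using cw(2)[OF I(3)[OF that]] by simp
    show "i = j \<and> s = t" if "i < n" "j < n" "s \<in> {0<..<1}" "t \<in> {0<..<1}" "e i s = e j t" for i j s t
    proof -
      have "Edge i = Edge j"
        by (rule disj[OF I(2)[OF that(1)] I(2)[OF that(2)] Eint[OF that(3)] Eint[OF that(4)]])
          (use that(5) in simp)
      then have "j = i" by simp
      moreover have "complex_of_real s = complex_of_real t"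
        by (rule inj_onD[OF cw(3)[OF I(2)[OF that(1)]] _ Eint[OF that(3)] Eint[OF that(4)]])
          (use that(5) \<open>j = i\<close> in simp)
      ultimately show ?thesis by simp
    qed
    show "i = j \<and> z = w" if "i < m" "j < m" "z \<in> ball 0 1" "w \<in> ball 0 1" "\<phi> i z = \<phi> j w" for i j z w
    proof -
      have "Face i = Face j"
        by (rule disj[OF I(3)[OF that(1)] I(3)[OF that(2)] Fint[OF that(3)] Fint[OF that(4)]])
          (use that(5) in simp)
      then have "j = i" by simp
      moreover have "z = w"
        by (rule inj_onD[OF cw(3)[OF I(3)[OF that(1)]] _ Fint[OF that(3)] Fint[OF that(4)]])
          (use that(5) \<open>j = i\<close> in simp)
      ultimately show ?thesis by simp
    qed
    show "e i s \<noteq> \<phi> j z" if "i < n" "j < m" "s \<in> {0<..<1}" "z \<in> ball 0 1" for i j s z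
      using disj[OF I(2)[OF that(1)] I(3)[OF that(2)] Eint[OF that(3)] Fint[OF that(4)]] by auto
    show "e i s \<noteq> v" if "i < n" "s \<in> {0<..<1}" for i s
      using disj[OF I(2)[OF that(1)] I(1) Eint[OF that(2)], of 0] by auto
    show "\<phi> i z \<noteq> v" if "i < m" "z \<in> ball 0 1" for i z
      using disj[OF I(3)[OF that(1)] I(1) Fint[OF that(2)], of 0] by auto
    show "p = v \<or> (\<exists>i<n. \<exists>s\<in>{0<..<1}. p = e i s) \<or> (\<exists>i<m. \<exists>z\<in>ball 0 1. p = \<phi> i z)"
      if p: "p \<in> topspace X" for p
    proof -
      obtain c z where c: "c \<in> ?I" "z \<in> int2 c" "p = ?f c z"
        using p unfolding cw(5)[symmetric] by (elim UN_E imageE)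
      then show ?thesis
      proof (cases c)
        case (Edge i)
        then obtain s where "s \<in> {0<..<1}" "p = e i s" "i < n" using c by (auto simp: cells2_def)
        then show ?thesis by blast
      next
        case (Face i)
        then have "z \<in> ball 0 1" "p = \<phi> i z" "i < m" using c by (auto simp: cells2_def)
        then show ?thesis by blast
      qed simp
    qed
    \<comment> \<open>An endpoint must land in an open cell of dimension below 1, and
      \<open>Vertex\<close> is the only such cell.\<close>
    have ends: "e i t = v" if "i < n" "t = 0 \<or> t = 1" for i t
    proof -
      have "complex_of_real t \<in> topspace (dom2 (Edge i)) - int2 (Edge i)" using that(2) by auto
      from cw(6)[OF I(2)[OF that(1)] this] obtain c where
        "c \<in> ?I" "dim2 c < 1" "e i t \<in> ?f c ` int2 c" by auto
      then show ?thesis by (cases c) auto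
    qed
    show "e i 0 = v" "e i 1 = v" if "i < n" for i using ends that by auto
    show "\<phi> i z = v \<or> (\<exists>j<n. \<exists>s\<in>{0<..<1}. \<phi> i z = e j s)" if "i < m" "z \<in> sphere 0 1" for i z
    proof -
      have "z \<in> topspace (dom2 (Face i)) - int2 (Face i)" using that(2) by auto
      from cw(6)[OF I(3)[OF that(1)] this] obtain c where
        "c \<in> ?I" "dim2 c < 2" "\<phi> i z \<in> ?f c ` int2 c" by auto
      then show ?thesis
      proof (cases c)
        case (Edge j)
        with \<open>c \<in> ?I\<close> \<open>\<phi> i z \<in> ?f c ` int2 c\<close> obtain s where
          "s \<in> {0<..<1}" "\<phi> i z = e j s" "j < n" by (auto simp: cells2_def)
        then show ?thesis by blast
      qed (use \<open>\<phi> i z \<in> ?f c ` int2 c\<close> \<open>dim2 c < 2\<close> in auto)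
    qed
  qed (rule base)
qed

subsection \<open>Generators and columns of a cell\<close>

text \<open>A generator names one slot of the index that contributes a point:
  \<open>Inl (i, b)\<close> is the \<open>b\<close>-th point on edge \<open>i\<close>, and
  \<open>Inr (q, a, b)\<close> is the \<open>b\<close>-th point in column \<open>a\<close> of the
  \<open>q\<close>-th face factor.\<close>

type_synonym generator = "(nat \<times> nat) + (nat \<times> nat \<times> nat)"

definition gens :: "cell_index \<Rightarrow> generator set" where
  "gens = (\<lambda>(T, J). (SIGMA i:{..<length J}. {..<J ! i}) <+>
     (SIGMA q:{..<length T}. SIGMA a:{..<length (snd (T ! q))}. {..<snd (T ! q) ! a}))"

definition cols :: "cell_index \<Rightarrow> (nat \<times> nat) set" where
  "cols = (\<lambda>(T, J). SIGMA q:{..<length T}. {..<length (snd (T ! q))})"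

definition gen_point ::
  "(nat \<Rightarrow> real \<Rightarrow> 'a) \<Rightarrow> (nat \<Rightarrow> complex \<Rightarrow> 'a) \<Rightarrow> cell_index \<Rightarrow> cell_point \<Rightarrow> generator \<Rightarrow> 'a" where
  "gen_point e \<phi> = (\<lambda>(T, J) (w, z) g. case g of
     Inl (i, b) \<Rightarrow> e i (z i b)
   | Inr (q, a, b) \<Rightarrow> \<phi> (fst (T ! q)) (kappa (snd (w q) a, fst (w q) a b)))"

text \<open>The face is recorded by its number in the complex and not by its position
  \<open>q\<close> in the list, so that the result can be compared with data read off from the
  finite set alone.\<close>

definition col_point :: "cell_index \<Rightarrow> cell_point \<Rightarrow> nat \<times> nat \<Rightarrow> nat \<times> real" where
  "col_point = (\<lambda>(T, J) (w, z) (q, a). (fst (T ! q), snd (w q) a))"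

definition open_simplex_product :: "nat list \<Rightarrow> (nat \<Rightarrow> nat \<Rightarrow> real) set" where
  "open_simplex_product S = (\<Pi>\<^sub>E a\<in>{..<length S}. open_simplex (S ! a))"

definition open_cell :: "cell_index \<Rightarrow> cell_point set" where
  "open_cell = (\<lambda>(T, J).
     (\<Pi>\<^sub>E q\<in>{..<length T}. open_simplex_product (snd (T ! q)) \<times> open_simplex (length (snd (T ! q)))) \<times>
     open_simplex_product J)"

lemma finite_gens: "finite (gens c)"
  by (auto simp: gens_def case_prod_unfold)

lemma finite_cols: "finite (cols c)"
  by (auto simp: cols_def case_prod_unfold)

lemma sum_list_map_nth: "sum_list (map f xs) = (\<Sum>i<length xs. f (xs ! i))"
  for f :: "'b \<Rightarrow> nat"
  by (simp add: sum_list_sum_nth atLeast0LessThan)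

lemma sum_list_nth: "sum_list xs = (\<Sum>i<length xs. xs ! i)" for xs :: "nat list"
  by (simp add: sum_list_sum_nth atLeast0LessThan)

lemma card_gens: "card (gens (T, J)) = sum_list J + (\<Sum>(i, S)\<leftarrow>T. sum_list S)"
  unfolding gens_def prod.case
  by (subst card_Plus) (auto simp: sum_list_map_nth sum_list_nth case_prod_unfold)

text \<open>Each edge coordinate and each \<open>y\<close>-coordinate belongs to one generator, and
  each \<open>x\<close>-coordinate to one column.\<close>

lemma cell_dim_eq: "cell_dim c = card (gens c) + card (cols c)"
proof -
  obtain T J where c: "c = (T, J)" by (cases c)
  have "card (cols c) = (\<Sum>(i, S)\<leftarrow>T. length S)"
    unfolding cols_def c prod.case by (auto simp: sum_list_map_nth case_prod_unfold)
  moreover have "(\<Sum>(i, S)\<leftarrow>T. sum_list S + length S) = (\<Sum>(i, S)\<leftarrow>T. sum_list S) + (\<Sum>(i, S)\<leftarrow>T. length S)"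
    by (simp add: case_prod_unfold sum_list_addf)
  ultimately show ?thesis unfolding c card_gens by (simp add: cell_dim_def)
qed

text \<open>Writing the value of a cell as the image of a finite set of generators reduces
  continuity to single points and the count of points to injectivity.\<close>

lemma free_cell_eq: "free_cell e \<phi> c p = gen_point e \<phi> c p ` gens c"
  for e :: "nat \<Rightarrow> real \<Rightarrow> 'a" and \<phi>
proof -
  obtain T J w z where cp: "c = (T, J)" "p = (w, z)" by (metis surj_pair)
  have "gen_point e \<phi> c p ` gens c =
      (\<Union>q<length T. {\<phi> (fst (T ! q)) (kappa (snd (w q) a, fst (w q) a b)) | a b.
          a < length (snd (T ! q)) \<and> b < snd (T ! q) ! a}) \<union>
      {e i (z i b) | i b. i < length J \<and> b < J ! i}"
    unfolding cp gens_def gen_point_def prod.case Plus_def image_Un image_image sum.case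
    by (auto simp: image_iff) blast+
  moreover have "tau_free f S t = {f (kappa (snd t a, fst t a b)) | a b. a < length S \<and> b < S ! a}" for f :: "complex \<Rightarrow> 'a" and S t
    unfolding tau_free_def case_prod_unfold by blast
  ultimately show ?thesis
    unfolding cp free_cell_def prod.case sigma_free_def by simp
qed

lemma based_cell_eq: "based_cell v e \<phi> c p = insert v (gen_point e \<phi> c p ` gens c)"
  unfolding free_cell_eq[symmetric]
  by (auto simp: based_cell_def free_cell_def tau_based_def sigma_based_def case_prod_unfold)

lemma ball_pair_simplex_product:
  "ball_pair (sum_list S) (simplex_product S) (open_simplex_product S)"
  unfolding sum_list_nth simplex_product_def open_simplex_product_def
  by (intro ball_pair_product ball_pair_simplex open_simplex_subset)

lemma ball_pair_cell: "ball_pair (cell_dim c) (cell_dom c) (open_cell c)"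
proof -
  obtain T J where c: "c = (T, J)" by (cases c)
  have face: "ball_pair (sum_list S + length S) (tau_dom S) (open_simplex_product S \<times> open_simplex (length S))" for S
    unfolding tau_dom_def by (intro ball_pair_prod ball_pair_simplex_product ball_pair_simplex)
  have "ball_pair (\<Sum>q<length T. sum_list (snd (T ! q)) + length (snd (T ! q)))
      (product_topology (\<lambda>q. tau_dom (snd (T ! q))) {..<length T})
      (\<Pi>\<^sub>E q\<in>{..<length T}. open_simplex_product (snd (T ! q)) \<times> open_simplex (length (snd (T ! q))))"
    by (intro ball_pair_product face ball_pair_subset[OF face])
  from ball_pair_prod[OF this ball_pair_simplex_product[of J]]
  show ?thesis
    by (simp add: c cell_dom_def open_cell_def cell_dim_def sum_list_map_nth case_prod_unfold add.commute)
qed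

lemma open_cell_subset: "open_cell c \<subseteq> topspace (cell_dom c)"
  by (rule ball_pair_subset[OF ball_pair_cell])

text \<open>The entries of each \<open>S\<close> are positive, so the length of \<open>S\<close> is
  at most its sum; the face numbers are strictly increasing, so \<open>T\<close> has at most
  \<open>m\<close> entries.\<close>

lemma finite_cell_indices: "finite (cell_indices n m r)"
proof -
  let ?S = "{S. set S \<subseteq> {..r} \<and> length S \<le> r}"
  let ?T = "{T. set T \<subseteq> {..<m} \<times> ?S \<and> length T \<le> m}"
  let ?J = "{J. set J \<subseteq> {..r} \<and> length J = n}"
  have "finite ?S" by (intro finite_lists_length_le) auto
  then have "finite ?T" by (intro finite_lists_length_le finite_cartesian_product) auto
  moreover have "finite ?J" by (intro finite_lists_length_eq) auto
  ultimately have fin: "finite (?T \<times> ?J)" by (rule finite_cartesian_product)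
  have "cell_indices n m r \<subseteq> ?T \<times> ?J"
  proof
    fix c assume "c \<in> cell_indices n m r"
    then obtain T J where c: "c = (T, J)" and srt: "sorted_wrt (<) (map fst T)"
      and T: "\<And>i S. (i, S) \<in> set T \<Longrightarrow> i < m \<and> (\<forall>s\<in>set S. 0 < s)"
      and J: "length J = n" and r: "sum_list J + (\<Sum>(i, S)\<leftarrow>T. sum_list S) \<le> r"
      unfolding cell_indices_def by blast
    have len: "length S \<le> sum_list S" if "\<forall>s\<in>set S. 0 < s" for S :: "nat list"
      using that by (induction S) auto
    have "i < m \<and> set S \<subseteq> {..r} \<and> length S \<le> r" if "(i, S) \<in> set T" for i S
    proof -
      have "sum_list S \<le> (\<Sum>(i, S)\<leftarrow>T. sum_list S)"
        using that by (intro member_le_sum_list) (force simp: image_iff)+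
      then have S: "sum_list S \<le> r" using r by simp
      have "s \<le> r" if "s \<in> set S" for s using member_le_sum_list[OF that] S by simp
      moreover have "length S \<le> r" using len[of S] T[OF that] S by simp
      ultimately show ?thesis using T[OF that] by auto
    qed
    then have T1: "set T \<subseteq> {..<m} \<times> ?S" by (intro subsetI) (simp add: split_paired_all)
    have T2: "length T \<le> m"
    proof -
      have "distinct (map fst T)" using srt by (simp add: strict_sorted_iff)
      then have "length T = card (fst ` set T)" using distinct_card by fastforce
      also have "\<dots> \<le> card {..<m}" using T by (intro card_mono) auto
      finally show ?thesis by simp
    qed
    have "s \<le> r" if "s \<in> set J" for s using member_le_sum_list[OF that] r by simp
    then have J1: "set J \<subseteq> {..r}" by (simp add: subset_iff)
    show "c \<in> ?T \<times> ?J"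
      unfolding c by (intro SigmaI CollectI conjI T1 T2 J1 J)
  qed
  then show ?thesis using fin by (rule finite_subset)
qed

section \<open>Finite subsets of the open interval and of the open square\<close>

lemma open_simplex_unique:
  assumes u: "u \<in> open_simplex j" "u' \<in> open_simplex j'" and eq: "u ` {..<j} = u' ` {..<j'}"
  shows "j = j' \<and> u = u'"
proof -
  have srt: "sorted_wrt (<) (map u [0..<j])" if "u \<in> open_simplex j" for u j
    using that by (auto simp: sorted_wrt_iff_nth_less open_simplex_def)
  have maps: "map u [0..<j] = map u' [0..<j']"
    using eq by (intro strict_sorted_equal srt u) (auto simp: atLeast0LessThan)
  have j: "j = j'" using arg_cong[OF maps, of length] by simp
  have nth: "u b = u' b" if "b < j" for b
    using arg_cong[OF maps, of "\<lambda>l. l ! b"] that j by simp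
  have "u b = u' b" for b
    using nth[of b] u j by (cases "b < j") (auto simp: open_simplex_def)
  with j show ?thesis by auto
qed

lemma open_simplex_inj: "u \<in> open_simplex j \<Longrightarrow> b < j \<Longrightarrow> c < j \<Longrightarrow> u b = u c \<Longrightarrow> b = c"
  unfolding open_simplex_def by (metis (mono_tags, lifting) mem_Collect_eq less_irrefl nat_neq_iff)

lemma open_simplex_exists:
  assumes "finite A" "A \<subseteq> {0<..<1}"
  obtains u where "u \<in> open_simplex (card A)" "u ` {..<card A} = A"
proof -
  let ?l = "sorted_list_of_set A"
  define u where "u = (\<lambda>b. if b < card A then ?l ! b else 0)"
  have l: "length ?l = card A" "set ?l = A" "sorted_wrt (<) ?l"
    using assms(1) by auto
  have im: "u ` {..<card A} = A"
    using l(1,2) unfolding u_def by (auto simp: set_conv_nth)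
  moreover have "u b \<in> {0<..<1}" if "b < card A" for b using im assms(2) that by blast
  then have "u \<in> open_simplex (card A)"
    using l by (auto simp: open_simplex_def u_def sorted_wrt_iff_nth_less)
  ultimately show ?thesis using that by blast
qed

text \<open>The configuration in the unit square before \<open>kappa\<close> and the characteristic
  map of the face are applied.\<close>

definition grid :: "nat list \<Rightarrow> face_point \<Rightarrow> (real \<times> real) set" where
  "grid S t = {(snd t a, fst t a b) | a b. a < length S \<and> b < S ! a}"

text \<open>The distinct first coordinates, sorted, give the columns, and the fibre over each of
  them is sorted separately. A fibre over a coordinate that occurs is non-empty, so the entries of
  \<open>S\<close> are positive.\<close>

lemma grid_exists:
  assumes "finite P" "P \<subseteq> {0<..<1} \<times> {0<..<1}" "P \<noteq> {}"
  obtains S t where "S \<noteq> []" "\<forall>s\<in>set S. 0 < s"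
    "t \<in> open_simplex_product S \<times> open_simplex (length S)" "grid S t = P"
proof -
  obtain x where x: "x \<in> open_simplex (card (fst ` P))" "x ` {..<card (fst ` P)} = fst ` P"
    using assms by (rule_tac open_simplex_exists[of "fst ` P"]) auto
  let ?l = "card (fst ` P)"
  let ?Y = "\<lambda>a. {y. (x a, y) \<in> P}"
  have "finite (?Y a)" "?Y a \<subseteq> {0<..<1}" for a
    using assms finite_subset[of "?Y a" "snd ` P"] by (force simp: image_iff)+
  then have "\<exists>u. u \<in> open_simplex (card (?Y a)) \<and> u ` {..<card (?Y a)} = ?Y a" for a
    by (metis open_simplex_exists)
  then obtain y where y: "\<And>a. y a \<in> open_simplex (card (?Y a))" "\<And>a. y a ` {..<card (?Y a)} = ?Y a"
    by metis
  define S where "S = map (\<lambda>a. card (?Y a)) [0..<?l]"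
  have S: "length S = ?l" "\<And>a. a < ?l \<Longrightarrow> S ! a = card (?Y a)" by (auto simp: S_def)
  have "?l > 0" using assms by (simp add: card_gt_0_iff)
  then have "S \<noteq> []" using S by auto
  moreover have "\<forall>s\<in>set S. 0 < s"
  proof -
    have "card (?Y a) > 0" if "a < ?l" for a
    proof -
      have "x a \<in> fst ` P" using x(2) that by blast
      then have "?Y a \<noteq> {}" by auto
      then show ?thesis using \<open>finite (?Y a)\<close> by (simp add: card_gt_0_iff)
    qed
    then show ?thesis by (auto simp: S_def)
  qed
  moreover have "(restrict y {..<?l}, x) \<in> open_simplex_product S \<times> open_simplex (length S)"
    using x y S by (auto simp: open_simplex_product_def)
  moreover have "grid S (restrict y {..<?l}, x) = P"
  proof (intro equalityI subsetI)
    fix p assume "p \<in> grid S (restrict y {..<?l}, x)"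
    then obtain a b where "a < ?l" "b < card (?Y a)" "p = (x a, y a b)"
      using S by (auto simp: grid_def)
    then show "p \<in> P" using y(2)[of a] by blast
  next
    fix p assume p: "p \<in> P"
    then have "fst p \<in> x ` {..<?l}" using x(2) by simp
    then obtain a where a: "a < ?l" "fst p = x a" by blast
    then have "snd p \<in> ?Y a" using p by (metis mem_Collect_eq prod.collapse)
    then obtain b where "b < card (?Y a)" "snd p = y a b" using y(2)[of a] by blast
    then show "p \<in> grid S (restrict y {..<?l}, x)"
      using a S unfolding grid_def by (cases p) auto
  qed
  ultimately show ?thesis using that by blast
qed

text \<open>An empty column would leave no trace, and positivity of the entries excludes it; so
  projecting to the first coordinate recovers the columns. As the \<open>x\<close>-coordinates are
  distinct, the fibre over each is exactly one column.\<close>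

lemma grid_unique:
  assumes S: "\<forall>s\<in>set S. 0 < s" "\<forall>s\<in>set S'. 0 < s"
    and t: "t \<in> open_simplex_product S \<times> open_simplex (length S)"
      "t' \<in> open_simplex_product S' \<times> open_simplex (length S')"
    and eq: "grid S t = grid S' t'"
  shows "S = S' \<and> t = t'"
proof -
  have fst_grid: "fst ` grid S t = snd t ` {..<length S}" if "\<forall>s\<in>set S. 0 < s" for S t
    using that by (force simp: grid_def image_iff)
  have "length S = length S' \<and> snd t = snd t'"
    using t eq fst_grid[OF S(1), of t] fst_grid[OF S(2), of t'] by (intro open_simplex_unique) auto
  then have len: "length S' = length S" and x: "snd t' = snd t" by auto
  have fib: "fst t a ` {..<S ! a} = {y. (snd t a, y) \<in> grid S t}"
    if "t \<in> open_simplex_product S \<times> open_simplex (length S)" "a < length S" for S t a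
    using that open_simplex_inj[of "snd t" "length S"] by (auto simp: grid_def) blast
  have mem: "fst t a \<in> open_simplex (S ! a)"
    if "t \<in> open_simplex_product S \<times> open_simplex (length S)" "a < length S" for S t a
  proof -
    have "fst t \<in> (\<Pi>\<^sub>E a\<in>{..<length S}. open_simplex (S ! a))"
      using that(1) by (simp add: open_simplex_product_def mem_Times_iff)
    from PiE_mem[OF this, of a] that(2) show ?thesis by simp
  qed
  have ya: "S ! a = S' ! a \<and> fst t a = fst t' a" if a: "a < length S" for a
  proof (rule open_simplex_unique)
    show "fst t a \<in> open_simplex (S ! a)" by (rule mem[OF t(1) a])
    show "fst t' a \<in> open_simplex (S' ! a)" by (rule mem[OF t(2)]) (simp add: a len)
    show "fst t a ` {..<S ! a} = fst t' a ` {..<S' ! a}"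
    proof -
      have "fst t a ` {..<S ! a} = {y. (snd t a, y) \<in> grid S t}" by (rule fib[OF t(1) a])
      also have "\<dots> = {y. (snd t' a, y) \<in> grid S' t'}" by (simp only: eq x)
      also have "\<dots> = fst t' a ` {..<S' ! a}" by (rule fib[OF t(2), symmetric]) (simp add: a len)
      finally show ?thesis .
    qed
  qed
  have ext: "fst t \<in> extensional {..<length S}"
    if "t \<in> open_simplex_product S \<times> open_simplex (length S)" for S t
    using that by (simp add: open_simplex_product_def mem_Times_iff PiE_iff)
  have "fst t = fst t'"
  proof (rule extensionalityI[of _ "{..<length S}"])
    show "fst t \<in> extensional {..<length S}" "fst t' \<in> extensional {..<length S}"
      using ext[OF t(1)] ext[OF t(2)] unfolding len .
    show "fst t a = fst t' a" if "a \<in> {..<length S}" for a using ya[of a] that by simp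
  qed
  moreover have "S = S'" by (rule nth_equalityI) (simp_all add: len ya)
  ultimately show ?thesis using x by (simp add: prod_eq_iff)
qed

section \<open>Closed and open cells in coordinates\<close>

lemma topspace_cell_dom_iff:
  "(w, z) \<in> topspace (cell_dom (T, J)) \<longleftrightarrow>
     w \<in> extensional {..<length T} \<and>
     (\<forall>q<length T. fst (w q) \<in> extensional {..<length (snd (T ! q))} \<and>
        (\<forall>a<length (snd (T ! q)). fst (w q) a \<in> topspace (simplex_space (snd (T ! q) ! a))) \<and>
        snd (w q) \<in> topspace (simplex_space (length (snd (T ! q))))) \<and>
     z \<in> extensional {..<length J} \<and> (\<forall>i<length J. z i \<in> topspace (simplex_space (J ! i)))"
  by (simp add: cell_dom_def tau_dom_def simplex_product_def PiE_iff mem_Times_iff Ball_def) blast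

lemma open_cell_iff:
  "(w, z) \<in> open_cell (T, J) \<longleftrightarrow>
     w \<in> extensional {..<length T} \<and>
     (\<forall>q<length T. fst (w q) \<in> extensional {..<length (snd (T ! q))} \<and>
        (\<forall>a<length (snd (T ! q)). fst (w q) a \<in> open_simplex (snd (T ! q) ! a)) \<and>
        snd (w q) \<in> open_simplex (length (snd (T ! q)))) \<and>
     z \<in> extensional {..<length J} \<and> (\<forall>i<length J. z i \<in> open_simplex (J ! i))"
  by (simp add: open_cell_def open_simplex_product_def PiE_iff mem_Times_iff Ball_def) blast

lemma simplex_space_unit: "u \<in> topspace (simplex_space j) \<Longrightarrow> b < j \<Longrightarrow> u b \<in> {0..1}"
  by (simp add: topspace_simplex_space)

lemma open_simplex_unit: "u \<in> open_simplex j \<Longrightarrow> b < j \<Longrightarrow> u b \<in> {0<..<1}"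
  by (simp add: open_simplex_def)

lemma open_simplexI:
  assumes "u \<in> topspace (simplex_space j)" "\<And>b. b < j \<Longrightarrow> u b \<noteq> 0" "\<And>b. b < j \<Longrightarrow> u b \<noteq> 1"
    and "\<And>b c. b < c \<Longrightarrow> c < j \<Longrightarrow> u b \<noteq> u c"
  shows "u \<in> open_simplex j"
  using assms unfolding open_simplex_def topspace_simplex_space
  by (auto simp: less_le)

lemma cell_indicesD:
  assumes "(T, J) \<in> cell_indices n m r"
  shows "length J = n"
    and "\<And>q. q < length T \<Longrightarrow> fst (T ! q) < m"
    and "\<And>q. q < length T \<Longrightarrow> snd (T ! q) \<noteq> []"
    and "\<And>q. q < length T \<Longrightarrow> \<forall>s\<in>set (snd (T ! q)). 0 < s"
    and "sorted_wrt (<) (map fst T)"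
    and "\<And>q q'. q < length T \<Longrightarrow> q' < length T \<Longrightarrow> fst (T ! q) = fst (T ! q') \<Longrightarrow> q = q'"
    and "card (gens (T, J)) \<le> r"
proof -
  note c = assms[unfolded cell_indices_def mem_Collect_eq prod.case]
  show "length J = n" "sorted_wrt (<) (map fst T)" using c by auto
  have T: "\<forall>t\<in>set T. fst t < m \<and> snd t \<noteq> [] \<and> (\<forall>s\<in>set (snd t). 0 < s)"
    using c by (auto simp: case_prod_unfold)
  then show "fst (T ! q) < m" "snd (T ! q) \<noteq> []" "\<forall>s\<in>set (snd (T ! q)). 0 < s" if "q < length T" for q
    using that by (auto dest: nth_mem)
  show "q = q'" if "q < length T" "q' < length T" "fst (T ! q) = fst (T ! q')" for q q'
  proof -
    have "distinct (map fst T)" using c by (simp add: strict_sorted_iff)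
    then show ?thesis using that by (metis length_map nth_eq_iff_index_eq nth_map)
  qed
  show "card (gens (T, J)) \<le> r" unfolding card_gens using c by simp
qed

lemma InlI_gens: "i < length J \<Longrightarrow> b < J ! i \<Longrightarrow> Inl (i, b) \<in> gens (T, J)"
  by (auto simp: gens_def)

lemma InrI_gens:
  "q < length T \<Longrightarrow> a < length (snd (T ! q)) \<Longrightarrow> b < snd (T ! q) ! a \<Longrightarrow> Inr (q, a, b) \<in> gens (T, J)"
  by (auto simp: gens_def)

lemma gensE:
  assumes "g \<in> gens (T, J)"
  obtains (Inl) i b where "g = Inl (i, b)" "i < length J" "b < J ! i"
  | (Inr) q a b where "g = Inr (q, a, b)" "q < length T" "a < length (snd (T ! q))" "b < snd (T ! q) ! a"
  using assms by (auto simp: gens_def)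

lemma gen_point_simps:
  "gen_point e \<phi> (T, J) (w, z) (Inl (i, b)) = e i (z i b)"
  "gen_point e \<phi> (T, J) (w, z) (Inr (q, a, b)) = \<phi> (fst (T ! q)) (kappa (snd (w q) a, fst (w q) a b))"
  by (simp_all add: gen_point_def)

subsection \<open>Traces of a finite set on the open cells of the complex\<close>

context one_vertex_complex
begin

text \<open>The side \<open>x = 1\<close> runs along the unit circle, which is attached to the
  1-skeleton; the other three sides collapse to \<open>-1\<close> and hence go to
  \<open>v\<close>.\<close>

lemma square_cases:
  assumes i: "i < m" and x: "x \<in> {0..1}" and y: "y \<in> {0..1}"
  shows "x \<in> {0<..<1} \<and> y \<in> {0<..<1} \<or> \<phi> i (kappa (x, y)) = v \<or>
    (\<exists>j<n. \<exists>s\<in>{0<..<1}. \<phi> i (kappa (x, y)) = e j s)"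
proof -
  consider "x \<in> {0<..<1} \<and> y \<in> {0<..<1}" | "x = 1" | "x = 0 \<or> y = 0 \<or> y = 1"
    using x y by force
  then show ?thesis
  proof cases
    case 2
    then show ?thesis using disc_boundary[OF i kappa_1_in_sphere, of y] by blast
  next
    case 3
    then have "kappa (x, y) = -1" using kappa_sides by auto
    then show ?thesis using disc_base[OF i] by simp
  qed blast
qed

lemma square_interior: "x \<in> {0<..<1} \<Longrightarrow> y \<in> {0<..<1} \<Longrightarrow> kappa (x, y) \<in> ball 0 1"
  using kappa_in_ball[of x y] unfolding greaterThanLessThan_iff by blast

text \<open>Interiority is asked of only one point. The other is then interior as well, since its
  value would otherwise lie in the 1-skeleton. This asymmetry suits closed cells, whose coordinates
  may lie on the sides.\<close>

lemma square_inject: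
  assumes i: "i < m" "j < m" and x: "x \<in> {0..1}" "y \<in> {0..1}" and x': "x' \<in> {0<..<1}" "y' \<in> {0<..<1}"
    and eq: "\<phi> i (kappa (x, y)) = \<phi> j (kappa (x', y'))"
  shows "i = j \<and> x = x' \<and> y = y'"
proof -
  note b' = square_interior[OF x']
  have int: "x \<in> {0<..<1}" "y \<in> {0<..<1}"
    using square_cases[OF i(1) x] unfolding eq
    using disc_vertex[OF i(2) b'] edge_disc[OF _ i(2) _ b'] by metis+
  have "i = j \<and> kappa (x, y) = kappa (x', y')"
    by (rule disc_inject[OF i square_interior[OF int] b' eq])
  then show ?thesis using kappa_inject[of x x' y y'] int x' by simp
qed

lemma edge_neq_square:
  assumes "i < n" "j < m" "s \<in> {0..1}" "x \<in> {0<..<1}" "y \<in> {0<..<1}"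
  shows "e i s \<noteq> \<phi> j (kappa (x, y))"
proof (cases "s \<in> {0<..<1}")
  case True
  then show ?thesis using edge_disc[OF assms(1,2) _ square_interior[OF assms(4,5)]] by blast
next
  case False
  then have "s = 0 \<or> s = 1" using assms(3) by auto
  then have "e i s = v" using edge_ends[OF assms(1)] by blast
  then show ?thesis using disc_vertex[OF assms(2) square_interior[OF assms(4,5)]] by simp
qed

definition edge_trace :: "'a set \<Rightarrow> nat \<Rightarrow> real set" where
  "edge_trace \<Lambda> i = {s \<in> {0<..<1}. e i s \<in> \<Lambda>}"

definition face_trace :: "'a set \<Rightarrow> nat \<Rightarrow> (real \<times> real) set" where
  "face_trace \<Lambda> i = {(x, y). x \<in> {0<..<1} \<and> y \<in> {0<..<1} \<and> \<phi> i (kappa (x, y)) \<in> \<Lambda>}"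

definition columns :: "'a set \<Rightarrow> (nat \<times> real) set" where
  "columns \<Lambda> = {(i, x). i < m \<and> x \<in> fst ` face_trace \<Lambda> i}"

text \<open>The dimension of the open cell containing \<open>\<Lambda>\<close>.\<close>

definition complexity :: "'a set \<Rightarrow> nat" where
  "complexity \<Lambda> = card (\<Lambda> - {v}) + card (columns \<Lambda>)"

abbreviation points :: "cell_index \<Rightarrow> cell_point \<Rightarrow> 'a set" where
  "points c p \<equiv> gen_point e \<phi> c p ` gens c"

text \<open>On a closed cell only this inclusion can be expected, because grid points on a side of
  the square leave the open face. It suffices to bound the number of visible columns.\<close>

lemma face_trace_points_subset:
  assumes c: "(T, J) \<in> cell_indices n m r" and p: "(w, z) \<in> topspace (cell_dom (T, J))"
    and i: "i < m" and xy: "(x, y) \<in> face_trace (insert v (points (T, J) (w, z))) i"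
  obtains q where "q < length T" "i = fst (T ! q)" "(x, y) \<in> grid (snd (T ! q)) (w q)"
proof -
  note p = p[unfolded topspace_cell_dom_iff] and cD = cell_indicesD[OF c]
  have xy: "x \<in> {0<..<1}" "y \<in> {0<..<1}" "\<phi> i (kappa (x, y)) \<in> insert v (points (T, J) (w, z))"
    using xy by (auto simp: face_trace_def)
  have "\<phi> i (kappa (x, y)) \<noteq> v" using disc_vertex[OF i square_interior[OF xy(1,2)]] .
  then obtain g where g: "g \<in> gens (T, J)" "\<phi> i (kappa (x, y)) = gen_point e \<phi> (T, J) (w, z) g"
    using xy(3) by blast
  from g(1) show ?thesis
  proof (cases rule: gensE)
    case (Inl j b)
    then have "z j b \<in> {0..1}" using p simplex_space_unit by blast
    then have "e j (z j b) \<noteq> \<phi> i (kappa (x, y))"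
      using edge_neq_square[OF _ i _ xy(1,2)] Inl(2) cD(1) by blast
    then show ?thesis using g(2) Inl(1) gen_point_simps by metis
  next
    case (Inr q a b)
    then have "snd (w q) a \<in> {0..1}" "fst (w q) a b \<in> {0..1}" using p simplex_space_unit by blast+
    moreover have "\<phi> (fst (T ! q)) (kappa (snd (w q) a, fst (w q) a b)) = \<phi> i (kappa (x, y))"
      using g(2) unfolding Inr(1) gen_point_simps by (rule sym)
    ultimately have "fst (T ! q) = i \<and> snd (w q) a = x \<and> fst (w q) a b = y"
      using square_inject[OF cD(2)[OF Inr(2)] i _ _ xy(1,2)] by blast
    then show ?thesis using that[OF Inr(2)] Inr(3,4) by (auto simp: grid_def)
  qed
qed

text \<open>Here the cell must be open: a square coordinate \<open>x = 1\<close> could place further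
  points on an edge.\<close>

lemma edge_trace_points:
  assumes c: "(T, J) \<in> cell_indices n m r" and p: "(w, z) \<in> open_cell (T, J)" and i: "i < n"
  shows "edge_trace (insert v (points (T, J) (w, z))) i = z i ` {..<J ! i}"
proof (intro equalityI subsetI)
  note p = p[unfolded open_cell_iff] and cD = cell_indicesD[OF c]
  fix s assume "s \<in> edge_trace (insert v (points (T, J) (w, z))) i"
  then have s: "s \<in> {0<..<1}" "e i s \<in> insert v (points (T, J) (w, z))" by (auto simp: edge_trace_def)
  then obtain g where g: "g \<in> gens (T, J)" "e i s = gen_point e \<phi> (T, J) (w, z) g"
    using edge_vertex[OF i s(1)] by blast
  from g(1) show "s \<in> z i ` {..<J ! i}"
  proof (cases rule: gensE)
    case (Inl j b)
    then have "z j b \<in> {0<..<1}" using p open_simplex_unit by blast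
    moreover have "e i s = e j (z j b)" using g(2) unfolding Inl(1) gen_point_simps .
    ultimately have "i = j \<and> s = z j b" using edge_inject[OF i _ s(1)] Inl(2) cD(1) by blast
    then show ?thesis using Inl(3) by blast
  next
    case (Inr q a b)
    then have "snd (w q) a \<in> {0<..<1}" "fst (w q) a b \<in> {0<..<1}" using p open_simplex_unit by blast+
    then have "kappa (snd (w q) a, fst (w q) a b) \<in> ball 0 1" by (rule square_interior)
    then show ?thesis
      using edge_disc[OF i cD(2)[OF Inr(2)] s(1)] g(2) unfolding Inr(1) gen_point_simps by blast
  qed
next
  note p = p[unfolded open_cell_iff] and cD = cell_indicesD[OF c]
  fix s assume "s \<in> z i ` {..<J ! i}"
  then obtain b where b: "b < J ! i" "s = z i b" by blast
  then have "s \<in> {0<..<1}" using p i cD(1) open_simplex_unit by blast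
  moreover have "e i s \<in> points (T, J) (w, z)"
    unfolding b(2) gen_point_simps(1)[where \<phi> = \<phi> and T = T and J = J and w = w, symmetric] using i b(1) cD(1)
    by (intro imageI InlI_gens) auto
  ultimately show "s \<in> edge_trace (insert v (points (T, J) (w, z))) i" by (simp add: edge_trace_def)
qed

lemma face_trace_points:
  assumes c: "(T, J) \<in> cell_indices n m r" and p: "(w, z) \<in> open_cell (T, J)" and q: "q < length T"
  shows "face_trace (insert v (points (T, J) (w, z))) (fst (T ! q)) = grid (snd (T ! q)) (w q)"
proof (intro equalityI subsetI)
  note cD = cell_indicesD[OF c]
  fix t assume t: "t \<in> face_trace (insert v (points (T, J) (w, z))) (fst (T ! q))"
  obtain x y where xy: "t = (x, y)" by (cases t)
  from face_trace_points_subset[OF c subsetD[OF open_cell_subset p] cD(2)[OF q] t[unfolded xy]]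
  obtain q' where "q' < length T" "fst (T ! q) = fst (T ! q')" "(x, y) \<in> grid (snd (T ! q')) (w q')"
    by blast
  then show "t \<in> grid (snd (T ! q)) (w q)" using cD(6)[OF q] xy by metis
next
  note p = p[unfolded open_cell_iff] and cD = cell_indicesD[OF c]
  fix t assume "t \<in> grid (snd (T ! q)) (w q)"
  then obtain a b where ab: "a < length (snd (T ! q))" "b < snd (T ! q) ! a"
    and t: "t = (snd (w q) a, fst (w q) a b)" unfolding grid_def by blast
  have "snd (w q) a \<in> {0<..<1}" "fst (w q) a b \<in> {0<..<1}" using p q ab open_simplex_unit by blast+
  moreover have "\<phi> (fst (T ! q)) (kappa (snd (w q) a, fst (w q) a b)) \<in> points (T, J) (w, z)"
    unfolding gen_point_simps(2)[where e = e and J = J and z = z, symmetric]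
    using q ab by (intro imageI InrI_gens)
  ultimately show "t \<in> face_trace (insert v (points (T, J) (w, z))) (fst (T ! q))"
    unfolding t face_trace_def by simp
qed

lemma face_trace_points_empty:
  assumes c: "(T, J) \<in> cell_indices n m r" and p: "(w, z) \<in> open_cell (T, J)" and i: "i < m"
    and "i \<notin> fst ` set T"
  shows "face_trace (insert v (points (T, J) (w, z))) i = {}"
proof -
  have "t \<notin> face_trace (insert v (points (T, J) (w, z))) i" for t
  proof
    assume t: "t \<in> face_trace (insert v (points (T, J) (w, z))) i"
    obtain x y where xy: "t = (x, y)" by (cases t)
    from face_trace_points_subset[OF c subsetD[OF open_cell_subset p] i t[unfolded xy]]
    obtain q where "q < length T" "i = fst (T ! q)" by blast
    then show False using assms(4) by auto
  qed
  then show ?thesis by blast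
qed

lemma columns_points_subset:
  assumes c: "(T, J) \<in> cell_indices n m r" and p: "(w, z) \<in> topspace (cell_dom (T, J))"
  shows "columns (insert v (points (T, J) (w, z))) \<subseteq> col_point (T, J) (w, z) ` cols (T, J)"
proof
  fix t assume t: "t \<in> columns (insert v (points (T, J) (w, z)))"
  then obtain i x y where ix: "t = (i, x)" and i: "i < m"
    and xy: "(x, y) \<in> face_trace (insert v (points (T, J) (w, z))) i"
    by (auto simp: columns_def)
  from face_trace_points_subset[OF c p i xy]
  obtain q where q: "q < length T" "i = fst (T ! q)" "(x, y) \<in> grid (snd (T ! q)) (w q)" .
  then obtain a where a: "a < length (snd (T ! q))" "x = snd (w q) a" by (auto simp: grid_def)
  have "t = col_point (T, J) (w, z) (q, a)" using ix q(2) a(2) by (simp add: col_point_def)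
  moreover have "(q, a) \<in> cols (T, J)" using q(1) a(1) by (simp add: cols_def)
  ultimately show "t \<in> col_point (T, J) (w, z) ` cols (T, J)" by (rule image_eqI)
qed

text \<open>In the interior nothing collapses. Distinct generators give distinct points, none of
  them \<open>v\<close>, and distinct columns stay distinct and visible, so both parts of the count
  attain their maximum.\<close>

lemma points_open_cell:
  assumes c: "(T, J) \<in> cell_indices n m r" and p: "(w, z) \<in> open_cell (T, J)"
  shows "v \<notin> points (T, J) (w, z)" and "card (points (T, J) (w, z)) = card (gens (T, J))"
    and "complexity (insert v (points (T, J) (w, z))) = cell_dim (T, J)"
proof -
  note op = p and p = p[unfolded open_cell_iff] and cD = cell_indicesD[OF c]
  let ?g = "gen_point e \<phi> (T, J) (w, z)"
  have sq: "snd (w q) a \<in> {0<..<1}" "fst (w q) a b \<in> {0<..<1}"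
    if "q < length T" "a < length (snd (T ! q))" "b < snd (T ! q) ! a" for q a b
    using p that open_simplex_unit by blast+
  have ed: "z i b \<in> {0<..<1}" if "i < length J" "b < J ! i" for i b
    using p that open_simplex_unit by blast
  have "?g g \<noteq> v" if "g \<in> gens (T, J)" for g
    using that
  proof (cases rule: gensE)
    case (Inl i b)
    then show ?thesis using edge_vertex[OF _ ed] cD(1) unfolding Inl(1) gen_point_simps by blast
  next
    case (Inr q a b)
    then show ?thesis using disc_vertex[OF cD(2) square_interior[OF sq]] unfolding Inr(1) gen_point_simps
      by blast
  qed
  then show nv: "v \<notin> points (T, J) (w, z)" by (auto simp del: gen_point_simps)
  have "inj_on ?g (gens (T, J))"
  proof (rule inj_onI)
    fix g g' assume g: "g \<in> gens (T, J)" and g': "g' \<in> gens (T, J)" and eq: "?g g = ?g g'"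
    from g show "g = g'"
    proof (cases rule: gensE)
      case 1: (Inl i b)
      from g' show ?thesis
      proof (cases rule: gensE)
        case 2: (Inl j d)
        have "i = j \<and> z i b = z j d"
          using edge_inject[OF _ _ ed[OF 1(2,3)] ed[OF 2(2,3)]] eq 1 2 cD(1) by (simp add: gen_point_simps)
        moreover from this have "b = d"
          using open_simplex_inj[of "z i" "J ! i"] p 1 2 by blast
        ultimately show ?thesis using 1 2 by simp
      next
        case 2: (Inr q a d)
        have "e i (z i b) \<noteq> \<phi> (fst (T ! q)) (kappa (snd (w q) a, fst (w q) a d))"
          using edge_disc[OF _ cD(2)[OF 2(2)] ed[OF 1(2,3)] square_interior[OF sq[OF 2(2-4)]]] 1(2) cD(1)
          by blast
        then show ?thesis using eq unfolding 1(1) 2(1) gen_point_simps by blast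
      qed
    next
      case 1: (Inr q a b)
      from g' show ?thesis
      proof (cases rule: gensE)
        case 2: (Inl i d)
        have "e i (z i d) \<noteq> \<phi> (fst (T ! q)) (kappa (snd (w q) a, fst (w q) a b))"
          using edge_disc[OF _ cD(2)[OF 1(2)] ed[OF 2(2,3)] square_interior[OF sq[OF 1(2-4)]]] 2(2) cD(1)
          by blast
        then show ?thesis using eq unfolding 1(1) 2(1) gen_point_simps by metis
      next
        case 2: (Inr q' a' b')
        have "snd (w q) a \<in> {0..1}" "fst (w q) a b \<in> {0..1}" using sq[OF 1(2-4)] by auto
        from square_inject[OF cD(2)[OF 1(2)] cD(2)[OF 2(2)] this sq[OF 2(2-4)]] eq
        have eqs: "fst (T ! q) = fst (T ! q')" "snd (w q) a = snd (w q') a'" "fst (w q) a b = fst (w q') a' b'"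
          unfolding 1(1) 2(1) gen_point_simps by blast+
        have q: "q' = q" using cD(6)[OF 1(2) 2(2) eqs(1)] by simp
        have a: "a' = a"
          using open_simplex_inj[of "snd (w q)" "length (snd (T ! q))" a a'] p 1 2 eqs(2) unfolding q by metis
        have "b = b'"
          using open_simplex_inj[of "fst (w q) a" "snd (T ! q) ! a" b b'] p 1 2 eqs(3) unfolding q a by blast
        then show ?thesis using 1(1) 2(1) q a by simp
      qed
    qed
  qed
  then show cg: "card (points (T, J) (w, z)) = card (gens (T, J))" by (rule card_image)
  have "columns (insert v (points (T, J) (w, z))) = col_point (T, J) (w, z) ` cols (T, J)"
  proof (rule equalityI[OF columns_points_subset[OF c subsetD[OF open_cell_subset op]]], rule subsetI)
    fix t assume "t \<in> col_point (T, J) (w, z) ` cols (T, J)"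
    then obtain q a where qa: "q < length T" "a < length (snd (T ! q))" and t: "t = (fst (T ! q), snd (w q) a)"
      by (auto simp: cols_def col_point_def)
    \<comment> \<open>A column is visible only through its points; it is non-empty, so its point
      with index 0 can serve.\<close>
    have "snd (T ! q) ! a > 0" using cD(4)[OF qa(1)] qa(2) by simp
    then have "(snd (w q) a, fst (w q) a 0) \<in> grid (snd (T ! q)) (w q)" using qa(2) by (auto simp: grid_def)
    then have "(snd (w q) a, fst (w q) a 0) \<in> face_trace (insert v (points (T, J) (w, z))) (fst (T ! q))"
      by (simp only: face_trace_points[OF c op qa(1)])
    from imageI[OF this, of fst] show "t \<in> columns (insert v (points (T, J) (w, z)))"
      unfolding t columns_def using cD(2)[OF qa(1)] by simp
  qed
  moreover have "inj_on (col_point (T, J) (w, z)) (cols (T, J))"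
  proof (rule inj_onI, clarsimp simp: cols_def col_point_def)
    fix q a q' a' assume qa: "q < length T" "a < length (snd (T ! q))" "q' < length T" "a' < length (snd (T ! q'))"
      and eq: "fst (T ! q) = fst (T ! q')" "snd (w q) a = snd (w q') a'"
    have q: "q' = q" using cD(6)[OF qa(1,3) eq(1)] by simp
    then show "q = q' \<and> a = a'"
      using open_simplex_inj[of "snd (w q)" "length (snd (T ! q))" a a'] p qa eq(2) by simp
  qed
  ultimately have "card (columns (insert v (points (T, J) (w, z)))) = card (cols (T, J))"
    by (simp add: card_image)
  moreover have "insert v (points (T, J) (w, z)) - {v} = points (T, J) (w, z)" using nv by blast
  ultimately show "complexity (insert v (points (T, J) (w, z))) = cell_dim (T, J)"
    unfolding complexity_def cell_dim_eq cg[symmetric] by simp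
qed

text \<open>Every way of reaching the boundary of the domain costs at least one unit. An edge or
  \<open>y\<close>-coordinate equal to 0 or 1 produces \<open>v\<close>, two equal ones in the same
  simplex identify two points, and an \<open>x\<close>-coordinate that is 0, 1 or repeated loses a
  column.\<close>

lemma complexity_boundary:
  assumes c: "(T, J) \<in> cell_indices n m r" and p: "(w, z) \<in> topspace (cell_dom (T, J))"
    and "(w, z) \<notin> open_cell (T, J)"
  shows "complexity (insert v (points (T, J) (w, z))) < cell_dim (T, J)"
proof (rule ccontr)
  assume ge: "\<not> ?thesis"
  let ?g = "gen_point e \<phi> (T, J) (w, z)" and ?k = "col_point (T, J) (w, z)"
  let ?L = "insert v (points (T, J) (w, z))"
  note cp = p and p = p[unfolded topspace_cell_dom_iff] and cD = cell_indicesD[OF c]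
  have L: "?L - {v} = points (T, J) (w, z) - {v}" by blast
  have sub: "columns ?L \<subseteq> ?k ` cols (T, J)" by (rule columns_points_subset[OF c cp])
  have fp: "finite (points (T, J) (w, z))" "finite (?k ` cols (T, J))"
    using finite_gens finite_cols by blast+
  \<comment> \<open>If the count does not drop, all four inequalities are equalities. In this order
    they say that no generator gives \<open>v\<close>, that the generators give distinct points,
    that every column is visible, and that the columns are distinct.\<close>
  have 1: "card (points (T, J) (w, z) - {v}) \<le> card (points (T, J) (w, z))"
    using fp(1) by (intro card_mono) auto
  have 2: "card (points (T, J) (w, z)) \<le> card (gens (T, J))" by (rule card_image_le[OF finite_gens])
  have 3: "card (columns ?L) \<le> card (?k ` cols (T, J))" by (rule card_mono[OF fp(2) sub])
  have 4: "card (?k ` cols (T, J)) \<le> card (cols (T, J))" by (rule card_image_le[OF finite_cols])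
  have ge: "card (gens (T, J)) + card (cols (T, J)) \<le> card (points (T, J) (w, z) - {v}) + card (columns ?L)"
    using ge unfolding complexity_def cell_dim_eq L by simp
  have nv: "v \<notin> points (T, J) (w, z)"
    using card_Diff1_less[OF fp(1), of v] ge 1 2 3 4 by linarith
  have "card (points (T, J) (w, z)) = card (gens (T, J))" using ge 1 2 3 4 by linarith
  then have inj: "inj_on ?g (gens (T, J))" by (rule eq_card_imp_inj_on[OF finite_gens])
  have "card (columns ?L) = card (?k ` cols (T, J))" using ge 1 2 3 4 by linarith
  then have cols: "columns ?L = ?k ` cols (T, J)" by (rule card_subset_eq[OF fp(2) sub])
  have "card (?k ` cols (T, J)) = card (cols (T, J))" using ge 1 2 3 4 by linarith
  then have injk: "inj_on ?k (cols (T, J))" by (rule eq_card_imp_inj_on[OF finite_cols])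
  have zi: "z i \<in> open_simplex (J ! i)" if i: "i < length J" for i
  proof (rule open_simplexI)
    show "z i \<in> topspace (simplex_space (J ! i))" using p i by blast
    have "e i (z i b) \<noteq> v" if "b < J ! i" for b
      using imageI[OF InlI_gens[OF i that, where T = T], of ?g] nv unfolding gen_point_simps by metis
    then show "z i b \<noteq> 0" "z i b \<noteq> 1" if "b < J ! i" for b
      using that edge_ends[of i] i cD(1) by metis+
    show "z i b \<noteq> z i d" if "b < d" "d < J ! i" for b d
    proof
      assume "z i b = z i d"
      then have "?g (Inl (i, b)) = ?g (Inl (i, d))" by (simp add: gen_point_simps)
      from inj_onD[OF inj this InlI_gens[OF i] InlI_gens[OF i]] that show False by simp
    qed
  qed
  \<comment> \<open>At \<open>x = 1\<close> the points may survive in the interior of an edge, so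
    counting points does not exclude this value. Visibility of the column does, because the trace
    sees only the open square.\<close>
  have xq: "snd (w q) a \<in> {0<..<1}" if q: "q < length T" and a: "a < length (snd (T ! q))" for q a
  proof -
    have "?k (q, a) \<in> columns ?L" unfolding cols using q a by (intro imageI) (simp add: cols_def)
    then show ?thesis by (auto simp: columns_def col_point_def face_trace_def)
  qed
  have xs: "snd (w q) \<in> open_simplex (length (snd (T ! q)))" if q: "q < length T" for q
  proof (rule open_simplexI)
    show "snd (w q) \<in> topspace (simplex_space (length (snd (T ! q))))" using p q by blast
    show "snd (w q) a \<noteq> 0" "snd (w q) a \<noteq> 1" if "a < length (snd (T ! q))" for a
      using xq[OF q that] by auto
    show "snd (w q) a \<noteq> snd (w q) d" if ad: "a < d" "d < length (snd (T ! q))" for a d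
    proof
      assume "snd (w q) a = snd (w q) d"
      then have "?k (q, a) = ?k (q, d)" by (simp add: col_point_def)
      moreover have "(q, a) \<in> cols (T, J)" "(q, d) \<in> cols (T, J)" using q ad by (simp_all add: cols_def)
      ultimately have "(q, a) = (q, d)" by (rule inj_onD[OF injk])
      with ad show False by simp
    qed
  qed
  have ys: "fst (w q) a \<in> open_simplex (snd (T ! q) ! a)" if q: "q < length T" and a: "a < length (snd (T ! q))" for q a
  proof (rule open_simplexI)
    show "fst (w q) a \<in> topspace (simplex_space (snd (T ! q) ! a))" using p q a by blast
    have "\<phi> (fst (T ! q)) (kappa (snd (w q) a, fst (w q) a b)) \<noteq> v" if "b < snd (T ! q) ! a" for b
      using imageI[OF InrI_gens[OF q a that, where J = J], of ?g] nv unfolding gen_point_simps by metis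
    then show "fst (w q) a b \<noteq> 0" "fst (w q) a b \<noteq> 1" if "b < snd (T ! q) ! a" for b
      using that kappa_sides(2,3) disc_base[OF cD(2)[OF q]] by metis+
    show "fst (w q) a b \<noteq> fst (w q) a d" if "b < d" "d < snd (T ! q) ! a" for b d
    proof
      assume "fst (w q) a b = fst (w q) a d"
      then have "?g (Inr (q, a, b)) = ?g (Inr (q, a, d))" by (simp add: gen_point_simps)
      from inj_onD[OF inj this InrI_gens[OF q a] InrI_gens[OF q a]] that show False by simp
    qed
  qed
  have "(w, z) \<in> open_cell (T, J)"
    unfolding open_cell_iff using p zi xs ys by blast
  with assms(3) show False by blast
qed

text \<open>The set determines everything through its traces: edge traces give \<open>J\<close> and
  \<open>z\<close>, the faces with non-empty trace give the face numbers in \<open>T\<close>, and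
  the face traces are the grids. Comparing the sets after inserting \<open>v\<close> lets one
  statement serve both families.\<close>

lemma open_cell_unique:
  assumes c: "(T, J) \<in> cell_indices n m r" and p: "(w, z) \<in> open_cell (T, J)"
    and c': "(T', J') \<in> cell_indices n m r'" and p': "(w', z') \<in> open_cell (T', J')"
    and eq: "insert v (points (T, J) (w, z)) = insert v (points (T', J') (w', z'))"
  shows "T = T' \<and> J = J' \<and> w = w' \<and> z = z'"
proof -
  note cD = cell_indicesD[OF c] and cD' = cell_indicesD[OF c']
  note pD = p[unfolded open_cell_iff] and pD' = p'[unfolded open_cell_iff]
  have zi: "J ! i = J' ! i \<and> z i = z' i" if i: "i < n" for i
  proof (rule open_simplex_unique)
    show "z i \<in> open_simplex (J ! i)" using pD i cD(1) by simp
    show "z' i \<in> open_simplex (J' ! i)" using pD' i cD'(1) by simp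
    show "z i ` {..<J ! i} = z' i ` {..<J' ! i}"
      using edge_trace_points[OF c p i] edge_trace_points[OF c' p' i] unfolding eq by (rule trans[OF sym])
  qed
  have J: "J = J'" by (rule nth_equalityI) (use zi cD(1) cD'(1) in auto)
  have z: "z = z'"
  proof (rule extensionalityI[of _ "{..<n}"])
    show "z \<in> extensional {..<n}" using pD cD(1) by simp
    show "z' \<in> extensional {..<n}" using pD' cD'(1) by simp
    show "z i = z' i" if "i \<in> {..<n}" for i using zi that by blast
  qed
  \<comment> \<open>Every listed face has at least one non-empty column, so the listed faces are
    exactly those met by the set.\<close>
  have faces: "fst ` set T = {i. i < m \<and> face_trace (insert v (points (T, J) (w, z))) i \<noteq> {}}"
    if c: "(T, J) \<in> cell_indices n m r" and p: "(w, z) \<in> open_cell (T, J)" for T J w z r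
  proof (intro equalityI subsetI)
    note cD = cell_indicesD[OF c]
    fix i assume "i \<in> fst ` set T"
    then obtain q where q: "q < length T" "i = fst (T ! q)" by (metis imageE in_set_conv_nth)
    have "0 < length (snd (T ! q))" "0 < snd (T ! q) ! 0" using cD(3,4)[OF q(1)] by auto
    then have "grid (snd (T ! q)) (w q) \<noteq> {}" unfolding grid_def by blast
    then show "i \<in> {i. i < m \<and> face_trace (insert v (points (T, J) (w, z))) i \<noteq> {}}"
      using face_trace_points[OF c p q(1)] cD(2)[OF q(1)] q(2) by simp
  next
    fix i assume "i \<in> {i. i < m \<and> face_trace (insert v (points (T, J) (w, z))) i \<noteq> {}}"
    then show "i \<in> fst ` set T" using face_trace_points_empty[OF c p] by blast
  qed
  have "map fst T = map fst T'"
  proof (rule strict_sorted_equal[OF cD'(5) cD(5)])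
    show "set (map fst T) = set (map fst T')"
      unfolding set_map faces[OF c p] faces[OF c' p'] eq ..
  qed
  then have len: "length T' = length T" by (metis length_map)
  have fstT: "fst (T' ! q) = fst (T ! q)" if "q < length T" for q
    using \<open>map fst T = map fst T'\<close> that len by (metis nth_map)
  have wq: "snd (T ! q) = snd (T' ! q) \<and> w q = w' q" if q: "q < length T" for q
  proof (rule grid_unique)
    have q': "q < length T'" using q len by simp
    show "\<forall>s\<in>set (snd (T ! q)). 0 < s" by (rule cD(4)[OF q])
    show "\<forall>s\<in>set (snd (T' ! q)). 0 < s" by (rule cD'(4)[OF q'])
    show "w q \<in> open_simplex_product (snd (T ! q)) \<times> open_simplex (length (snd (T ! q)))"
      using pD q by (simp add: open_simplex_product_def mem_Times_iff PiE_iff)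
    show "w' q \<in> open_simplex_product (snd (T' ! q)) \<times> open_simplex (length (snd (T' ! q)))"
      using pD' q' by (simp add: open_simplex_product_def mem_Times_iff PiE_iff)
    show "grid (snd (T ! q)) (w q) = grid (snd (T' ! q)) (w' q)"
      using face_trace_points[OF c p q] face_trace_points[OF c' p' q'] unfolding eq fstT[OF q]
      by (rule trans[OF sym])
  qed
  have T: "T = T'" by (rule nth_equalityI) (simp_all add: len prod_eq_iff fstT wq)
  have w: "w = w'"
  proof (rule extensionalityI[of _ "{..<length T}"])
    show "w \<in> extensional {..<length T}" using pD by simp
    show "w' \<in> extensional {..<length T}" using pD' len by simp
    show "w q = w' q" if "q \<in> {..<length T}" for q using wq that by blast
  qed
  show ?thesis using T J w z by blast
qed

lemma open_cell_exists:
  assumes L: "\<Lambda> \<subseteq> topspace X" "finite \<Lambda>" "v \<in> \<Lambda>"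
  obtains T J w z where "(T, J) \<in> cell_indices n m (card \<Lambda> - 1)" "(w, z) \<in> open_cell (T, J)"
    "\<Lambda> = insert v (points (T, J) (w, z))"
proof -
  have et: "finite (edge_trace \<Lambda> i)" "edge_trace \<Lambda> i \<subseteq> {0<..<1}" if "i < n" for i
  proof -
    have "inj_on (e i) (edge_trace \<Lambda> i)"
      using edge_inject[OF that that] by (intro inj_onI) (simp add: edge_trace_def)
    moreover have "e i ` edge_trace \<Lambda> i \<subseteq> \<Lambda>" by (auto simp: edge_trace_def)
    ultimately show "finite (edge_trace \<Lambda> i)" using L(2) by (metis inj_on_finite)
    show "edge_trace \<Lambda> i \<subseteq> {0<..<1}" unfolding edge_trace_def by blast
  qed
  have ft: "finite (face_trace \<Lambda> i)" "face_trace \<Lambda> i \<subseteq> {0<..<1} \<times> {0<..<1}" if "i < m" for i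
  proof -
    have "inj_on (\<lambda>t. \<phi> i (kappa t)) (face_trace \<Lambda> i)"
    proof (rule inj_onI)
      fix t t' assume t: "t \<in> face_trace \<Lambda> i" "t' \<in> face_trace \<Lambda> i" and eq: "\<phi> i (kappa t) = \<phi> i (kappa t')"
      obtain x y x' y' where xy: "t = (x, y)" "t' = (x', y')" by (metis surj_pair)
      have "x \<in> {0..1}" "y \<in> {0..1}" "x' \<in> {0<..<1}" "y' \<in> {0<..<1}"
        using t by (auto simp: face_trace_def xy)
      from square_inject[OF that that this] eq show "t = t'" by (simp add: xy)
    qed
    moreover have "(\<lambda>t. \<phi> i (kappa t)) ` face_trace \<Lambda> i \<subseteq> \<Lambda>" by (auto simp: face_trace_def)
    ultimately show "finite (face_trace \<Lambda> i)" using L(2) by (metis inj_on_finite)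
    show "face_trace \<Lambda> i \<subseteq> {0<..<1} \<times> {0<..<1}" unfolding face_trace_def by blast
  qed
  have "\<exists>u. u \<in> open_simplex (card (edge_trace \<Lambda> i)) \<and> u ` {..<card (edge_trace \<Lambda> i)} = edge_trace \<Lambda> i"
    if "i < n" for i
    using open_simplex_exists[OF et[OF that]] by metis
  then obtain u where u: "\<And>i. i < n \<Longrightarrow> u i \<in> open_simplex (card (edge_trace \<Lambda> i))"
    "\<And>i. i < n \<Longrightarrow> u i ` {..<card (edge_trace \<Lambda> i)} = edge_trace \<Lambda> i" by metis
  have "\<exists>S t. S \<noteq> [] \<and> (\<forall>s\<in>set S. 0 < s) \<and> t \<in> open_simplex_product S \<times> open_simplex (length S) \<and>
      grid S t = face_trace \<Lambda> i" if "i < m" "face_trace \<Lambda> i \<noteq> {}" for i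
    using grid_exists[OF ft[OF that(1)] that(2)] by metis
  then obtain S t where S: "\<And>i. i < m \<Longrightarrow> face_trace \<Lambda> i \<noteq> {} \<Longrightarrow>
      S i \<noteq> [] \<and> (\<forall>s\<in>set (S i). 0 < s) \<and> t i \<in> open_simplex_product (S i) \<times> open_simplex (length (S i)) \<and>
      grid (S i) (t i) = face_trace \<Lambda> i" by metis
  \<comment> \<open>Filtering the increasing list of all faces keeps the face numbers strictly
    increasing, as an index requires.\<close>
  define F where "F = filter (\<lambda>i. face_trace \<Lambda> i \<noteq> {}) [0..<m]"
  define T where "T = map (\<lambda>i. (i, S i)) F"
  define J where "J = map (\<lambda>i. card (edge_trace \<Lambda> i)) [0..<n]"
  define w where "w = (\<lambda>q\<in>{..<length F}. t (F ! q))"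
  define z where "z = restrict u {..<n}"
  have F: "F ! q < m" "face_trace \<Lambda> (F ! q) \<noteq> {}" if "q < length F" for q
    using nth_mem[OF that] by (auto simp: F_def)
  have T: "length T = length F" "\<And>q. q < length F \<Longrightarrow> T ! q = (F ! q, S (F ! q))" by (auto simp: T_def)
  have J: "length J = n" "\<And>i. i < n \<Longrightarrow> J ! i = card (edge_trace \<Lambda> i)" by (auto simp: J_def)
  have fstT: "map fst T = F" by (simp add: T_def o_def)
  \<comment> \<open>For now the bound is the number of generators itself; it is identified with
    \<open>card \<Lambda> - 1\<close> at the end, once the points are known to be distinct and
    different from \<open>v\<close>.\<close>
  have c: "(T, J) \<in> cell_indices n m (card (gens (T, J)))"
    unfolding cell_indices_def mem_Collect_eq prod.case card_gens
  proof (intro conjI)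
    show "sorted_wrt (<) (map fst T)" unfolding fstT F_def by (intro sorted_wrt_filter) simp
    show "\<forall>(i, S)\<in>set T. i < m \<and> S \<noteq> [] \<and> (\<forall>s\<in>set S. 0 < s)"
      using S by (auto simp: T_def F_def)
  qed (use J in auto)
  have p: "(w, z) \<in> open_cell (T, J)"
    unfolding open_cell_iff
  proof (intro conjI allI impI)
    fix q assume "q < length T"
    then have q: "q < length F" using T(1) by simp
    then have "w q \<in> open_simplex_product (snd (T ! q)) \<times> open_simplex (length (snd (T ! q)))"
      using S[OF F[OF q]] by (simp add: T(2) w_def)
    then show "fst (w q) \<in> extensional {..<length (snd (T ! q))}"
      "snd (w q) \<in> open_simplex (length (snd (T ! q)))"
      "a < length (snd (T ! q)) \<Longrightarrow> fst (w q) a \<in> open_simplex (snd (T ! q) ! a)" for a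
      by (simp_all add: open_simplex_product_def mem_Times_iff PiE_iff)
  qed (use T J u in \<open>auto simp: w_def z_def\<close>)
  have "\<Lambda> = insert v (points (T, J) (w, z))"
  proof (intro equalityI subsetI)
    fix a assume a: "a \<in> \<Lambda>"
    then have "a \<in> topspace X" using L(1) by blast
    from disc_cover[OF this] consider "a = v" | i s where "i < n" "s \<in> {0<..<1}" "a = e i s"
      | i d where "i < m" "d \<in> ball 0 1" "a = \<phi> i d" by blast
    then show "a \<in> insert v (points (T, J) (w, z))"
    proof cases
      case 2
      then have "s \<in> edge_trace \<Lambda> i" using a by (simp add: edge_trace_def)
      then have "s \<in> z i ` {..<J ! i}" using u(2)[OF 2(1)] J(2)[OF 2(1)] 2(1) by (simp add: z_def)
      then have "s \<in> edge_trace (insert v (points (T, J) (w, z))) i"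
        using edge_trace_points[OF c p 2(1)] by blast
      then show ?thesis using 2(3) by (simp add: edge_trace_def)
    next
      case 3
      obtain x y where xy: "0 < x" "x < 1" "0 < y" "y < 1" "d = kappa (x, y)" using kappa_surj[OF 3(2)] .
      then have ft_xy: "(x, y) \<in> face_trace \<Lambda> i" using a 3(3) by (simp add: face_trace_def)
      then have "i \<in> set F" using 3(1) by (auto simp: F_def)
      then obtain q where q: "q < length F" "i = F ! q" by (metis in_set_conv_nth)
      have "(x, y) \<in> grid (snd (T ! q)) (w q)"
        using S[OF F[OF q(1)]] ft_xy q by (simp add: T(2) w_def)
      moreover have "face_trace (insert v (points (T, J) (w, z))) (fst (T ! q)) = grid (snd (T ! q)) (w q)"
        by (rule face_trace_points[OF c p]) (simp add: T(1) q(1))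
      ultimately have "(x, y) \<in> face_trace (insert v (points (T, J) (w, z))) i"
        using q T(2)[OF q(1)] by simp
      then show ?thesis using 3(3) xy(5) by (simp add: face_trace_def)
    qed simp
  next
    fix a assume "a \<in> insert v (points (T, J) (w, z))"
    then consider "a = v" | g where "g \<in> gens (T, J)" "a = gen_point e \<phi> (T, J) (w, z) g" by blast
    then show "a \<in> \<Lambda>"
    proof cases
      case 2
      from 2(1) show ?thesis
      proof (cases rule: gensE)
        case (Inl i b)
        then have "z i b \<in> edge_trace \<Lambda> i" using u(2)[of i] J by (auto simp: z_def)
        then show ?thesis using 2(2) unfolding Inl(1) gen_point_simps by (simp add: edge_trace_def)
      next
        case (Inr q a' b)
        then have q: "q < length F" using T(1) by simp
        have "(snd (w q) a', fst (w q) a' b) \<in> grid (snd (T ! q)) (w q)"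
          using Inr(3,4) by (auto simp: grid_def)
        then have "(snd (w q) a', fst (w q) a' b) \<in> face_trace \<Lambda> (fst (T ! q))"
          using S[OF F[OF q]] q by (simp add: T(2) w_def)
        then show ?thesis using 2(2) unfolding Inr(1) gen_point_simps by (simp add: face_trace_def)
      qed
    qed (use L(3) in simp)
  qed
  moreover have "card (gens (T, J)) = card \<Lambda> - 1"
  proof -
    have "\<Lambda> - {v} = points (T, J) (w, z)"
      using \<open>\<Lambda> = _\<close> points_open_cell(1)[OF c p] by blast
    then show ?thesis using points_open_cell(2)[OF c p] L(2,3) by (metis card_Diff_singleton)
  qed
  ultimately show ?thesis using that c p by metis
qed

lemma continuous_map_gen_point:
  assumes c: "(T, J) \<in> cell_indices n m r" and g: "g \<in> gens (T, J)"
  shows "continuous_map (cell_dom (T, J)) X (\<lambda>p. gen_point e \<phi> (T, J) p g)"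
proof -
  note cD = cell_indicesD[OF c]
  have unit: "continuous_map (simplex_space j) (top_of_set {0..1}) (\<lambda>u. u b)" if "b < j" for j b
  proof -
    have "continuous_on (topspace (simplex_space j)) (\<lambda>u. u b)" by (rule continuous_on_eval)
    moreover have "(\<lambda>u. u b) \<in> topspace (simplex_space j) \<rightarrow> {0..1}"
      using simplex_space_unit[OF _ that] by blast
    ultimately show ?thesis
      by (subst simplex_space_eq) (simp add: continuous_map_in_subtopology)
  qed
  have coord: "continuous_map (simplex_product S) (top_of_set {0..1}) (\<lambda>y. y a b)"
    if "a < length S" "b < S ! a" for S a b
  proof -
    have "continuous_map (simplex_product S) (simplex_space (S ! a)) (\<lambda>y. y a)"
      unfolding simplex_product_def
      using continuous_map_product_projection[of a "{..<length S}" "\<lambda>a. simplex_space (S ! a)"] that(1)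
      by simp
    from continuous_map_compose[OF this unit[OF that(2)]] show ?thesis by (simp add: o_def)
  qed
  from g show ?thesis
  proof (cases rule: gensE)
    case (Inl i b)
    have "continuous_map (cell_dom (T, J)) (simplex_product J) snd"
      unfolding cell_dom_def prod.case by (rule continuous_map_snd)
    from continuous_map_compose[OF continuous_map_compose[OF this coord[OF Inl(2,3)]] edge_cont[of i]] Inl(2) cD(1)
    have "continuous_map (cell_dom (T, J)) X (\<lambda>p. e i (snd p i b))" by (simp add: o_def)
    then show ?thesis by (simp add: Inl(1) gen_point_def case_prod_unfold)
  next
    case (Inr q a b)
    let ?S = "snd (T ! q)"
    have "continuous_map (cell_dom (T, J)) (tau_dom ?S) (\<lambda>p. fst p q)"
    proof -
      have "continuous_map (product_topology (\<lambda>q. tau_dom (snd (T ! q))) {..<length T}) (tau_dom ?S) (\<lambda>w. w q)"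
        using continuous_map_product_projection[of q "{..<length T}" "\<lambda>q. tau_dom (snd (T ! q))"] Inr(2)
        by simp
      from continuous_map_compose[OF continuous_map_fst this] show ?thesis
        unfolding cell_dom_def prod.case by (simp add: o_def)
    qed
    then have f: "continuous_map (cell_dom (T, J)) (simplex_product ?S) (\<lambda>p. fst (fst p q))"
      and s: "continuous_map (cell_dom (T, J)) (simplex_space (length ?S)) (\<lambda>p. snd (fst p q))"
      unfolding tau_dom_def by (auto simp: continuous_map_pairwise o_def)
    have xy: "continuous_map (cell_dom (T, J)) (prod_topology (top_of_set {0..1}) (top_of_set {0..1}))
        (\<lambda>p. (snd (fst p q) a, fst (fst p q) a b))"
      using continuous_map_compose[OF s unit[OF Inr(3)]] continuous_map_compose[OF f coord[OF Inr(3,4)]]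
      unfolding continuous_map_pairwise o_def fst_conv snd_conv by (rule conjI)
    have "continuous_map (prod_topology (top_of_set {0..1}) (top_of_set {0..1})) (top_of_set (cball 0 1)) kappa"
      unfolding prod_topology_subtopology_eu continuous_map_in_subtopology continuous_map_iff_continuous
      using kappa_in_cball by (auto simp: continuous_on_kappa simp del: mem_cball)
    from continuous_map_compose[OF continuous_map_compose[OF xy this] face_cont[OF cD(2)[OF Inr(2)]]]
    show ?thesis by (simp add: Inr(1) gen_point_def case_prod_unfold o_def)
  qed
qed

end

subsection \<open>The cells of the finite subset spaces\<close>

text \<open>The index left out of the free family is exactly the one whose cell would have the empty
  set as its value.\<close>

lemma gens_eq_empty:
  assumes "c \<in> cell_indices n m r"
  shows "gens c = {} \<longleftrightarrow> fst c = [] \<and> sum_list (snd c) = 0"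
proof -
  obtain T J where c: "c = (T, J)" by (cases c)
  note cD = cell_indicesD[OF assms[unfolded c]]
  have "gens (T, J) \<noteq> {}" if "T \<noteq> []"
  proof -
    have "0 < length T" using that by simp
    then have "0 < length (snd (T ! 0))" "0 < snd (T ! 0) ! 0" using cD(3,4)[of 0] by auto
    then show ?thesis using InrI_gens[OF \<open>0 < length T\<close>] by blast
  qed
  moreover have "gens (T, J) = {} \<longleftrightarrow> sum_list J + (\<Sum>(i, S)\<leftarrow>T. sum_list S) = 0"
    using card_gens[of T J] finite_gens[of "(T, J)"] by (metis card_0_eq)
  ultimately show ?thesis unfolding c fst_conv snd_conv
    by (metis add_cancel_right_left add_eq_0_iff_both_eq_0 list.map(1) sum_list.Nil)
qed

context one_vertex_complex
begin

lemma continuous_map_points: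
  assumes c: "c \<in> cell_indices n m r"
  shows "gens c \<noteq> {} \<Longrightarrow> r \<le> k \<Longrightarrow> continuous_map (cell_dom c) (exp_space k X) (\<lambda>p. points c p)"
    and "r < k \<Longrightarrow> continuous_map (cell_dom c) (exp_space k X) (\<lambda>p. insert v (points c p))"
proof -
  obtain T J where TJ: "c = (T, J)" by (cases c)
  note c = c[unfolded TJ]
  have card: "card (gens c) \<le> r" using cell_indicesD(7)[OF c] TJ by simp
  show "continuous_map (cell_dom c) (exp_space k X) (\<lambda>p. points c p)" if "gens c \<noteq> {}" "r \<le> k"
    using that card continuous_map_gen_point[OF c] finite_gens
    by (intro continuous_map_exp_space) (auto simp: TJ)
  show "continuous_map (cell_dom c) (exp_space k X) (\<lambda>p. insert v (points c p))" if "r < k"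
  proof -
    \<comment> \<open>\<open>None\<close> is an extra generator with the constant value
      \<open>v\<close>, so there are at most \<open>r + 1 \<le> k\<close> generators in all.\<close>
    let ?F = "\<lambda>g p. case g of None \<Rightarrow> v | Some g \<Rightarrow> gen_point e \<phi> c p g"
    have "card (insert None (Some ` gens c)) \<le> k"
      using that card by (simp add: finite_gens card_image)
    then have "continuous_map (cell_dom c) (exp_space k X) (\<lambda>p. (\<lambda>g. ?F g p) ` insert None (Some ` gens c))"
      using continuous_map_gen_point[OF c] vertex finite_gens
      by (intro continuous_map_exp_space) (auto simp: TJ)
    then show ?thesis by (simp add: image_image)
  qed
qed

lemma points_boundary:
  assumes "c \<in> cell_indices n m r" "p \<in> topspace (cell_dom c)" "p \<notin> open_cell c"
  shows "complexity (insert v (points c p)) < cell_dim c"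
  using assms by (cases c, cases p) (simp only: complexity_boundary)

lemma points_interior:
  assumes "c \<in> cell_indices n m r" "p \<in> open_cell c"
  shows "v \<notin> points c p" and "complexity (insert v (points c p)) = cell_dim c"
proof -
  obtain T J w z where TJ: "c = (T, J)" "p = (w, z)" by (metis surj_pair)
  show "v \<notin> points c p" "complexity (insert v (points c p)) = cell_dim c"
    using points_open_cell(1,3)[OF assms[unfolded TJ]] unfolding TJ .
qed

lemma points_unique:
  assumes "c \<in> cell_indices n m r" "p \<in> open_cell c" "c' \<in> cell_indices n m r'" "p' \<in> open_cell c'"
    and "insert v (points c p) = insert v (points c' p')"
  shows "c = c' \<and> p = p'"
proof -
  obtain T J w z T' J' w' z' where "c = (T, J)" "p = (w, z)" "c' = (T', J')" "p' = (w', z')"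
    by (metis surj_pair)
  then show ?thesis using open_cell_unique[of T J r w z T' J' r' w' z'] assms by simp
qed

lemma points_exist:
  assumes "\<Lambda> \<subseteq> topspace X" "finite \<Lambda>" "v \<in> \<Lambda>" "card \<Lambda> \<le> Suc r"
  obtains c p where "c \<in> cell_indices n m r" "p \<in> open_cell c" "\<Lambda> = insert v (points c p)"
proof -
  obtain T J w z where "(T, J) \<in> cell_indices n m (card \<Lambda> - 1)" "(w, z) \<in> open_cell (T, J)"
    "\<Lambda> = insert v (points (T, J) (w, z))" using open_cell_exists[OF assms(1-3)] .
  moreover from this(1) have "(T, J) \<in> cell_indices n m r"
    using assms(4) by (auto simp: cell_indices_def)
  ultimately show ?thesis using that by blast
qed

lemma based_cell_structure:
  assumes k: "k \<ge> 1"
  shows "cell_structure (exp_space_at k X v) (cell_indices n m (k - 1)) cell_dim cell_dom (based_cell v e \<phi>)"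
proof (rule cell_structure_finiteI[where U = open_cell])
  let ?I = "cell_indices n m (k - 1)"
  have top: "topspace (exp_space_at k X v) = {\<Lambda> \<in> exp_set k X. v \<in> \<Lambda>}"
    using topspace_exp_space[OF k, of X] by (auto simp: exp_space_at_def)
  show "Hausdorff_space (exp_space_at k X v)"
    unfolding exp_space_at_def by (intro Hausdorff_space_subtopology Hausdorff_exp_space Hausdorff k)
  show "finite ?I" by (rule finite_cell_indices)
  show "ball_pair (cell_dim c) (cell_dom c) (open_cell c)" for c by (rule ball_pair_cell)
  show cont: "continuous_map (cell_dom c) (exp_space_at k X v) (based_cell v e \<phi> c)" if "c \<in> ?I" for c
    using continuous_map_points(2)[OF that, of k] k
    unfolding exp_space_at_def continuous_map_in_subtopology based_cell_eq[abs_def] by auto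
  show "inj_on (based_cell v e \<phi> c) (open_cell c)" if "c \<in> ?I" for c
    using points_unique[OF that _ that] by (intro inj_onI) (simp only: based_cell_eq)
  show "disjoint_family_on (\<lambda>c. based_cell v e \<phi> c ` open_cell c) ?I"
    unfolding disjoint_family_on_def
  proof (intro ballI impI)
    fix c c' assume c: "c \<in> ?I" "c' \<in> ?I" "c \<noteq> c'"
    show "based_cell v e \<phi> c ` open_cell c \<inter> based_cell v e \<phi> c' ` open_cell c' = {}"
      using points_unique[OF c(1) _ c(2)] c(3) unfolding based_cell_eq[abs_def] by blast
  qed
  \<comment> \<open>This gives the covering and, since values on the boundary of a cell have smaller
    complexity, also the cell of lower dimension in which they lie.\<close>
  have exist: "\<exists>c\<in>?I. \<Lambda> \<in> based_cell v e \<phi> c ` open_cell c \<and> cell_dim c = complexity \<Lambda>"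
    if L: "\<Lambda> \<in> topspace (exp_space_at k X v)" for \<Lambda>
  proof -
    have "\<Lambda> \<subseteq> topspace X" "finite \<Lambda>" "v \<in> \<Lambda>" "card \<Lambda> \<le> Suc (k - 1)"
      using L k unfolding top by (auto simp: exp_set_def)
    from points_exist[OF this] obtain c p where
      c: "c \<in> ?I" "p \<in> open_cell c" "\<Lambda> = insert v (points c p)" .
    then have "\<Lambda> \<in> based_cell v e \<phi> c ` open_cell c" "cell_dim c = complexity \<Lambda>"
      using points_interior(2)[OF c(1,2)] by (auto simp: based_cell_eq)
    then show ?thesis using c(1) by (intro bexI[of _ c]) auto
  qed
  then show "topspace (exp_space_at k X v) \<subseteq> (\<Union>c\<in>?I. based_cell v e \<phi> c ` open_cell c)" by blast
  fix c p assume c: "c \<in> ?I" and p: "p \<in> topspace (cell_dom c) - open_cell c"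
  have "based_cell v e \<phi> c p \<in> topspace (exp_space_at k X v)"
    using cont[OF c] p by (meson DiffD1 continuous_map_funspace funcset_mem)
  then obtain c' where c': "c' \<in> ?I" "based_cell v e \<phi> c p \<in> based_cell v e \<phi> c' ` open_cell c'"
    "cell_dim c' = complexity (based_cell v e \<phi> c p)" using exist by blast
  have "complexity (based_cell v e \<phi> c p) < cell_dim c"
    using points_boundary[OF c, of p] p unfolding based_cell_eq by blast
  with c' show "\<exists>c'\<in>?I. cell_dim c' < cell_dim c \<and> based_cell v e \<phi> c p \<in> based_cell v e \<phi> c' ` open_cell c'"
    by (intro bexI[of _ c']) simp_all
qed

text \<open>A based and a free open cell with the same index have the same traces, and only
  membership of \<open>v\<close> tells them apart. Inserting \<open>v\<close> before taking the
  complexity gives the dimension in both families, and a boundary value of a free cell may fall into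
  either.\<close>

lemma full_cell_structure:
  assumes k: "k \<ge> 1"
  shows "cell_structure (exp_space k X) (cell_indices n m (k - 1) <+> free_cell_indices n m k)
    (case_sum cell_dim cell_dim) (case_sum cell_dom cell_dom)
    (case_sum (based_cell v e \<phi>) (free_cell e \<phi>))"
proof (rule cell_structure_finiteI[where U = "case_sum open_cell open_cell"])
  let ?A = "cell_indices n m (k - 1)" and ?B = "free_cell_indices n m k"
  let ?I = "?A <+> ?B" and ?f = "case_sum (based_cell v e \<phi>) (free_cell e \<phi>)"
  let ?U = "case_sum open_cell open_cell"
  have B: "c \<in> ?B \<longleftrightarrow> c \<in> cell_indices n m k \<and> gens c \<noteq> {}" for c
    using gens_eq_empty[of c n m k] by (cases c) (auto simp: free_cell_indices_def)
  have BD: "c \<in> cell_indices n m k" if "c \<in> ?B" for c using that B by blast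
  have top: "topspace (exp_space k X) = exp_set k X" by (rule topspace_exp_space[OF k])
  show "Hausdorff_space (exp_space k X)" by (intro Hausdorff_exp_space Hausdorff k)
  show "finite ?I"
    using finite_cell_indices BD by (meson finite_Plus finite_subset subsetI)
  show "ball_pair (case_sum cell_dim cell_dim s) (case_sum cell_dom cell_dom s) (?U s)" for s
    by (cases s) (simp_all add: ball_pair_cell)
  show cont: "continuous_map (case_sum cell_dom cell_dom s) (exp_space k X) (?f s)" if "s \<in> ?I" for s
  proof (cases s)
    case (Inl c)
    then have "c \<in> ?A" using that by auto
    then show ?thesis using continuous_map_points(2)[of c "k - 1" k] k Inl
      by (simp add: based_cell_eq[abs_def])
  next
    case (Inr c)
    then have "c \<in> ?B" using that by auto
    then show ?thesis using continuous_map_points(1)[of c k k] B Inr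
      by (simp add: free_cell_eq[abs_def])
  qed
  have vbased: "v \<in> ?f (Inl c) p" for c p by (simp add: based_cell_eq)
  have vfree: "v \<notin> ?f (Inr c) p" if "c \<in> ?B" "p \<in> ?U (Inr c)" for c p
    using points_interior(1)[OF BD[OF that(1)]] that(2) by (simp add: free_cell_eq)
  have ins: "insert v (?f (Inl c) p) = insert v (points c p)" "insert v (?f (Inr c) p) = insert v (points c p)" for c p
    by (simp_all add: based_cell_eq free_cell_eq)
  have unique: "s = s' \<and> p = p'"
    if s: "s \<in> ?I" "s' \<in> ?I" and p: "p \<in> ?U s" "p' \<in> ?U s'" and eq: "?f s p = ?f s' p'" for s s' p p'
  proof -
    have ins_eq: "insert v (?f s p) = insert v (?f s' p')" using eq by simp
    obtain c c' where "s = Inl c \<and> s' = Inl c' \<or> s = Inr c \<and> s' = Inr c' \<or>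
        s = Inl c \<and> s' = Inr c' \<or> s = Inr c \<and> s' = Inl c'"
      by (cases s; cases s') blast+
    then consider (based) "s = Inl c" "s' = Inl c'" | (free) "s = Inr c" "s' = Inr c'"
      | (mixed) "s = Inl c" "s' = Inr c'" | (mixed') "s = Inr c" "s' = Inl c'"
      by blast
    then show ?thesis
    proof cases
      case based
      have "c = c' \<and> p = p'"
      proof (rule points_unique)
        show "c \<in> ?A" "c' \<in> ?A" "p \<in> open_cell c" "p' \<in> open_cell c'" using s p based by auto
        show "insert v (points c p) = insert v (points c' p')" using ins_eq unfolding based ins .
      qed
      then show ?thesis using based by simp
    next
      case free
      have "c = c' \<and> p = p'"
      proof (rule points_unique)
        show "c \<in> cell_indices n m k" "c' \<in> cell_indices n m k" "p \<in> open_cell c" "p' \<in> open_cell c'"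
          using s p free BD by auto
        show "insert v (points c p) = insert v (points c' p')" using ins_eq unfolding free ins .
      qed
      then show ?thesis using free by simp
    next
      case mixed
      then have "c' \<in> ?B" using s by auto
      from vfree[OF this, of p'] have False using p(2) eq vbased[of c p] unfolding mixed by simp
      then show ?thesis ..
    next
      case mixed'
      then have "c \<in> ?B" using s by auto
      from vfree[OF this, of p] have False using p(1) eq vbased[of c' p'] unfolding mixed' by simp
      then show ?thesis ..
    qed
  qed
  show "inj_on (?f s) (?U s)" if "s \<in> ?I" for s
    using unique[OF that that] by (intro inj_onI) blast
  show "disjoint_family_on (\<lambda>s. ?f s ` ?U s) ?I"
    unfolding disjoint_family_on_def using unique by blast
  have exist: "\<exists>s\<in>?I. \<Lambda> \<in> ?f s ` ?U s \<and> case_sum cell_dim cell_dim s = complexity (insert v \<Lambda>)"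
    if L: "\<Lambda> \<in> topspace (exp_space k X)" for \<Lambda>
  proof (cases "v \<in> \<Lambda>")
    case True
    have "\<Lambda> \<subseteq> topspace X" "finite \<Lambda>" "card \<Lambda> \<le> Suc (k - 1)"
      using L k unfolding top by (auto simp: exp_set_def)
    from points_exist[OF this(1,2) True this(3)] obtain c p where
      c: "c \<in> ?A" "p \<in> open_cell c" "\<Lambda> = insert v (points c p)" .
    then have "\<Lambda> \<in> ?f (Inl c) ` ?U (Inl c)" "cell_dim c = complexity (insert v \<Lambda>)"
      using points_interior(2)[OF c(1,2)] by (auto simp: based_cell_eq)
    then show ?thesis using c(1) by (intro bexI[of _ "Inl c"]) auto
  next
    case False
    \<comment> \<open>Adding \<open>v\<close> can produce \<open>k + 1\<close> points, so the index
      is sought with bound \<open>k\<close>, the one for the free family.\<close>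
    have L': "insert v \<Lambda> \<subseteq> topspace X" "finite (insert v \<Lambda>)" "card (insert v \<Lambda>) \<le> Suc k" "\<Lambda> \<noteq> {}"
      using L vertex False unfolding top by (auto simp: exp_set_def)
    from points_exist[OF this(1,2) insertI1 this(3)] obtain c p where
      c: "c \<in> cell_indices n m k" "p \<in> open_cell c" "insert v \<Lambda> = insert v (points c p)" .
    have L: "\<Lambda> = points c p" using c(3) insert_ident[OF False points_interior(1)[OF c(1,2)]] by (rule iffD1[rotated])
    then have "c \<in> ?B" using B c(1) L'(4) by auto
    moreover have "\<Lambda> \<in> ?f (Inr c) ` ?U (Inr c)" "cell_dim c = complexity (insert v \<Lambda>)"
      using points_interior(2)[OF c(1,2)] c(2) L by (auto simp: free_cell_eq)
    ultimately show ?thesis by (intro bexI[of _ "Inr c"]) auto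
  qed
  then show "topspace (exp_space k X) \<subseteq> (\<Union>s\<in>?I. ?f s ` ?U s)" by blast
  fix s p assume s: "s \<in> ?I" and p: "p \<in> topspace (case_sum cell_dom cell_dom s) - ?U s"
  have "?f s p \<in> topspace (exp_space k X)"
    using cont[OF s] p by (meson DiffD1 continuous_map_funspace funcset_mem)
  then obtain s' where s': "s' \<in> ?I" "?f s p \<in> ?f s' ` ?U s'"
    "case_sum cell_dim cell_dim s' = complexity (insert v (?f s p))"
    using exist by blast
  have "complexity (insert v (?f s p)) < case_sum cell_dim cell_dim s"
  proof (cases s)
    case (Inl c)
    then show ?thesis using points_boundary[of c "k - 1" p] s p by (auto simp: based_cell_eq)
  next
    case (Inr c)
    then show ?thesis using points_boundary[of c k p] BD s p by (auto simp: free_cell_eq)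
  qed
  with s' show "\<exists>s'\<in>?I. case_sum cell_dim cell_dim s' < case_sum cell_dim cell_dim s \<and> ?f s p \<in> ?f s' ` ?U s'"
    by (intro bexI[of _ s'] conjI) (simp_all only:)
qed

end

theorem theorem6:
  fixes X :: "'a topology" and v :: 'a
    and n m k :: nat
    and e :: "nat \<Rightarrow> real \<Rightarrow> 'a" and \<phi> :: "nat \<Rightarrow> complex \<Rightarrow> 'a"
  assumes "one_vertex_2_complex X v n e m \<phi>"
    and "connected_space X"
    and "k \<ge> 1"
  shows "cell_structure (exp_space_at k X v)
           (cell_indices n m (k - 1)) cell_dim cell_dom (based_cell v e \<phi>)
       \<and> cell_structure (exp_space k X)
           (cell_indices n m (k - 1) <+> free_cell_indices n m k)
           (case_sum cell_dim cell_dim) (case_sum cell_dom cell_dom)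
           (case_sum (based_cell v e \<phi>) (free_cell e \<phi>))"
proof -
  interpret one_vertex_complex X v n m e \<phi>
    by (rule one_vertex_complexI[OF assms(1)])
  show ?thesis using based_cell_structure[OF assms(3)] full_cell_structure[OF assms(3)] by blast
qed

end
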